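(* Let $n\geq 1$ be a natural number, and let $p,q$ be real numbers with $1<p\leq 2$ and $1<q\leq p-1+\frac{p}{n}$. Let $\mathbb S=(0,+\infty)\times\mathbb R^n$. Let $u$ be an entire weak super-solution and $v$ an entire weak sub-solution in $\mathbb S$ of the equation $$w_t-\Delta_p(w)=|w|^{q-1}w,$$ such that $u\geq v$ a.e. in $\mathbb S$. Then $u=v$ a.e. in $\mathbb S$.
   Context: Points of $\mathbb S=(0,+\infty)\times\mathbb R^n$ are written $(t,x)$ with $t>0$, $x\in\mathbb R^n$; $\nabla_x$ is the gradient in the $x$ variables. The $p$-Laplacian is $\Delta_p(w)=\mathrm{div}_x(|\nabla_x w|^{p-2}\nabla_x w)$, with the convention that $|\xi|^{p-2}\xi=0$ when $\xi=0$. Partial derivatives $u_t$, $u_{x_i}$ are understood in the weak (distributional) sense in $\mathbb S$. The notation $L_{r,\mathrm{loc}}(\mathbb S)$ means the measurable functions $f$ on $\mathbb S$ with $|f|^r$ integrable on every compact subset of the open set $\mathbb S$. Definition (for $n\ge 1$, $p>1$, $q>0$). A measurable function $u=u(t,x)$ on $\mathbb S$ is an entire weak super-solution of $w_t-\Delta_p(w)=|w|^{q-1}w$ in $\mathbb S$ if $u\in L_{q,\mathrm{loc}}(\mathbb S)$, $u_t\in L_{1,\mathrm{loc}}(\mathbb S)$, $|\nabla_x u|^p\in L_{1,\mathrm{loc}}(\mathbb S)$, and $$\int_{\mathbb S}\Big[u_t\varphi+\sum_{i=1}^n|\nabla_x u|^{p-2}u_{x_i}\varphi_{x_i}-|u|^{q-1}u\,\varphi\Big]\,dt\,dx\geq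 0$$ for every non-negative $\varphi\in C^\infty(\mathbb S)$ with compact support in $\mathbb S$. A function $v=v(t,x)$ is an entire weak sub-solution of the equation in $\mathbb S$ if $-v$ is an entire weak super-solution of the equation in $\mathbb S$. No condition is imposed on the behaviour of $u$, $v$ at $t=0$ or at infinity. *)

theory Defs
  imports "HOL-Analysis.Analysis"
begin

text \<open>Points of \<open>(0,+\<infinity>) \<times> \<real>\<^sup>n\<close> are pairs \<open>(t, x)\<close> of type
  \<open>real \<times> (real ^ 'n)\<close> with \<open>n = CARD('n)\<close>. Measurability and integrals are those of
  Lebesgue measure.\<close>

definition half_space :: "(real \<times> (real ^ 'n)) set" where
  "half_space = {0<..} \<times> UNIV"

definition t_dir :: "real \<times> (real ^ 'n)" where
  "t_dir = (1, 0)"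

definition x_dir :: "'n \<Rightarrow> real \<times> (real ^ 'n)" where
  "x_dir i = (0, axis i 1)"

definition partial :: "'a::real_normed_vector \<Rightarrow> ('a \<Rightarrow> real) \<Rightarrow> 'a \<Rightarrow> real" where
  "partial b f z = frechet_derivative f (at z) b"

text \<open>The following is meant for open \<open>S\<close>. Differentiability at every stage makes
  \<open>partial\<close> a genuine derivative.\<close>

primrec C_k_on :: "nat \<Rightarrow> 'a::euclidean_space set \<Rightarrow> ('a \<Rightarrow> real) \<Rightarrow> bool" where
  "C_k_on 0 S f \<longleftrightarrow> continuous_on S f"
| "C_k_on (Suc k) S f \<longleftrightarrow>
     (\<forall>z\<in>S. f differentiable at z) \<and> (\<forall>b\<in>Basis. C_k_on k S (partial b f))"

definition C_inf_on :: "'a::euclidean_space set \<Rightarrow> ('a \<Rightarrow> real) \<Rightarrow> bool" where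
  "C_inf_on S f \<longleftrightarrow> (\<forall>k. C_k_on k S f)"

text \<open>\<open>C\<^sup>\<infinity>\<close> functions on the open set \<open>S\<close> with compact support in \<open>S\<close>, identified with
  their extension by zero to the whole space.\<close>

definition test_fun :: "'a::euclidean_space set \<Rightarrow> ('a \<Rightarrow> real) \<Rightarrow> bool" where
  "test_fun S \<phi> \<longleftrightarrow>
     C_inf_on S \<phi> \<and> compact (closure {z. \<phi> z \<noteq> 0}) \<and> closure {z. \<phi> z \<noteq> 0} \<subseteq> S"

definition L_loc :: "real \<Rightarrow> 'a::euclidean_space set \<Rightarrow> ('a \<Rightarrow> real) \<Rightarrow> bool" where
  "L_loc r S f \<longleftrightarrow>
     f \<in> borel_measurable (lebesgue_on S) \<and>
     (\<forall>K. compact K \<and> K \<subseteq> S \<longrightarrow> set_integrable lebesgue K (\<lambda>z. \<bar>f z\<bar> powr r))"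

text \<open>\<open>g\<close> is a weak derivative of \<open>f\<close> in the direction \<open>b\<close>; it is unique up to null sets.
  Both functions must be locally integrable to be identified with distributions.\<close>

definition has_weak_partial ::
  "'a::euclidean_space set \<Rightarrow> 'a \<Rightarrow> ('a \<Rightarrow> real) \<Rightarrow> ('a \<Rightarrow> real) \<Rightarrow> bool" where
  "has_weak_partial S b f g \<longleftrightarrow>
     L_loc 1 S f \<and> L_loc 1 S g \<and>
     (\<forall>\<phi>. test_fun S \<phi> \<longrightarrow>
        (LINT z:S|lebesgue. f z * partial b \<phi> z) = - (LINT z:S|lebesgue. g z * \<phi> z))"

text \<open>In the last conjunct, at a zero of \<open>ux\<close> the term with \<open>norm (ux z) powr (p - 2)\<close>
  vanishes, because the component \<open>ux z $ i\<close> does; this is the convention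
  \<open>|\<xi>|\<^sup>p\<^sup>-\<^sup>2 \<xi> = 0\<close> for \<open>\<xi> = 0\<close>.\<close>

definition entire_weak_super_solution ::
  "real \<Rightarrow> real \<Rightarrow> (real \<times> (real ^ 'n) \<Rightarrow> real) \<Rightarrow> bool" where
  "entire_weak_super_solution p q u \<longleftrightarrow>
     L_loc q half_space u \<and>
     (\<exists>ut ux.
        has_weak_partial half_space t_dir u ut \<and>
        (\<forall>i. has_weak_partial half_space (x_dir i) u (\<lambda>z. ux z $ i)) \<and>
        L_loc 1 half_space ut \<and>
        L_loc 1 half_space (\<lambda>z. norm (ux z) powr p) \<and>
        (\<forall>\<phi>. test_fun half_space \<phi> \<and> (\<forall>z\<in>half_space. \<phi> z \<ge> 0) \<longrightarrow>
           (LINT z:half_space|lebesgue.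
              ut z * \<phi> z
              + (\<Sum>i\<in>UNIV. norm (ux z) powr (p - 2) * (ux z $ i) * partial (x_dir i) \<phi> z)
              - \<bar>u z\<bar> powr (q - 1) * u z * \<phi> z) \<ge> 0))"

definition entire_weak_sub_solution ::
  "real \<Rightarrow> real \<Rightarrow> (real \<times> (real ^ 'n) \<Rightarrow> real) \<Rightarrow> bool" where
  "entire_weak_sub_solution p q v \<longleftrightarrow> entire_weak_super_solution p q (\<lambda>z. - v z)"

end

(* Write w = u - v >= 0.  For 1 < p <= 2 the difference F of the two fluxes satisfies
   F . grad w >= c |F|^(p/(p-1)), and the difference of the sources is at least c w^q.  Testing the
   difference of the inequalities with (w + nu)^(-s) mu and absorbing by Young's inequality bounds
   the integral of |F|^(p/(p-1)) (w + nu)^(-s-1) mu; testing with mu alone then bounds the integral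
   of w^q mu.  The cutoff mu lives on a parabolic region of duration eps^(-(q-1)) and radius
   eps^(-(q-p+1)/p), on which the integral of eps^q stays bounded exactly when q <= p - 1 + p/n.
   Hence w^q is integrable, and then the terms carrying derivatives of mu tend to zero as
   eps -> 0, which gives w = 0.  No condition at t = 0 is needed, because the part of the
   derivative of mu that comes from the cutoff near t = 0 enters with the favourable sign.

   Test functions depending on w are avoided: the inequality is mollified, which makes it a
   pointwise inequality between smooth functions, multiplied by (w + nu)^(-s) mu and integrated by
   parts classically, and only then is the mollification removed. *)

theory Submission
  imports Defs
begin

section \<open>Mollifiers\<close>

text \<open>Replacing \<open>v\<close> by \<open>- v\<close> turns the pair into two super-solutions
  with non-negative sum, so every difference becomes a sum and the two functions play symmetric
  roles. The hypothesis \<open>p \<le> 2\<close> enters through duality: the inverse of the vector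
  field of exponent \<open>p\<close> is the field of the conjugate exponent
  \<open>r \<ge> 2\<close>, which is strongly monotone; therefore coercivity is measured by the flux
  and not by the gradient. At the critical \<open>q\<close> the product of \<epsilon>^q and the
  volume is merely bounded, so scaling alone yields integrability of w^q but not its vanishing. Two
  devices close this gap. The derivatives of the cutoff carry a factor \<open>\<sigma>\<close> that
  tends to 0 at each fixed point; Young's inequality keeps this factor on the w^q term, where it
  compensates a large weight \<open>A\<close>, while large \<open>A\<close> makes the \<epsilon>^q
  term small. The flux term is given the weight \<eta> \<epsilon>^s; the first estimate bounds
  exactly \<epsilon>^s times the weighted flux integral, so only \<eta> is left. The limits are
  taken in the order \<epsilon> to 0, \<open>A\<close> to infinity, \<eta> to 0.\<close>

definition exp_bump :: "nat \<Rightarrow> real \<Rightarrow> real" where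
  "exp_bump k t = (if t > 0 then exp (- (1 / t)) / t ^ k else 0)"

lemma exp_bump_nonneg: "0 \<le> exp_bump k t"
  by (simp add: exp_bump_def)

text \<open>One term of the exponential series, that of index \<open>k + 2\<close>, already
  dominates. The quadratic bound is what produces the derivative 0 at the origin.\<close>

lemma exp_bump_le: "exp_bump k t \<le> fact (k + 2) * t\<^sup>2"
proof (cases "t > 0")
  case True
  have "(1 / t) ^ (k + 2) / fact (k + 2) \<le> exp (1 / t)"
  proof -
    have "(\<Sum>n\<in>{k+2}. (1 / t) ^ n /\<^sub>R fact n) \<le> (\<Sum>n. (1 / t) ^ n /\<^sub>R fact n)"
      using True by (intro sum_le_suminf summable_exp_generic) auto
    then show ?thesis by (simp add: exp_def divide_inverse mult.commute)
  qed
  then have "1 / t ^ (k + 2) \<le> fact (k + 2) * exp (1 / t)"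
    by (simp only: power_one_over pos_divide_le_eq[OF fact_gt_zero] mult.commute)
  then have "exp (- (1 / t)) * (1 / t ^ (k + 2)) \<le> exp (- (1 / t)) * (fact (k + 2) * exp (1 / t))"
    by (intro mult_left_mono) auto
  also have "\<dots> = fact (k + 2)" by (simp add: exp_minus field_simps)
  finally have "exp (- (1 / t)) * (1 / t ^ (k + 2)) * t\<^sup>2 \<le> fact (k + 2) * t\<^sup>2"
    by (intro mult_right_mono) auto
  moreover have "exp (- (1 / t)) * (1 / t ^ (k + 2)) * t\<^sup>2 = exp_bump k t"
    using True by (simp add: exp_bump_def power_add power2_eq_square)
  ultimately show ?thesis by simp
qed (simp add: exp_bump_def)

text \<open>Differentiation stays within the family over all \<open>k\<close>, which is why powers
  of \<open>t\<close> are part of the definition. At 0 the difference quotient is O(h) by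
  \<open>exp_bump_le\<close>, and the claimed derivative is 0 there through the default branch of
  the definition.\<close>

lemma exp_bump_has_derivative:
  "(exp_bump k has_real_derivative (exp_bump (k + 2) t - real k * exp_bump (k + 1) t)) (at t)"
proof -
  consider "t > 0" | "t < 0" | "t = 0" by linarith
  then show ?thesis
  proof cases
    case 1
    have eq: "(k::real) * t ^ (k - Suc 0) = k * t ^ k / t"
      using 1 by (cases k) auto
    have "((\<lambda>t. exp (- (1 / t)) / t ^ k) has_real_derivative
        (exp_bump (k + 2) t - real k * exp_bump (k + 1) t)) (at t)"
      using 1
      by (auto intro!: derivative_eq_intros simp: exp_bump_def eq)
         (simp add: field_simps power2_eq_square)
    then show ?thesis
      by (rule has_field_derivative_transform_within_open[of _ _ _ "{0<..}"])
         (use 1 in \<open>auto simp: exp_bump_def\<close>)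
  next
    case 2
    have "((\<lambda>t. 0) has_real_derivative (exp_bump (k + 2) t - real k * exp_bump (k + 1) t)) (at t)"
      using 2 by (auto simp: exp_bump_def)
    then show ?thesis
      by (rule has_field_derivative_transform_within_open[of _ _ _ "{..<0}"])
         (use 2 in \<open>auto simp: exp_bump_def\<close>)
  next
    case 3
    have "(\<lambda>h. exp_bump k h / h) \<midarrow>0\<rightarrow> 0"
    proof (rule Lim_null_comparison)
      show "eventually (\<lambda>h. norm (exp_bump k h / h) \<le> fact (k + 2) * \<bar>h\<bar>) (at 0)"
      proof (rule always_eventually, rule allI)
        fix h :: real
        show "norm (exp_bump k h / h) \<le> fact (k + 2) * \<bar>h\<bar>"
        proof (cases "h = 0")
          case False
          have "exp_bump k h \<le> fact (k + 2) * \<bar>h\<bar> * \<bar>h\<bar>"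
            using exp_bump_le[of k h] by (simp add: power2_eq_square del: fact_Suc)
          then have "exp_bump k h / \<bar>h\<bar> \<le> fact (k + 2) * \<bar>h\<bar>"
            by (subst pos_divide_le_eq) (use False in \<open>auto simp del: fact_Suc\<close>)
          then show ?thesis by (simp add: exp_bump_nonneg)
        qed simp
      qed
      show "(\<lambda>h. fact (k + 2) * \<bar>h\<bar>) \<midarrow>0\<rightarrow> (0::real)"
        by (auto intro!: tendsto_eq_intros)
    qed
    then show ?thesis using 3
      by (simp add: DERIV_def exp_bump_def cong: if_cong)
  qed
qed

text \<open>Smoothness without formulas for higher derivatives: this algebra contains the bump and
  is closed under directional derivatives. Coordinates are generators because differentiating
  \<open>z \<bullet> z\<close> produces them.\<close>

inductive_set bump_alg :: "real \<Rightarrow> ('a::euclidean_space \<Rightarrow> real) set" for d where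
  const: "(\<lambda>z. c) \<in> bump_alg d"
| coord: "(\<lambda>z. z \<bullet> b) \<in> bump_alg d"
| bump: "(\<lambda>z. exp_bump k (d - z \<bullet> z)) \<in> bump_alg d"
| add: "f \<in> bump_alg d \<Longrightarrow> g \<in> bump_alg d \<Longrightarrow> (\<lambda>z. f z + g z) \<in> bump_alg d"
| mult: "f \<in> bump_alg d \<Longrightarrow> g \<in> bump_alg d \<Longrightarrow> (\<lambda>z. f z * g z) \<in> bump_alg d"

lemma bump_alg_derivative:
  assumes "f \<in> bump_alg d"
  shows "\<exists>D. (\<forall>z. (f has_derivative D z) (at z)) \<and> (\<forall>b. (\<lambda>z. D z b) \<in> bump_alg d)"
  using assms
proof induction
  case (const c)
  show ?case by (rule exI[of _ "\<lambda>z b. 0"]) (auto intro: bump_alg.const)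
next
  case (coord b)
  show ?case
    by (rule exI[of _ "\<lambda>z c. c \<bullet> b"]) (auto intro: bump_alg.const intro!: derivative_eq_intros)
next
  case (bump k)
  let ?e = "\<lambda>z. exp_bump (k + 2) (d - z \<bullet> z) - real k * exp_bump (k + 1) (d - z \<bullet> z)"
  show ?case
  proof (rule exI[of _ "\<lambda>z b. (exp_bump (k + 2) (d - z \<bullet> z) + (- real k) * exp_bump (k + 1) (d - z \<bullet> z)) * ((-2) * (z \<bullet> b))"],
      intro conjI allI)
    fix z :: 'a
    have "((\<lambda>z. exp_bump k (d - z \<bullet> z)) has_derivative (\<lambda>b. ?e z * (- (z \<bullet> b + b \<bullet> z)))) (at z)"
      by (rule has_derivative_compose[where f = "\<lambda>z. d - z \<bullet> z" and g = "exp_bump k",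
            OF _ exp_bump_has_derivative[unfolded has_field_derivative_def]])
         (auto intro!: derivative_eq_intros)
    then show "((\<lambda>z. exp_bump k (d - z \<bullet> z)) has_derivative
       (\<lambda>b. (exp_bump (k + 2) (d - z \<bullet> z) + (- real k) * exp_bump (k + 1) (d - z \<bullet> z)) * ((-2) * (z \<bullet> b)))) (at z)"
      by (rule has_derivative_eq_rhs) (auto simp: inner_commute)
  qed (intro bump_alg.intros)
next
  case (add f g)
  then obtain D E where "\<forall>z. (f has_derivative D z) (at z)" "\<forall>b. (\<lambda>z. D z b) \<in> bump_alg d"
    "\<forall>z. (g has_derivative E z) (at z)" "\<forall>b. (\<lambda>z. E z b) \<in> bump_alg d" by blast
  then show ?case
    by (intro exI[of _ "\<lambda>z b. D z b + E z b"]) (auto intro!: derivative_eq_intros bump_alg.add)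
next
  case (mult f g)
  then obtain D E where *: "\<forall>z. (f has_derivative D z) (at z)" "\<forall>b. (\<lambda>z. D z b) \<in> bump_alg d"
    "\<forall>z. (g has_derivative E z) (at z)" "\<forall>b. (\<lambda>z. E z b) \<in> bump_alg d" by blast
  show ?case
  proof (intro exI[of _ "\<lambda>z b. f z * E z b + D z b * g z"] conjI allI)
    fix z show "((\<lambda>z. f z * g z) has_derivative (\<lambda>b. f z * E z b + D z b * g z)) (at z)"
      using * by (intro has_derivative_mult) auto
  next
    fix b show "(\<lambda>z. f z * E z b + D z b * g z) \<in> bump_alg d"
      using * mult.hyps by (intro bump_alg.intros) auto
  qed
qed

lemma C_k_on_bump_alg: "f \<in> bump_alg d \<Longrightarrow> C_k_on k S f"
proof (induction k arbitrary: f)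
  case 0
  then obtain D where "\<forall>z. (f has_derivative D z) (at z)"
    using bump_alg_derivative by blast
  then have "isCont f z" for z
    using has_derivative_continuous by blast
  then show ?case
    by (simp add: continuous_at_imp_continuous_on)
next
  case (Suc k)
  obtain D where D: "\<And>z. (f has_derivative D z) (at z)" "\<And>b. (\<lambda>z. D z b) \<in> bump_alg d"
    using bump_alg_derivative[OF Suc.prems] by blast
  have "partial b f = (\<lambda>z. D z b)" for b
    using frechet_derivative_at[OF D(1)] by (auto simp: partial_def fun_eq_iff)
  then show ?case
    using D Suc.IH by (auto simp: differentiable_def)
qed

text \<open>The factor \<open>c\<close> is there for the induction: each derivative of the reflected
  function contributes a sign, so the claim for \<open>c\<close> rests on the claim for
  \<open>- c\<close> one order lower.\<close>

lemma C_k_on_reflect: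
  assumes "C_k_on k UNIV f"
  shows "C_k_on k UNIV (\<lambda>y. c * f (a - y))"
  using assms
proof (induction k arbitrary: f c)
  case 0
  then show ?case
    by (auto intro!: continuous_intros continuous_on_compose2[of UNIV f])
next
  case (Suc k)
  have f: "f differentiable at z" for z using Suc.prems by simp
  have D: "((\<lambda>y. c * f (a - y)) has_derivative (\<lambda>b. c * (frechet_derivative f (at (a - z)) (- b)))) (at z)" for z
  proof -
    have "((\<lambda>y. a - y) has_derivative (\<lambda>b. - b)) (at z)"
      by (auto intro!: derivative_eq_intros)
    from has_derivative_compose[OF this f[of "a - z", unfolded frechet_derivative_works]]
    show ?thesis by (rule has_derivative_mult_right)
  qed
  have "linear (frechet_derivative f (at z))" for z
    using f linear_frechet_derivative by blast
  then have P: "partial b (\<lambda>y. c * f (a - y)) = (\<lambda>y. (- c) * partial b f (a - y))" for b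
    using frechet_derivative_at[OF D] by (auto simp: partial_def fun_eq_iff linear_neg)
  show ?case
    unfolding C_k_on.simps P
  proof (intro conjI ballI)
    show "(\<lambda>y. c * f (a - y)) differentiable at z" for z
      using D by (auto simp: differentiable_def)
    show "C_k_on k UNIV (\<lambda>y. - c * partial b f (a - y))" if "b \<in> Basis" for b
      using Suc that by (intro Suc.IH) simp
  qed
qed

lemma C_k_on_subset: "C_k_on k S f \<Longrightarrow> T \<subseteq> S \<Longrightarrow> C_k_on k T f"
proof (induction k arbitrary: f)
  case 0 then show ?case by (auto intro: continuous_on_subset)
qed auto

section \<open>Kernels of unit mass supported in small balls\<close>

definition bump_fun :: "real \<Rightarrow> 'a::euclidean_space \<Rightarrow> real" where
  "bump_fun d z = exp_bump 0 (d\<^sup>2 - z \<bullet> z)"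

definition mollifier :: "real \<Rightarrow> 'a::euclidean_space \<Rightarrow> real" where
  "mollifier d z = bump_fun d z / (LINT y|lebesgue. bump_fun d (y::'a))"

lemma bump_fun_zero: "norm z \<ge> d \<Longrightarrow> d > 0 \<Longrightarrow> bump_fun d z = 0"
  using power_mono[of d "norm z" 2] by (auto simp: bump_fun_def exp_bump_def power2_norm_eq_inner)

lemma C_k_mollifier: "C_k_on k S (mollifier d)"
proof -
  have "(\<lambda>z::'a. (1 / (LINT y|lebesgue. bump_fun d (y::'a))) * exp_bump 0 (d\<^sup>2 - z \<bullet> z)) \<in> bump_alg (d\<^sup>2)"
    by (intro bump_alg.intros)
  from C_k_on_bump_alg[OF this, of k S] show ?thesis
    by (simp add: mollifier_def[abs_def] bump_fun_def[abs_def])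
qed

lemma continuous_bump_fun: "continuous_on S (bump_fun d)"
  using C_k_on_bump_alg[OF bump_alg.bump, of 0 S 0 "d\<^sup>2"] by (simp add: bump_fun_def[abs_def])

lemma integrable_continuous_compact_support:
  fixes f :: "'a::euclidean_space \<Rightarrow> real"
  assumes "continuous_on UNIV f" "compact K" "\<And>z. z \<notin> K \<Longrightarrow> f z = 0"
  shows "integrable lebesgue f"
proof -
  have "integrable lborel (\<lambda>x. if x \<in> K then f x else 0)"
    using borel_integrable_compact[of K f] assms continuous_on_subset[of UNIV f K]
    by (simp add: indicator_times_eq_if)
  moreover have "(\<lambda>x. if x \<in> K then f x else 0) = f" using assms(3) by auto
  ultimately have i: "integrable lborel f" by simp
  show ?thesis
    by (rule iffD2[OF integrable_completion _ ] ) (use i in auto)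
qed

text \<open>\<open>mollifier\<close> divides by this integral. If it vanished, the bump would be
  zero almost everywhere, whereas it is positive on a non-empty open ball.\<close>

lemma integral_bump_fun_pos:
  assumes "d > 0" shows "(LINT y|lebesgue. bump_fun d (y::'a::euclidean_space)) > 0"
proof -
  have i: "integrable lebesgue (bump_fun d :: 'a \<Rightarrow> real)"
    by (rule integrable_continuous_compact_support[of _ "cball 0 d"])
       (use assms in \<open>auto intro: bump_fun_zero continuous_bump_fun\<close>)
  have "(LINT y|lebesgue. bump_fun d (y::'a)) \<noteq> 0"
  proof
    assume "(LINT y|lebesgue. bump_fun d (y::'a)) = 0"
    then have "AE y in lebesgue. bump_fun d (y::'a) = 0"
      using i by (subst (asm) integral_nonneg_eq_0_iff_AE) (auto simp: bump_fun_def exp_bump_nonneg)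
    then have "{y::'a. bump_fun d y \<noteq> 0} \<in> null_sets lebesgue"
    proof (subst (asm) AE_iff_null)
      have "(bump_fun d :: 'a \<Rightarrow> real) -` (- {0}) \<inter> space lebesgue \<in> sets lebesgue"
        by (rule measurable_sets[OF borel_measurable_integrable[OF i]]) auto
      then show "{y \<in> space lebesgue. bump_fun d (y::'a) \<noteq> 0} \<in> sets lebesgue"
        by (simp add: vimage_def Collect_neg_eq)
    qed simp
    moreover have "ball 0 d \<subseteq> {y::'a. bump_fun d y \<noteq> 0}"
    proof
      fix y :: 'a assume "y \<in> ball 0 d"
      then have "norm y < d" by simp
      then have "(norm y)\<^sup>2 < d\<^sup>2" using power_strict_mono[of "norm y" d 2] by simp
      then show "y \<in> {y. bump_fun d y \<noteq> 0}"
        by (auto simp: bump_fun_def exp_bump_def power2_norm_eq_inner)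
    qed
    ultimately have "negligible (ball (0::'a) d)"
      using negligible_subset negligible_iff_null_sets by blast
    then show False using open_not_negligible[of "ball (0::'a) d"] assms by auto
  qed
  moreover have "(LINT y|lebesgue. bump_fun d (y::'a)) \<ge> 0"
    by (intro Bochner_Integration.integral_nonneg) (auto simp: bump_fun_def exp_bump_nonneg)
  ultimately show ?thesis by linarith
qed

lemma mollifier_nonneg: "0 \<le> mollifier d z"
  unfolding mollifier_def
  by (intro divide_nonneg_nonneg Bochner_Integration.integral_nonneg)
     (auto simp: bump_fun_def exp_bump_nonneg)

lemma mollifier_zero: "norm z \<ge> d \<Longrightarrow> d > 0 \<Longrightarrow> mollifier d z = 0"
  by (simp add: mollifier_def bump_fun_zero)

lemma integral_mollifier: "d > 0 \<Longrightarrow> (LINT y|lebesgue. mollifier d (y::'a::euclidean_space)) = 1"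
  using integral_bump_fun_pos[of d, where 'a = 'a] by (simp add: mollifier_def)

lemma continuous_mollifier: "continuous_on S (mollifier d)"
  using C_k_mollifier[of 0] by simp

section \<open>Convolution and convergence in the mean\<close>

lemma borel_imp_lebesgue_measurable:
  "f \<in> borel_measurable borel \<Longrightarrow> f \<in> borel_measurable lebesgue"
  by (rule measurable_completion) simp

lemma integral_lebesgue_translation:
  fixes f :: "'a::euclidean_space \<Rightarrow> real"
  assumes [measurable]: "f \<in> borel_measurable borel"
  shows "(LINT z|lebesgue. f (a + z)) = (LINT z|lebesgue. f z)"
proof -
  have "(LINT z|lebesgue. f z) = (LINT z|distr lborel borel ((+) a). f z)"
    by (simp add: integral_completion lborel_distr_plus)
  also have "\<dots> = (LINT z|lborel. f (a + z))"
    by (rule integral_distr) auto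
  finally show ?thesis by (simp add: integral_completion)
qed

lemma nn_integral_lborel_translation:
  fixes f :: "'a::euclidean_space \<Rightarrow> ennreal"
  assumes [measurable]: "f \<in> borel_measurable borel"
  shows "(\<integral>\<^sup>+z. f (a + z) \<partial>lborel) = (\<integral>\<^sup>+z. f z \<partial>lborel)"
proof -
  have "(\<integral>\<^sup>+z. f z \<partial>lborel) = (\<integral>\<^sup>+z. f z \<partial>distr lborel borel ((+) a))"
    by (simp add: lborel_distr_plus)
  also have "\<dots> = (\<integral>\<^sup>+z. f (a + z) \<partial>lborel)"
    by (rule nn_integral_distr) auto
  finally show ?thesis by simp
qed

lemma uniformly_continuous_compact_support:
  fixes f :: "'a::euclidean_space \<Rightarrow> real"
  assumes "continuous_on UNIV f" "compact K" "\<And>z. z \<notin> K \<Longrightarrow> f z = 0"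
  shows "uniformly_continuous_on UNIV f"
  unfolding uniformly_continuous_on_def
proof (intro allI impI)
  fix e :: real assume "e > 0"
  obtain R where R: "K \<subseteq> cball 0 R" using compact_imp_bounded[OF assms(2)] by (auto simp: bounded_iff subset_iff)
  \<comment> \<open>With the radius enlarged by 1, two points at distance below 1 either both lie in
    this ball or both avoid \<open>K\<close>, where \<open>f\<close> vanishes.\<close>
  have "uniformly_continuous_on (cball 0 (R + 1)) f"
    by (rule compact_uniformly_continuous) (use assms(1) continuous_on_subset in auto)
  then obtain d where d: "d > 0" "\<And>x y. x \<in> cball 0 (R+1) \<Longrightarrow> y \<in> cball 0 (R+1) \<Longrightarrow> dist y x < d \<Longrightarrow> dist (f y) (f x) < e"
    using \<open>e > 0\<close> unfolding uniformly_continuous_on_def by metis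
  have "dist (f y) (f x) < e" if "dist y x < min d 1" for x y
  proof (cases "x \<in> K \<or> y \<in> K")
    case True
    then have "norm x \<le> R \<or> norm y \<le> R" using R by auto
    moreover have "norm (y - x) < 1" using that by (simp add: dist_norm)
    then have "\<bar>norm y - norm x\<bar> < 1" using norm_triangle_ineq3[of y x] by linarith
    ultimately have "x \<in> cball 0 (R+1)" "y \<in> cball 0 (R+1)" by auto
    then show ?thesis using d that by auto
  qed (use assms(3) \<open>e > 0\<close> in simp)
  then show "\<exists>d>0. \<forall>x\<in>UNIV. \<forall>x'\<in>UNIV. dist x' x < d \<longrightarrow> dist (f x') (f x) < e"
    using d(1) by (intro exI[of _ "min d 1"]) auto
qed

lemma bounded_compact_support:
  fixes f :: "'a::euclidean_space \<Rightarrow> real"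
  assumes "continuous_on UNIV f" "compact K" "\<And>z. z \<notin> K \<Longrightarrow> f z = 0"
  obtains B where "B > 0" "\<And>z. \<bar>f z\<bar> \<le> B"
proof -
  have "bounded (f ` K)"
    using assms by (intro compact_imp_bounded compact_continuous_image) (auto intro: continuous_on_subset)
  then obtain B where "B > 0" "\<forall>z\<in>K. \<bar>f z\<bar> \<le> B" by (auto simp: bounded_pos)
  then show ?thesis using assms(3) by (intro that[of B]) (metis abs_zero less_imp_le)+
qed

lemma integrable_mult_bounded:
  fixes f h :: "'a \<Rightarrow> real"
  assumes "integrable M f" "h \<in> borel_measurable M" "\<And>x. \<bar>h x\<bar> \<le> B"
  shows "integrable M (\<lambda>x. f x * h x)"
proof (rule Bochner_Integration.integrable_bound)
  show "integrable M (\<lambda>x. B * f x)" using assms(1) by simp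
  show "(\<lambda>x. f x * h x) \<in> borel_measurable M" using assms by auto
  show "AE x in M. norm (f x * h x) \<le> norm (B * f x)"
  proof (rule AE_I2)
    fix x show "norm (f x * h x) \<le> norm (B * f x)"
      using mult_right_mono[OF order_trans[OF assms(3) abs_ge_self], of "\<bar>f x\<bar>" x]
      by (simp add: abs_mult mult.commute)
  qed
qed

definition conv :: "('a::euclidean_space \<Rightarrow> real) \<Rightarrow> ('a \<Rightarrow> real) \<Rightarrow> 'a \<Rightarrow> real" where
  "conv f \<rho> z = (LINT y|lebesgue. f y * \<rho> (z - y))"

lemma integrable_conv:
  fixes \<rho> :: "'a::euclidean_space \<Rightarrow> real"
  assumes "integrable lebesgue f" "continuous_on UNIV \<rho>" "\<And>z. \<bar>\<rho> z\<bar> \<le> B"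
  shows "integrable lebesgue (\<lambda>y. f y * \<rho> (z - y))"
proof (rule integrable_mult_bounded[OF assms(1)])
  have "continuous_on UNIV (\<lambda>y. \<rho> (z - y))"
    by (intro continuous_on_compose2[OF assms(2)] continuous_intros) auto
  then show "(\<lambda>y. \<rho> (z - y)) \<in> borel_measurable lebesgue"
    by (intro borel_imp_lebesgue_measurable borel_measurable_continuous_onI)
qed (use assms in auto)

lemma continuous_conv:
  fixes \<rho> :: "'a::euclidean_space \<Rightarrow> real"
  assumes f: "integrable lebesgue f" and \<rho>: "uniformly_continuous_on UNIV \<rho>" "\<And>z. \<bar>\<rho> z\<bar> \<le> B"
  shows "continuous_on UNIV (conv f \<rho>)"
proof (rule uniformly_continuous_imp_continuous, unfold uniformly_continuous_on_def, intro allI impI)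
  fix e :: real assume "e > 0"
  define I where "I = (LINT y|lebesgue. \<bar>f y\<bar>)"
  have I: "I \<ge> 0" by (simp add: I_def)
  define e' where "e' = e / (I + 1)"
  have e': "e' > 0" "e' * I < e" using \<open>e > 0\<close> I by (auto simp: e'_def field_simps)
  obtain d where d: "d > 0" "\<And>x y. dist y x < d \<Longrightarrow> dist (\<rho> y) (\<rho> x) < e'"
    using \<rho>(1) e'(1) unfolding uniformly_continuous_on_def by (metis UNIV_I)
  note c = uniformly_continuous_imp_continuous[OF \<rho>(1)]
  have "dist (conv f \<rho> x') (conv f \<rho> x) < e" if "dist x' x < d" for x x'
  proof -
    have "conv f \<rho> x' - conv f \<rho> x = (LINT y|lebesgue. f y * (\<rho> (x' - y) - \<rho> (x - y)))"
      unfolding conv_def right_diff_distrib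
      by (rule Bochner_Integration.integral_diff[symmetric]; rule integrable_conv[OF f c \<rho>(2)])
    also have "\<bar>\<dots>\<bar> \<le> (LINT y|lebesgue. e' * \<bar>f y\<bar>)"
    proof (rule integral_abs_bound_integral)
      show "integrable lebesgue (\<lambda>y. f y * (\<rho> (x' - y) - \<rho> (x - y)))"
        unfolding right_diff_distrib
        by (rule Bochner_Integration.integrable_diff; rule integrable_conv[OF f c \<rho>(2)])
      show "integrable lebesgue (\<lambda>y. e' * \<bar>f y\<bar>)" using f by simp
      fix y
      have "\<bar>\<rho> (x' - y) - \<rho> (x - y)\<bar> \<le> e'"
        using d(2)[of "x' - y" "x - y"] that by (simp add: dist_norm)
      then show "\<bar>f y * (\<rho> (x' - y) - \<rho> (x - y))\<bar> \<le> e' * \<bar>f y\<bar>"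
        unfolding abs_mult by (subst mult.commute) (rule mult_right_mono, auto)
    qed
    also have "\<dots> = e' * I" by (simp add: I_def)
    finally show ?thesis using e' by (simp add: dist_norm)
  qed
  then show "\<exists>d>0. \<forall>x\<in>UNIV. \<forall>x'\<in>UNIV. dist x' x < d \<longrightarrow> dist (conv f \<rho> x') (conv f \<rho> x) < e"
    using d(1) by blast
qed

section \<open>Mollification as a contraction in L1, and its convergence\<close>

lemma nn_integral_mollifier_translate:
  fixes y :: "'a::euclidean_space"
  assumes "d > 0"
  shows "(\<integral>\<^sup>+z. ennreal (mollifier d (z - y)) \<partial>lborel) = 1"
proof -
  have [measurable]: "(mollifier d :: 'a \<Rightarrow> real) \<in> borel_measurable borel"
    by (intro borel_measurable_continuous_onI continuous_mollifier)
  have i: "integrable lebesgue (mollifier d :: 'a \<Rightarrow> real)"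
    by (rule integrable_continuous_compact_support[of _ "cball 0 d"])
       (use assms in \<open>auto intro: continuous_mollifier mollifier_zero\<close>)
  then have i': "integrable lborel (mollifier d :: 'a \<Rightarrow> real)"
    by (subst (asm) integrable_completion) auto
  have "(\<integral>\<^sup>+z. ennreal (mollifier d (z - y)) \<partial>lborel) = (\<integral>\<^sup>+z. ennreal (mollifier d ((- y) + z)) \<partial>lborel)"
    by simp
  also have "\<dots> = (\<integral>\<^sup>+z. ennreal (mollifier d (z::'a)) \<partial>lborel)"
    by (rule nn_integral_lborel_translation) auto
  also have "\<dots> = ennreal (LINT z|lborel. mollifier d (z::'a))"
    by (rule nn_integral_eq_integral[OF i']) (simp add: mollifier_nonneg)
  also have "(LINT z|lborel. mollifier d (z::'a)) = 1"
    using integral_mollifier[OF assms, where 'a = 'a] by (subst (asm) integral_completion) auto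
  finally show ?thesis by simp
qed

lemma mollifier_uminus: "mollifier d (- z) = mollifier d z"
  by (simp add: mollifier_def bump_fun_def)

lemma mollifier_diff_commute: "mollifier d (x - y) = mollifier d (y - x)"
  using mollifier_uminus[of d "x - y"] by simp

lemma mollifier_bounded:
  assumes "d > 0"
  obtains B where "B > 0" "\<And>z::'a::euclidean_space. \<bar>mollifier d z\<bar> \<le> B"
  by (rule bounded_compact_support[of "mollifier d" "cball (0::'a) d"])
     (use assms in \<open>auto intro: continuous_mollifier mollifier_zero\<close>)

lemma mollifier_uniformly_continuous:
  assumes "d > 0"
  shows "uniformly_continuous_on UNIV (mollifier d :: 'a::euclidean_space \<Rightarrow> real)"
  by (rule uniformly_continuous_compact_support[of _ "cball (0::'a) d"])
     (use assms in \<open>auto intro: continuous_mollifier mollifier_zero\<close>)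

lemma integral_mollifier_translate:
  fixes y :: "'a::euclidean_space"
  assumes "d > 0"
  shows "(LINT z|lebesgue. mollifier d (y - z)) = 1"
proof -
  have m: "(mollifier d :: 'a \<Rightarrow> real) \<in> borel_measurable borel"
    by (intro borel_measurable_continuous_onI continuous_mollifier)
  have "(LINT z|lebesgue. mollifier d (y - z)) = (LINT z|lebesgue. mollifier d ((- y) + z))"
    by (simp add: mollifier_diff_commute[of d y])
  then show ?thesis
    unfolding integral_lebesgue_translation[OF m] integral_mollifier[OF assms] .
qed

lemma continuous_conv_mollifier:
  assumes "integrable lebesgue f" "d > 0"
  shows "continuous_on UNIV (conv f (mollifier d))"
  by (rule mollifier_bounded[OF assms(2)])
     (rule continuous_conv[OF assms(1) mollifier_uniformly_continuous[OF assms(2)]])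

lemma integrable_conv_mollifier:
  assumes "integrable lebesgue f" "d > 0"
  shows "integrable lebesgue (\<lambda>y. f y * mollifier d (z - y))"
  by (rule mollifier_bounded[OF assms(2)])
     (rule integrable_conv[OF assms(1) continuous_mollifier])

lemma conv_diff:
  assumes "integrable lebesgue f" "integrable lebesgue g" "d > 0"
  shows "conv (\<lambda>z. f z - g z) (mollifier d) z = conv f (mollifier d) z - conv g (mollifier d) z"
  unfolding conv_def left_diff_distrib
  by (intro Bochner_Integration.integral_diff integrable_conv_mollifier assms)

text \<open>Tonelli's theorem and the unit mass of the kernel. The bound is uniform in
  \<open>d\<close>, so that convergence passes from a dense class to all integrable
  functions.\<close>

lemma conv_L1_bound:
  fixes f :: "'a::euclidean_space \<Rightarrow> real"
  assumes f: "integrable lebesgue f" and d: "d > 0"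
  shows "integrable lebesgue (conv f (mollifier d))"
    and "(LINT z|lebesgue. \<bar>conv f (mollifier d) z\<bar>) \<le> (LINT z|lebesgue. \<bar>f z\<bar>)"
proof -
  let ?c = "conv f (mollifier d)"
  \<comment> \<open>Tonelli is applied to Borel measures, so \<open>f\<close> is replaced by a Borel
    function equal to it almost everywhere; the integrals do not see the change.\<close>
  obtain f' where f'[measurable]: "f' \<in> borel_measurable lborel" and ff': "AE x in lborel. f x = f' x"
    using completion_ex_borel_measurable_real borel_measurable_integrable[OF f] by blast
  have [measurable]: "(mollifier d :: 'a \<Rightarrow> real) \<in> borel_measurable borel"
    by (intro borel_measurable_continuous_onI continuous_mollifier)
  have c[measurable]: "?c \<in> borel_measurable borel"
    by (intro borel_measurable_continuous_onI continuous_conv_mollifier f d)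
  have pw: "ennreal \<bar>?c z\<bar> \<le> (\<integral>\<^sup>+y. ennreal (\<bar>f' y\<bar> * mollifier d (z - y)) \<partial>lborel)" for z
  proof -
    have "\<bar>?c z\<bar> \<le> (LINT y|lebesgue. \<bar>f y * mollifier d (z - y)\<bar>)"
      unfolding conv_def by (rule integral_abs_bound)
    then have "ennreal \<bar>?c z\<bar> \<le> ennreal (LINT y|lebesgue. \<bar>f y * mollifier d (z - y)\<bar>)"
      by (rule ennreal_leI)
    also have "\<dots> = (\<integral>\<^sup>+y. ennreal \<bar>f y * mollifier d (z - y)\<bar> \<partial>lebesgue)"
      by (rule nn_integral_eq_integral[symmetric]) (auto intro!: integrable_abs integrable_conv_mollifier f d)
    also have "\<dots> = (\<integral>\<^sup>+y. ennreal (\<bar>f' y\<bar> * mollifier d (z - y)) \<partial>lebesgue)"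
      by (rule nn_integral_cong_AE) (use AE_completion[OF ff'] in eventually_elim, simp add: abs_mult mollifier_nonneg)
    also have "\<dots> = (\<integral>\<^sup>+y. ennreal (\<bar>f' y\<bar> * mollifier d (z - y)) \<partial>lborel)"
      by (simp add: nn_integral_completion)
    finally show ?thesis .
  qed
  have "(\<integral>\<^sup>+z. ennreal \<bar>?c z\<bar> \<partial>lborel) \<le> (\<integral>\<^sup>+z. \<integral>\<^sup>+y. ennreal (\<bar>f' y\<bar> * mollifier d (z - y)) \<partial>lborel \<partial>lborel)"
    by (rule nn_integral_mono) (rule pw)
  also have "\<dots> = (\<integral>\<^sup>+y. \<integral>\<^sup>+z. ennreal (\<bar>f' y\<bar> * mollifier d (z - y)) \<partial>lborel \<partial>lborel)"
    by (rule lborel_pair.Fubini') measurable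
  also have "\<dots> = (\<integral>\<^sup>+y. ennreal \<bar>f' y\<bar> * (\<integral>\<^sup>+z. ennreal (mollifier d (z - y)) \<partial>lborel) \<partial>lborel)"
    by (intro nn_integral_cong) (simp add: ennreal_mult' nn_integral_cmult)
  also have "\<dots> = (\<integral>\<^sup>+y. ennreal \<bar>f' y\<bar> \<partial>lborel)"
    by (simp add: nn_integral_mollifier_translate[OF d])
  also have "\<dots> = (\<integral>\<^sup>+y. ennreal \<bar>f y\<bar> \<partial>lebesgue)"
    unfolding nn_integral_completion
    by (rule nn_integral_cong_AE) (use ff' in eventually_elim, simp)
  also have "\<dots> = ennreal (LINT z|lebesgue. \<bar>f z\<bar>)"
    by (rule nn_integral_eq_integral) (use f in auto)
  finally have le: "(\<integral>\<^sup>+z. ennreal \<bar>?c z\<bar> \<partial>lborel) \<le> ennreal (LINT z|lebesgue. \<bar>f z\<bar>)" .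
  then have le': "(\<integral>\<^sup>+z. ennreal \<bar>?c z\<bar> \<partial>lebesgue) \<le> ennreal (LINT z|lebesgue. \<bar>f z\<bar>)"
    by (simp add: nn_integral_completion)
  show i: "integrable lebesgue ?c"
    using le' by (intro integrableI_bounded borel_imp_lebesgue_measurable c)
      (auto simp: le_less_trans[OF _ ennreal_less_top])
  have "(\<integral>\<^sup>+z. ennreal \<bar>?c z\<bar> \<partial>lebesgue) = ennreal (LINT z|lebesgue. \<bar>?c z\<bar>)"
    by (rule nn_integral_eq_integral) (use i in auto)
  with le' show "(LINT z|lebesgue. \<bar>?c z\<bar>) \<le> (LINT z|lebesgue. \<bar>f z\<bar>)"
    by (simp add: ennreal_le_iff)
qed

text \<open>Lebesgue measurable functions are almost everywhere limits of continuous ones, but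
  without domination. Truncating \<open>f\<close> and the approximants by the same
  \<open>cut m\<close> supplies it and preserves continuity.\<close>

lemma L1_continuous_dense:
  fixes f :: "'a::euclidean_space \<Rightarrow> real"
  assumes f: "integrable lebesgue f" and e: "e > 0"
  obtains g R where "continuous_on UNIV g" "\<And>z. z \<notin> cball 0 R \<Longrightarrow> g z = 0"
    "(LINT z|lebesgue. \<bar>f z - g z\<bar>) < e"
proof -
  \<comment> \<open>Values are clipped to the interval from \<open>- m\<close> to \<open>m\<close>
    and multiplied by a continuous spatial cutoff that is 1 up to radius \<open>m\<close> and 0 from
    radius \<open>m + 1\<close> on.\<close>
  define cut where "cut m h z = max (- real m) (min (real m) (h z)) * max 0 (min 1 (real m + 1 - norm z))"
    for m and h :: "'a \<Rightarrow> real" and z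
  have cut_le1: "\<bar>cut m h z\<bar> \<le> \<bar>h z\<bar>" for m h z
  proof -
    have "\<bar>max (- real m) (min (real m) (h z))\<bar> * \<bar>max 0 (min 1 (real m + 1 - norm z))\<bar> \<le> \<bar>h z\<bar> * 1"
      by (intro mult_mono) auto
    then show ?thesis by (simp add: cut_def abs_mult)
  qed
  have cut_le2: "\<bar>cut m h z\<bar> \<le> real m * indicator (cball 0 (real m + 1)) z" for m h z
  proof -
    have "\<bar>max (- real m) (min (real m) (h z))\<bar> * \<bar>max 0 (min 1 (real m + 1 - norm z))\<bar> \<le> real m * indicator (cball 0 (real m + 1)) z"
      by (intro mult_mono) (auto simp: indicator_def)
    then show ?thesis by (simp add: cut_def abs_mult)
  qed
  have m_f: "f \<in> borel_measurable lebesgue" using f by auto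
  have norm_meas: "(\<lambda>z::'a. max 0 (min 1 (real m + 1 - norm z))) \<in> borel_measurable lebesgue" for m
    by (intro borel_imp_lebesgue_measurable) measurable
  have cut_meas: "cut m h \<in> borel_measurable lebesgue" if "h \<in> borel_measurable lebesgue" for m h
    unfolding cut_def using that
    by (intro borel_measurable_times norm_meas borel_measurable_max borel_measurable_min borel_measurable_const)
  have lim1: "(\<lambda>m. LINT z|lebesgue. \<bar>f z - cut m f z\<bar>) \<longlonglongrightarrow> (LINT z::'a|lebesgue. 0)"
  proof (rule integral_dominated_convergence[where w = "\<lambda>z. 2 * \<bar>f z\<bar>"])
    show "(\<lambda>z. \<bar>f z - cut m f z\<bar>) \<in> borel_measurable lebesgue" for m
      using cut_meas[OF m_f] m_f by measurable
    show "AE z in lebesgue. (\<lambda>m. \<bar>f z - cut m f z\<bar>) \<longlonglongrightarrow> 0"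
    proof (rule AE_I2)
      fix z
      obtain N :: nat where N: "real N \<ge> \<bar>f z\<bar> + norm z" using real_arch_simple by blast
      have "\<bar>f z - cut m f z\<bar> = 0" if "m \<ge> N" for m
      proof -
        have "real m \<ge> \<bar>f z\<bar> + norm z" using N that by linarith
        moreover have "norm z \<ge> 0" by simp
        ultimately have "max (- real m) (min (real m) (f z)) = f z" "max 0 (min 1 (real m + 1 - norm z)) = 1"
          by linarith+
        then show ?thesis by (simp add: cut_def)
      qed
      then show "(\<lambda>m. \<bar>f z - cut m f z\<bar>) \<longlonglongrightarrow> 0"
        by (intro tendsto_eventually eventually_sequentiallyI) auto
    qed
    show "AE z in lebesgue. norm \<bar>f z - cut m f z\<bar> \<le> 2 * \<bar>f z\<bar>" for m
    proof (rule AE_I2)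
      fix z show "norm \<bar>f z - cut m f z\<bar> \<le> 2 * \<bar>f z\<bar>" using cut_le1[of m f z] by simp
    qed
  qed (use f in auto)
  then have "eventually (\<lambda>m. (LINT z|lebesgue. \<bar>f z - cut m f z\<bar>) < e / 2) sequentially"
    using e by (intro order_tendstoD(2)) auto
  then obtain m where m: "(LINT z|lebesgue. \<bar>f z - cut m f z\<bar>) < e / 2"
    by (auto simp: eventually_sequentially)
  obtain N g where N: "negligible N" and g: "\<And>n. continuous_on UNIV (g n)"
    and lim: "\<And>x. x \<notin> N \<Longrightarrow> (\<lambda>n. g n x) \<longlonglongrightarrow> f x"
    using lebesgue_measurable_imp_measurable_on_real[OF m_f, of UNIV] by (auto simp: measurable_on_def)
  have g_meas: "g n \<in> borel_measurable lebesgue" for n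
    by (intro borel_imp_lebesgue_measurable borel_measurable_continuous_onI g)
  have ind: "integrable lebesgue (\<lambda>z::'a. 2 * (real m * indicator (cball 0 (real m + 1)) z))"
    by (intro integrable_mult_right) (use lmeasurable_cball[of "0::'a" "real m + 1"] in \<open>simp add: fmeasurable_def\<close>)
  have cut_int: "integrable lebesgue (cut m h)" if "h \<in> borel_measurable lebesgue" for h
  proof (rule Bochner_Integration.integrable_bound[OF ind cut_meas[OF that]], rule AE_I2)
    fix z :: 'a
    show "norm (cut m h z) \<le> norm (2 * (real m * indicator (cball 0 (real m + 1)) z))"
      using cut_le2[of m h z] abs_ge_zero[of "cut m h z"] unfolding real_norm_def by linarith
  qed
  have "(\<lambda>n. LINT z|lebesgue. \<bar>cut m f z - cut m (g n) z\<bar>) \<longlonglongrightarrow> (LINT z::'a|lebesgue. 0)"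
  proof (rule integral_dominated_convergence[where w = "\<lambda>z::'a. 2 * (real m * indicator (cball 0 (real m + 1)) z)"])
    show "(\<lambda>z. \<bar>cut m f z - cut m (g n) z\<bar>) \<in> borel_measurable lebesgue" for n
      using cut_meas[OF m_f] cut_meas[OF g_meas] by measurable
    have "AE z in lebesgue. z \<notin> N"
      using N by (simp add: negligible_iff_null_sets AE_not_in)
    then show "AE z in lebesgue. (\<lambda>n. \<bar>cut m f z - cut m (g n) z\<bar>) \<longlonglongrightarrow> 0"
    proof eventually_elim
      fix z assume "z \<notin> N"
      then have "(\<lambda>n. \<bar>cut m f z - cut m (g n) z\<bar>) \<longlonglongrightarrow> \<bar>cut m f z - cut m f z\<bar>"
        unfolding cut_def by (intro tendsto_intros lim)
      then show "(\<lambda>n. \<bar>cut m f z - cut m (g n) z\<bar>) \<longlonglongrightarrow> 0" by simp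
    qed
    show "AE z in lebesgue. norm \<bar>cut m f z - cut m (g n) z\<bar> \<le> 2 * (real m * indicator (cball 0 (real m + 1)) z)" for n
    proof (rule AE_I2)
      fix z show "norm \<bar>cut m f z - cut m (g n) z\<bar> \<le> 2 * (real m * indicator (cball 0 (real m + 1)) z)"
        using cut_le2[of m f z] cut_le2[of m "g n" z] by simp
    qed
  qed (use ind in auto)
  then have "eventually (\<lambda>n. (LINT z|lebesgue. \<bar>cut m f z - cut m (g n) z\<bar>) < e / 2) sequentially"
    using e by (intro order_tendstoD(2)) auto
  then obtain n where n: "(LINT z|lebesgue. \<bar>cut m f z - cut m (g n) z\<bar>) < e / 2"
    by (auto simp: eventually_sequentially)
  show ?thesis
  proof (rule that[of "cut m (g n)" "real m + 1"])
    show "continuous_on UNIV (cut m (g n))"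
      unfolding cut_def by (intro continuous_intros g)
    show "cut m (g n) z = 0" if "z \<notin> cball 0 (real m + 1)" for z
      using that by (simp add: cut_def)
    have i1: "integrable lebesgue (\<lambda>z. \<bar>f z - cut m f z\<bar>)" "integrable lebesgue (\<lambda>z. \<bar>cut m f z - cut m (g n) z\<bar>)"
      "integrable lebesgue (\<lambda>z. \<bar>f z - cut m (g n) z\<bar>)"
      by (intro integrable_abs Bochner_Integration.integrable_diff f cut_int m_f g_meas)+
    have "(LINT z|lebesgue. \<bar>f z - cut m (g n) z\<bar>) \<le> (LINT z|lebesgue. \<bar>f z - cut m f z\<bar> + \<bar>cut m f z - cut m (g n) z\<bar>)"
      by (intro integral_mono i1 Bochner_Integration.integrable_add) auto
    also have "\<dots> = (LINT z|lebesgue. \<bar>f z - cut m f z\<bar>) + (LINT z|lebesgue. \<bar>cut m f z - cut m (g n) z\<bar>)"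
      by (intro Bochner_Integration.integral_add i1)
    finally show "(LINT z|lebesgue. \<bar>f z - cut m (g n) z\<bar>) < e" using m n by linarith
  qed
qed

text \<open>Uniform continuity makes the pointwise error at most \<open>e'\<close>; for
  \<open>d\<close> below 1 the error lives in the ball of radius \<open>R + 1\<close>, whose measure
  \<open>V\<close> converts this into a bound in the mean.\<close>

lemma conv_mollifier_L1_continuous:
  fixes g :: "'a::euclidean_space \<Rightarrow> real"
  assumes g: "continuous_on UNIV g" "\<And>z. z \<notin> cball 0 R \<Longrightarrow> g z = 0" and e: "e > 0"
  obtains \<delta> where "\<delta> > 0"
    "\<And>d. 0 < d \<Longrightarrow> d < \<delta> \<Longrightarrow> (LINT z|lebesgue. \<bar>conv g (mollifier d) z - g z\<bar>) < e"
proof -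
  have gi: "integrable lebesgue g" by (rule integrable_continuous_compact_support[OF g(1) compact_cball g(2)])
  define V where "V = measure lebesgue (cball (0::'a) (R + 1))"
  have V: "V \<ge> 0" by (simp add: V_def)
  define e' where "e' = e / (V + 1)"
  have e': "e' > 0" "e' * V < e" using \<open>e > 0\<close> V by (auto simp: e'_def field_simps)
  obtain \<delta> where d: "\<delta> > 0" "\<And>x y. dist y x < \<delta> \<Longrightarrow> dist (g y) (g x) < e'"
    using uniformly_continuous_compact_support[OF g(1) compact_cball g(2)] e'(1)
    unfolding uniformly_continuous_on_def by (metis UNIV_I)
  have "(LINT z|lebesgue. \<bar>conv g (mollifier d) z - g z\<bar>) < e" if dd: "0 < d" "d < min 1 \<delta>" for d
  proof -
    have bound: "\<bar>conv g (mollifier d) z - g z\<bar> \<le> e' * indicator (cball 0 (R + 1)) z" for z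
    proof -
      have "conv g (mollifier d) z - g z = (LINT y|lebesgue. (g y - g z) * mollifier d (z - y))"
      proof -
        have mi: "integrable lebesgue (\<lambda>y. mollifier d (z - y))"
          using integral_mollifier_translate[OF dd(1), of z] not_integrable_integral_eq by fastforce
        have "(LINT y|lebesgue. (g y - g z) * mollifier d (z - y)) =
            (LINT y|lebesgue. g y * mollifier d (z - y)) - (LINT y|lebesgue. g z * mollifier d (z - y))"
          unfolding left_diff_distrib
          by (intro Bochner_Integration.integral_diff integrable_conv_mollifier gi dd integrable_mult_right mi)
        then show ?thesis
          by (simp add: conv_def integral_mollifier_translate[OF dd(1)])
      qed
      moreover have "\<bar>LINT y|lebesgue. (g y - g z) * mollifier d (z - y)\<bar>
          \<le> (LINT y|lebesgue. (e' * indicator (cball 0 (R + 1)) z) * mollifier d (z - y))"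
      proof (rule integral_abs_bound_integral)
        have mi: "integrable lebesgue (\<lambda>y. mollifier d (z - y))"
          using integral_mollifier_translate[OF dd(1), of z] not_integrable_integral_eq by fastforce
        show "integrable lebesgue (\<lambda>y. (e' * indicator (cball 0 (R + 1)) z) * mollifier d (z - y))"
          by (intro integrable_mult_right mi)
        show "integrable lebesgue (\<lambda>y. (g y - g z) * mollifier d (z - y))"
          unfolding left_diff_distrib
          by (intro Bochner_Integration.integrable_diff integrable_conv_mollifier gi dd integrable_mult_right mi)
        fix y
        show "\<bar>(g y - g z) * mollifier d (z - y)\<bar> \<le> (e' * indicator (cball 0 (R + 1)) z) * mollifier d (z - y)"
        proof (cases "norm (z - y) < d")
          case True
          have 1: "\<bar>g y - g z\<bar> \<le> e'"
            using d(2)[of y z] True dd by (simp add: dist_norm norm_minus_commute)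
          have 2: "g y - g z = 0" if "z \<notin> cball 0 (R + 1)"
          proof -
            have "norm z \<le> norm y + norm (z - y)" using norm_triangle_sub by blast
            then have "y \<notin> cball 0 R" "z \<notin> cball 0 R" using that True dd by auto
            then show ?thesis using g(2) by simp
          qed
          have "\<bar>g y - g z\<bar> \<le> e' * indicator (cball 0 (R + 1)) z"
            using 1 2 by (auto simp: indicator_def)
          then show ?thesis
            by (simp add: abs_mult mollifier_nonneg mult_right_mono)
        qed (simp add: mollifier_zero dd)
      qed
      moreover have "(LINT y|lebesgue. (e' * indicator (cball 0 (R + 1)) z) * mollifier d (z - y)) = e' * indicator (cball 0 (R + 1)) z"
        by (simp add: integral_mollifier_translate[OF dd(1)])
      ultimately show ?thesis by linarith
    qed
    have "(LINT z|lebesgue. \<bar>conv g (mollifier d) z - g z\<bar>) \<le> (LINT z|lebesgue. e' * indicator (cball (0::'a) (R + 1)) z)"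
    proof (rule integral_mono)
      show "integrable lebesgue (\<lambda>z. \<bar>conv g (mollifier d) z - g z\<bar>)"
        by (intro integrable_abs Bochner_Integration.integrable_diff gi conv_L1_bound dd)
      show "integrable lebesgue (\<lambda>z. e' * indicator (cball (0::'a) (R + 1)) z)"
        by (intro integrable_mult_right) (use lmeasurable_cball[of "0::'a" "R + 1"] in \<open>simp add: fmeasurable_def\<close>)
    qed (rule bound)
    also have "\<dots> = e' * V" by (simp add: V_def)
    finally show ?thesis using e' by simp
  qed
  then show ?thesis using d(1) by (intro that[of "min 1 \<delta>"]) auto
qed

lemma conv_mollifier_L1:
  fixes f :: "'a::euclidean_space \<Rightarrow> real"
  assumes f: "integrable lebesgue f" and d: "\<And>n. d n > 0" "d \<longlonglongrightarrow> 0"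
  shows "(\<lambda>n. LINT z|lebesgue. \<bar>conv f (mollifier (d n)) z - f z\<bar>) \<longlonglongrightarrow> 0"
proof (rule LIMSEQ_I)
  fix e :: real assume e: "e > 0"
  obtain g R where g: "continuous_on UNIV g" "\<And>z. z \<notin> cball 0 R \<Longrightarrow> g z = 0"
    "(LINT z|lebesgue. \<bar>f z - g z\<bar>) < e / 3"
    using L1_continuous_dense[OF f, of "e/3"] e by auto
  have gi: "integrable lebesgue g" by (rule integrable_continuous_compact_support[OF g(1) compact_cball g(2)])
  obtain \<delta> where \<delta>: "\<delta> > 0"
    "\<And>d. 0 < d \<Longrightarrow> d < \<delta> \<Longrightarrow> (LINT z|lebesgue. \<bar>conv g (mollifier d) z - g z\<bar>) < e / 3"
    \<comment> \<open>\<open>num.Bit1 num.One\<close> is the binary numeral 3: it instantiates the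
      tolerance to \<open>e / 3\<close>.\<close>
    using conv_mollifier_L1_continuous[OF g(1,2) divide_pos_pos[OF e zero_less_numeral], of R "num.Bit1 num.One"] by blast
  obtain N where N: "\<And>n. n \<ge> N \<Longrightarrow> d n < \<delta>"
    using order_tendstoD(2)[OF d(2) \<delta>(1)] by (auto simp: eventually_sequentially)
  have "(LINT z|lebesgue. \<bar>conv f (mollifier (d n)) z - f z\<bar>) < e" if "n \<ge> N" for n
  proof -
    let ?m = "mollifier (d n)"
    have fg: "integrable lebesgue (\<lambda>z. f z - g z)" using f gi by simp
    have i: "integrable lebesgue (\<lambda>z. \<bar>conv (\<lambda>z. f z - g z) ?m z\<bar>)"
      "integrable lebesgue (\<lambda>z. \<bar>conv g ?m z - g z\<bar>)" "integrable lebesgue (\<lambda>z. \<bar>f z - g z\<bar>)"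
      "integrable lebesgue (\<lambda>z. \<bar>conv f ?m z - f z\<bar>)"
      by (intro integrable_abs conv_L1_bound fg d Bochner_Integration.integrable_diff gi f)+
    have "(LINT z|lebesgue. \<bar>conv f ?m z - f z\<bar>) \<le>
       (LINT z|lebesgue. \<bar>conv (\<lambda>z. f z - g z) ?m z\<bar> + (\<bar>conv g ?m z - g z\<bar> + \<bar>f z - g z\<bar>))"
      by (intro integral_mono i Bochner_Integration.integrable_add)
         (auto simp: conv_diff[OF f gi d(1)])
    also have "\<dots> = (LINT z|lebesgue. \<bar>conv (\<lambda>z. f z - g z) ?m z\<bar>) +
       ((LINT z|lebesgue. \<bar>conv g ?m z - g z\<bar>) + (LINT z|lebesgue. \<bar>f z - g z\<bar>))"
      using i by simp
    also have "\<dots> < e"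
      using conv_L1_bound(2)[OF fg d(1)[of n]] g(3) \<delta>(2)[OF d(1) N[OF that]] by linarith
    finally show ?thesis .
  qed
  then show "\<exists>N. \<forall>n\<ge>N. norm ((LINT z|lebesgue. \<bar>conv f (mollifier (d n)) z - f z\<bar>) - 0) < e"
    by (intro exI[of _ N]) simp
qed

text \<open>One sequence of radii has to serve all functions at once. It is extracted from the mean
  convergence of the finite sum of their errors, which dominates each single error.\<close>

lemma conv_mollifier_AE_subseq:
  fixes f :: "'i \<Rightarrow> 'a::euclidean_space \<Rightarrow> real"
  assumes I: "finite I" and f: "\<And>i. i \<in> I \<Longrightarrow> integrable lebesgue (f i)" and "d0 > 0"
  obtains d where "\<And>n. d n > 0" "\<And>n::nat. d n \<le> d0" "d \<longlonglongrightarrow> 0"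
    "AE z in lebesgue. \<forall>i\<in>I. (\<lambda>n. conv (f i) (mollifier (d n)) z) \<longlonglongrightarrow> f i z"
proof -
  define c where "c n = d0 / real (Suc n)" for n
  have c: "c n > 0" "c n \<le> d0" for n using \<open>d0 > 0\<close> by (auto simp: c_def field_simps)
  have c0: "c \<longlonglongrightarrow> 0"
    using LIMSEQ_inverse_real_of_nat[THEN tendsto_mult_right_zero, of d0] by (simp add: c_def[abs_def] divide_inverse)
  define s where "s n z = (\<Sum>i\<in>I. \<bar>conv (f i) (mollifier (c n)) z - f i z\<bar>)" for n z
  have si: "integrable lebesgue (s n)" for n
    unfolding s_def
    by (intro Bochner_Integration.integrable_sum integrable_abs Bochner_Integration.integrable_diff conv_L1_bound f c)
  have "(LINT z|lebesgue. norm (s n z)) = (\<Sum>i\<in>I. LINT z|lebesgue. \<bar>conv (f i) (mollifier (c n)) z - f i z\<bar>)" for n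
  proof -
    have "(LINT z|lebesgue. norm (s n z)) = (LINT z|lebesgue. s n z)"
      by (intro Bochner_Integration.integral_cong) (auto simp: s_def sum_nonneg)
    also have "\<dots> = (\<Sum>i\<in>I. LINT z|lebesgue. \<bar>conv (f i) (mollifier (c n)) z - f i z\<bar>)"
      unfolding s_def
      by (intro Bochner_Integration.integral_sum integrable_abs Bochner_Integration.integrable_diff conv_L1_bound f c)
    finally show ?thesis .
  qed
  moreover have "(\<lambda>n. \<Sum>i\<in>I. LINT z|lebesgue. \<bar>conv (f i) (mollifier (c n)) z - f i z\<bar>) \<longlonglongrightarrow> 0"
    by (intro tendsto_null_sum conv_mollifier_L1 f c c0)
  ultimately have "(\<lambda>n. LINT z|lebesgue. norm (s n z)) \<longlonglongrightarrow> 0" by simp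
  from tendsto_L1_AE_subseq[OF si this] obtain r where r: "strict_mono r"
    "AE z in lebesgue. (\<lambda>n. s (r n) z) \<longlonglongrightarrow> 0" by auto
  show ?thesis
  proof (rule that[of "\<lambda>n. c (r n)"])
    show "(\<lambda>n. c (r n)) \<longlonglongrightarrow> 0"
      using LIMSEQ_subseq_LIMSEQ[OF c0 r(1)] by (simp add: o_def)
    show "AE z in lebesgue. \<forall>i\<in>I. (\<lambda>n. conv (f i) (mollifier (c (r n))) z) \<longlonglongrightarrow> f i z"
      using r(2)
    proof eventually_elim
      case (elim z)
      show ?case
      proof
        fix i assume "i \<in> I"
        have "(\<lambda>n. conv (f i) (mollifier (c (r n))) z - f i z) \<longlonglongrightarrow> 0"
        proof (rule Lim_null_comparison[OF _ elim], rule always_eventually, rule allI)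
          fix n show "norm (conv (f i) (mollifier (c (r n))) z - f i z) \<le> s (r n) z"
            unfolding s_def real_norm_def by (rule member_le_sum[OF \<open>i \<in> I\<close> _ I]) simp
        qed
        then show "(\<lambda>n. conv (f i) (mollifier (c (r n))) z) \<longlonglongrightarrow> f i z"
          by (simp add: LIM_zero_iff)
      qed
    qed
  qed (use c in auto)
qed

section \<open>Directional derivatives\<close>

text \<open>A derivative along one direction at every point. Products, compositions and convolutions
  are treated direction by direction, which suffices for integrating by parts.\<close>

definition dir_deriv :: "'a::euclidean_space \<Rightarrow> ('a \<Rightarrow> real) \<Rightarrow> ('a \<Rightarrow> real) \<Rightarrow> bool" where
  "dir_deriv b f f' \<longleftrightarrow> (\<forall>z. ((\<lambda>t. f (z + t *\<^sub>R b)) has_real_derivative f' z) (at 0))"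

lemma dir_deriv_at:
  assumes "dir_deriv b f f'"
  shows "((\<lambda>t. f (z + t *\<^sub>R b)) has_real_derivative f' (z + t *\<^sub>R b)) (at t)"
proof -
  have "((\<lambda>s. f ((z + t *\<^sub>R b) + s *\<^sub>R b)) has_real_derivative f' (z + t *\<^sub>R b)) (at 0)"
    using assms by (simp add: dir_deriv_def)
  then have "((\<lambda>s. f (z + (s + t) *\<^sub>R b)) has_real_derivative f' (z + t *\<^sub>R b)) (at 0)"
    by (simp add: algebra_simps)
  then show ?thesis
    using DERIV_shift[of "\<lambda>t. f (z + t *\<^sub>R b)" "f' (z + t *\<^sub>R b)" 0 t] by simp
qed

lemma has_derivative_imp_dir_deriv:
  assumes "\<And>z. (f has_derivative f' z) (at z)"
  shows "dir_deriv b f (\<lambda>z. f' z b)"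
  unfolding dir_deriv_def
proof
  fix z
  have "((\<lambda>t. z + t *\<^sub>R b) has_derivative (\<lambda>t. t *\<^sub>R b)) (at (0::real))"
    by (auto intro!: derivative_eq_intros)
  from has_derivative_compose[OF this, of f "f' z"] assms
  have "((\<lambda>t. f (z + t *\<^sub>R b)) has_derivative (\<lambda>t. f' z (t *\<^sub>R b))) (at 0)" by simp
  moreover have "(\<lambda>t. f' z (t *\<^sub>R b)) = (*) (f' z b)"
    using linear_scale[OF has_derivative_linear[OF assms]] by (auto simp: fun_eq_iff)
  ultimately show "((\<lambda>t. f (z + t *\<^sub>R b)) has_real_derivative f' z b) (at 0)"
    by (simp add: has_field_derivative_def)
qed

lemma dir_deriv_mult:
  assumes "dir_deriv b f f'" "dir_deriv b g g'"
  shows "dir_deriv b (\<lambda>z. f z * g z) (\<lambda>z. f' z * g z + f z * g' z)"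
  unfolding dir_deriv_def
proof
  fix z
  from DERIV_mult[OF assms(1)[unfolded dir_deriv_def, rule_format, of z] assms(2)[unfolded dir_deriv_def, rule_format, of z]]
  show "((\<lambda>t. f (z + t *\<^sub>R b) * g (z + t *\<^sub>R b)) has_real_derivative f' z * g z + f z * g' z) (at 0)"
    by (simp add: algebra_simps)
qed

lemma dir_deriv_compose:
  assumes "dir_deriv b f f'" "\<And>z. (h has_real_derivative h' (f z)) (at (f z))"
  shows "dir_deriv b (\<lambda>z. h (f z)) (\<lambda>z. h' (f z) * f' z)"
  unfolding dir_deriv_def
proof
  fix z
  have "((\<lambda>t. f (z + t *\<^sub>R b)) has_real_derivative f' z) (at 0)"
    using assms(1) by (simp add: dir_deriv_def)
  from DERIV_chain2[OF _ this, of h "h' (f z)"] assms(2)[of z]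
  show "((\<lambda>t. h (f (z + t *\<^sub>R b))) has_real_derivative h' (f z) * f' z) (at 0)" by simp
qed

text \<open>The mean value inequality on the segment, for \<open>f\<close> minus its linear part at
  \<open>z\<close>. Uniform continuity of \<open>f'\<close> makes the admissible step independent of
  \<open>z\<close>.\<close>

lemma dir_deriv_uniform:
  assumes f: "dir_deriv b f f'" and u: "uniformly_continuous_on UNIV f'" and e: "e > 0"
  obtains d where "d > 0" "\<And>h z. \<bar>h\<bar> < d \<Longrightarrow> \<bar>f (z + h *\<^sub>R b) - f z - h * f' z\<bar> \<le> e * \<bar>h\<bar>"
proof -
  obtain d where d: "d > 0" "\<And>x y. dist y x < d \<Longrightarrow> dist (f' y) (f' x) < e"
    using u e unfolding uniformly_continuous_on_def by (metis UNIV_I)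
  define d' where "d' = d / (norm b + 1)"
  have nb: "norm b + 1 > 0" using norm_ge_zero[of b] by linarith
  have d': "d' > 0" using d nb by (simp add: d'_def)
  have "\<bar>f (z + h *\<^sub>R b) - f z - h * f' z\<bar> \<le> e * \<bar>h\<bar>" if h: "\<bar>h\<bar> < d'" for h z
  proof -
    let ?g = "\<lambda>t. f (z + t *\<^sub>R b) - t * f' z"
    have "norm (?g h - ?g 0) \<le> e * norm (h - 0)"
    proof (rule field_differentiable_bound[of "{-d'<..<d'}"])
      show "(?g has_real_derivative (f' (z + t *\<^sub>R b) - f' z)) (at t within {- d'<..<d'})" for t
        by (rule DERIV_subset[of _ _ _ UNIV]) (auto intro!: derivative_eq_intros dir_deriv_at[OF f])
      fix t assume t: "t \<in> {- d'<..<d'}"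
      have "\<bar>t\<bar> * norm b \<le> \<bar>t\<bar> * (norm b + 1)" by (intro mult_left_mono) auto
      also have "\<bar>t\<bar> * (norm b + 1) < d' * (norm b + 1)"
        using t nb by (intro mult_strict_right_mono) auto
      also have "d' * (norm b + 1) = d" using nb by (simp add: d'_def)
      finally have "dist (z + t *\<^sub>R b) z < d" by (simp add: dist_norm)
      then show "norm (f' (z + t *\<^sub>R b) - f' z) \<le> e" using d(2) by (auto simp: dist_norm intro: less_imp_le)
    qed (use h d' in auto)
    then show ?thesis by (simp add: algebra_simps)
  qed
  then show ?thesis using d' that by blast
qed

text \<open>Differentiability from a bound on the increment with a fixed extra factor
  \<open>C\<close>, such as an L1 norm. Dividing by \<open>C + 1\<close> in the proof covers
  \<open>C = 0\<close>.\<close>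

lemma DERIV_from_error:
  fixes g :: "real \<Rightarrow> real"
  assumes C: "C \<ge> 0"
    and e: "\<And>e. e > 0 \<Longrightarrow> \<exists>d>0. \<forall>h. \<bar>h\<bar> < d \<longrightarrow> \<bar>g h - g 0 - h * D\<bar> \<le> e * \<bar>h\<bar> * C"
  shows "(g has_real_derivative D) (at 0)"
  unfolding DERIV_def
proof (rule LIM_I)
  fix r :: real assume r: "r > 0"
  define e where "e = r / (C + 1)"
  have e': "e > 0" "e * C < r" using r C by (auto simp: e_def field_simps)
  obtain d where d: "d > 0" "\<And>h. \<bar>h\<bar> < d \<Longrightarrow> \<bar>g h - g 0 - h * D\<bar> \<le> e * \<bar>h\<bar> * C"
    using e[OF e'(1)] by blast
  have "norm ((g (0 + h) - g 0) / h - D) < r" if "h \<noteq> 0" "norm (h - 0) < d" for h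
  proof -
    have "(g (0 + h) - g 0) / h - D = (g h - g 0 - h * D) / h" using that by (simp add: field_simps)
    also have "norm \<dots> = \<bar>g h - g 0 - h * D\<bar> / \<bar>h\<bar>" by simp
    also have "\<dots> \<le> e * C" using d(2)[of h] that by (simp add: pos_divide_le_eq mult.commute mult.left_commute)
    finally show ?thesis using e' by simp
  qed
  then show "\<exists>s>0. \<forall>x. x \<noteq> 0 \<and> norm (x - 0) < s \<longrightarrow> norm ((g (0 + x) - g 0) / x - D) < r"
    using d(1) by blast
qed

text \<open>The first-order error of the kernel is uniform in the point, so integrating it against
  \<open>f\<close> costs only the L1 norm of \<open>f\<close>.\<close>

lemma dir_deriv_conv:
  fixes \<rho> :: "'a::euclidean_space \<Rightarrow> real"
  assumes f: "integrable lebesgue f"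
    and \<rho>: "dir_deriv b \<rho> \<rho>'" "continuous_on UNIV \<rho>" "\<And>z. \<bar>\<rho> z\<bar> \<le> B"
    and \<rho>': "uniformly_continuous_on UNIV \<rho>'" "\<And>z. \<bar>\<rho>' z\<bar> \<le> B'"
  shows "dir_deriv b (conv f \<rho>) (conv f \<rho>')"
  unfolding dir_deriv_def
proof
  fix z
  note c' = uniformly_continuous_imp_continuous[OF \<rho>'(1)]
  note i = integrable_conv[OF f \<rho>(2,3)] and i' = integrable_conv[OF f c' \<rho>'(2)]
  show "((\<lambda>t. conv f \<rho> (z + t *\<^sub>R b)) has_real_derivative conv f \<rho>' z) (at 0)"
  proof (rule DERIV_from_error[where C = "LINT y|lebesgue. \<bar>f y\<bar>"])
    fix e :: real assume "e > 0"
    then obtain d where d: "d > 0" "\<And>h z. \<bar>h\<bar> < d \<Longrightarrow> \<bar>\<rho> (z + h *\<^sub>R b) - \<rho> z - h * \<rho>' z\<bar> \<le> e * \<bar>h\<bar>"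
      using dir_deriv_uniform[OF \<rho>(1) \<rho>'(1)] by blast
    have "\<bar>conv f \<rho> (z + h *\<^sub>R b) - conv f \<rho> z - h * conv f \<rho>' z\<bar> \<le> e * \<bar>h\<bar> * (LINT y|lebesgue. \<bar>f y\<bar>)"
      if h: "\<bar>h\<bar> < d" for h
    proof -
      let ?k = "\<lambda>y. f y * \<rho> (z + h *\<^sub>R b - y) - f y * \<rho> (z - y) - h * (f y * \<rho>' (z - y))"
      have k: "integrable lebesgue ?k"
        by (intro Bochner_Integration.integrable_diff i i' integrable_mult_right)
      have "conv f \<rho> (z + h *\<^sub>R b) - conv f \<rho> z - h * conv f \<rho>' z = (LINT y|lebesgue. ?k y)"
        unfolding conv_def
        by (simp add: Bochner_Integration.integral_diff Bochner_Integration.integrable_diff i i')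
      also have "\<bar>\<dots>\<bar> \<le> (LINT y|lebesgue. (e * \<bar>h\<bar>) * \<bar>f y\<bar>)"
      proof (rule integral_abs_bound_integral[OF k])
        show "integrable lebesgue (\<lambda>y. (e * \<bar>h\<bar>) * \<bar>f y\<bar>)" using f by simp
        fix y
        have "\<bar>f y\<bar> * \<bar>\<rho> ((z - y) + h *\<^sub>R b) - \<rho> (z - y) - h * \<rho>' (z - y)\<bar> \<le> \<bar>f y\<bar> * (e * \<bar>h\<bar>)"
          by (intro mult_left_mono d(2) h) auto
        moreover have "?k y = f y * (\<rho> ((z - y) + h *\<^sub>R b) - \<rho> (z - y) - h * \<rho>' (z - y))"
          by (simp add: algebra_simps)
        ultimately show "\<bar>?k y\<bar> \<le> (e * \<bar>h\<bar>) * \<bar>f y\<bar>"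
          by (simp add: abs_mult mult.commute)
      qed
      finally show ?thesis by simp
    qed
    then show "\<exists>d>0. \<forall>h. \<bar>h\<bar> < d \<longrightarrow> \<bar>conv f \<rho> (z + h *\<^sub>R b) - conv f \<rho> (z + 0 *\<^sub>R b) - h * conv f \<rho>' z\<bar> \<le> e * \<bar>h\<bar> * (LINT y|lebesgue. \<bar>f y\<bar>)"
      using d(1) by auto
  qed simp
qed

text \<open>Translation invariance does the work: \<Phi> and its shift by \<open>h\<close> along
  \<open>b\<close> have equal integrals, so \<open>h\<close> times the integral of
  \<open>\<Phi>'\<close> is, up to sign, the integral of the first-order error, which is at most
  \<open>e * h * V\<close>.\<close>

lemma integral_dir_deriv_zero:
  fixes \<Phi> :: "'a::euclidean_space \<Rightarrow> real"
  assumes \<Phi>: "dir_deriv b \<Phi> \<Phi>'" "continuous_on UNIV \<Phi>" "continuous_on UNIV \<Phi>'"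
    and K: "compact K" "\<And>z. z \<notin> K \<Longrightarrow> \<Phi> z = 0" "\<And>z. z \<notin> K \<Longrightarrow> \<Phi>' z = 0"
  shows "(LINT z|lebesgue. \<Phi>' z) = 0"
proof -
  obtain R where R: "\<And>z. z \<in> K \<Longrightarrow> norm z \<le> R"
    using compact_imp_bounded[OF K(1)] by (auto simp: bounded_iff)
  \<comment> \<open>The ball contains the support of the error for every positive shift
    \<open>h \<le> 1\<close>.\<close>
  define V where "V = measure lebesgue (cball (0::'a) (R + norm b))"
  have i: "integrable lebesgue \<Phi>" by (rule integrable_continuous_compact_support[OF \<Phi>(2) K(1,2)])
  have i': "integrable lebesgue \<Phi>'" by (rule integrable_continuous_compact_support[OF \<Phi>(3) K(1,3)])
  have mb: "\<Phi> \<in> borel_measurable borel" by (intro borel_measurable_continuous_onI \<Phi>)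

  have "\<bar>LINT z|lebesgue. \<Phi>' z\<bar> \<le> e * V" if e: "e > 0" for e
  proof -
    obtain d where d: "d > 0" "\<And>h z. \<bar>h\<bar> < d \<Longrightarrow> \<bar>\<Phi> (z + h *\<^sub>R b) - \<Phi> z - h * \<Phi>' z\<bar> \<le> e * \<bar>h\<bar>"
      using dir_deriv_uniform[OF \<Phi>(1) uniformly_continuous_compact_support[OF \<Phi>(3) K(1,3)] e] by blast
    define h where "h = min (d / 2) 1"
    have h: "0 < h" "h < d" "h \<le> 1" using d(1) by (auto simp: h_def)
    have tr: "(LINT z|lebesgue. \<Phi> (z + h *\<^sub>R b)) = (LINT z|lebesgue. \<Phi> z)"
      using integral_lebesgue_translation[OF mb, of "h *\<^sub>R b"] by (simp add: add.commute)
    have ti: "integrable lebesgue (\<lambda>z. \<Phi> (z + h *\<^sub>R b))"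
    proof (rule integrable_continuous_compact_support[of _ "(\<lambda>z. z - h *\<^sub>R b) ` K"])
      show "continuous_on UNIV (\<lambda>z. \<Phi> (z + h *\<^sub>R b))"
        by (intro continuous_on_compose2[OF \<Phi>(2)] continuous_intros) auto
      show "compact ((\<lambda>z. z - h *\<^sub>R b) ` K)"
        by (intro compact_continuous_image continuous_intros K)
      show "\<Phi> (z + h *\<^sub>R b) = 0" if "z \<notin> (\<lambda>z. z - h *\<^sub>R b) ` K" for z
        using that by (intro K(2)) (metis add_diff_cancel image_eqI)
    qed
    have "h * (LINT z|lebesgue. \<Phi>' z) = - (LINT z|lebesgue. \<Phi> (z + h *\<^sub>R b) - \<Phi> z - h * \<Phi>' z)"
      using tr i i' ti by simp
    also have "\<bar>\<dots>\<bar> \<le> (LINT z|lebesgue. (e * h) * indicator (cball (0::'a) (R + norm b)) z)"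
      unfolding abs_minus_cancel
    proof (rule integral_abs_bound_integral)
      show "integrable lebesgue (\<lambda>z. \<Phi> (z + h *\<^sub>R b) - \<Phi> z - h * \<Phi>' z)"
        using i i' ti by simp
      show "integrable lebesgue (\<lambda>z. (e * h) * indicator (cball (0::'a) (R + norm b)) z)"
        by (intro integrable_mult_right) (use lmeasurable_cball[of "0::'a" "R + norm b"] in \<open>simp add: fmeasurable_def\<close>)
      fix z
      show "\<bar>\<Phi> (z + h *\<^sub>R b) - \<Phi> z - h * \<Phi>' z\<bar> \<le> (e * h) * indicator (cball 0 (R + norm b)) z"
      proof (cases "z \<in> cball 0 (R + norm b)")
        case True
        then show ?thesis using d(2)[of h z] h by simp
      next
        case False
        have "norm z \<le> norm (z + h *\<^sub>R b) + norm (h *\<^sub>R b)" by (metis add_diff_cancel norm_triangle_ineq4)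
        moreover have "norm (h *\<^sub>R b) \<le> norm b" using h mult_right_mono[of h 1 "norm b"] by simp
        ultimately have "norm (z + h *\<^sub>R b) > R" "norm z > R" using False norm_ge_zero[of b]
          by (simp_all del: norm_ge_zero)
        then have "z + h *\<^sub>R b \<notin> K" "z \<notin> K" using R by force+
        then have "\<Phi> (z + h *\<^sub>R b) - \<Phi> z - h * \<Phi>' z = 0" by (simp add: K)
        then show ?thesis using h e by (simp add: indicator_def)
      qed
    qed
    also have "\<dots> = h * (e * V)" by (simp add: V_def)
    finally have "h * \<bar>LINT z|lebesgue. \<Phi>' z\<bar> \<le> h * (e * V)"
      using h by (simp add: abs_mult)
    then show ?thesis using h by simp
  qed
  note * = this
  have V: "V \<ge> 0" by (simp add: V_def)
  have "\<bar>LINT z|lebesgue. \<Phi>' z\<bar> \<le> 0"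
  proof (rule field_le_epsilon)
    fix e :: real assume "e > 0"
    then have "e / (V + 1) > 0" "e / (V + 1) * V \<le> e" using V by (auto simp: field_simps)
    then show "\<bar>LINT z|lebesgue. \<Phi>' z\<bar> \<le> 0 + e" using *[of "e / (V + 1)"] by linarith
  qed
  then show ?thesis by simp
qed

section \<open>Local integrability and the derivatives of the kernel\<close>

lemma L_loc_measurable:
  assumes "L_loc r S f" "open S"
  shows "(\<lambda>z. indicator S z * f z) \<in> borel_measurable lebesgue"
proof -
  have "S \<in> sets lebesgue" using assms(2) by simp
  then show ?thesis
    using assms(1) borel_measurable_restrict_space_iff[of S lebesgue f]
    by (simp add: L_loc_def)
qed

lemma L_loc_1_integrable:
  assumes f: "L_loc 1 S f" and S: "open S" and K: "compact K" "K \<subseteq> S"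
  shows "integrable lebesgue (\<lambda>z. indicator K z * f z)"
proof -
  have Ks: "K \<in> sets lebesgue" using K by (simp add: compact_imp_closed)
  have "(\<lambda>z. indicator K z * (indicator S z * f z)) \<in> borel_measurable lebesgue"
    by (rule borel_measurable_times[OF borel_measurable_indicator[OF Ks] L_loc_measurable[OF f S]])
  moreover have "(\<lambda>z. indicator K z * (indicator S z * f z)) = (\<lambda>z. indicator K z * f z)"
    using K by (auto simp: indicator_def fun_eq_iff)
  ultimately have m: "(\<lambda>z. indicator K z * f z) \<in> borel_measurable lebesgue" by simp
  have "set_integrable lebesgue K (\<lambda>z. \<bar>f z\<bar> powr 1)" using f K by (auto simp: L_loc_def)
  then have "integrable lebesgue (\<lambda>z. \<bar>indicator K z * f z\<bar>)"
    by (simp add: set_integrable_def abs_mult)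
  then show ?thesis
    using m integrable_iff_bounded[of lebesgue "\<lambda>z. \<bar>indicator K z * f z\<bar>"]
      integrable_iff_bounded[of lebesgue "\<lambda>z. indicator K z * f z"] by auto
qed

lemma partial_reflect:
  assumes "\<And>z. f differentiable at z"
  shows "partial b (\<lambda>y. f (a - y)) z = - partial b f (a - z)"
proof -
  have "((\<lambda>y. a - y) has_derivative (\<lambda>b. - b)) (at z)"
    by (auto intro!: derivative_eq_intros)
  from has_derivative_compose[OF this assms[of "a - z", unfolded frechet_derivative_works]]
  have "((\<lambda>y. f (a - y)) has_derivative (\<lambda>b. frechet_derivative f (at (a - z)) (- b))) (at z)" .
  moreover have "linear (frechet_derivative f (at (a - z)))"
    using assms linear_frechet_derivative by blast
  ultimately show ?thesis
    using frechet_derivative_at[of "\<lambda>y. f (a - y)" _ z] by (auto simp: partial_def linear_neg)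
qed

lemma mollifier_differentiable: "mollifier d differentiable (at (z::'a::euclidean_space))"
  using C_k_mollifier[of "Suc 0" "UNIV::'a set" d] by simp

text \<open>Where it vanishes, the non-negative kernel attains a minimum, so its derivative is 0.
  This includes the sphere \<open>norm z = d\<close>, where no neighbourhood of zeros is
  available.\<close>

lemma partial_mollifier_zero:
  assumes "norm z \<ge> d" "d > 0"
  shows "partial b (mollifier d) z = 0"
proof -
  have "frechet_derivative (mollifier d) (at z) = (\<lambda>v. 0)"
    by (rule differential_zero_maxmin[of z UNIV "mollifier d"])
       (use assms in \<open>auto simp: mollifier_nonneg mollifier_zero mollifier_differentiable frechet_derivative_works[symmetric]\<close>)
  then show ?thesis by (simp add: partial_def)
qed

lemma continuous_partial_mollifier:
  fixes b :: "'a::euclidean_space"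
  shows "b \<in> Basis \<Longrightarrow> continuous_on UNIV (partial b (mollifier d))"
  using C_k_mollifier[of "Suc 0" "UNIV::'a set" d] by simp

lemma dir_deriv_mollifier: "dir_deriv b (mollifier d) (partial b (mollifier d))"
  unfolding partial_def
  by (rule has_derivative_imp_dir_deriv)
     (simp add: mollifier_differentiable frechet_derivative_works[symmetric])

lemma partial_mollifier_uniformly_continuous:
  fixes b :: "'a::euclidean_space"
  assumes "d > 0" "b \<in> Basis"
  shows "uniformly_continuous_on UNIV (partial b (mollifier d))"
  by (rule uniformly_continuous_compact_support[of _ "cball (0::'a) d"])
     (use assms in \<open>auto intro: continuous_partial_mollifier partial_mollifier_zero\<close>)

lemma partial_mollifier_bounded:
  fixes b :: "'a::euclidean_space"
  assumes "d > 0" "b \<in> Basis"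
  obtains B where "B > 0" "\<And>z. \<bar>partial b (mollifier d) z\<bar> \<le> B"
  by (rule bounded_compact_support[of "partial b (mollifier d)" "cball (0::'a) d"])
     (use assms in \<open>auto intro: continuous_partial_mollifier partial_mollifier_zero\<close>)

lemma integrable_conv_partial:
  assumes "integrable lebesgue f" "d > 0" "b \<in> Basis"
  shows "integrable lebesgue (\<lambda>y. f y * partial b (mollifier d) (z - y))"
  by (rule partial_mollifier_bounded[OF assms(2,3)])
     (rule integrable_conv[OF assms(1) continuous_partial_mollifier[OF assms(3)]])

lemma continuous_conv_partial:
  assumes "integrable lebesgue f" "d > 0" "b \<in> Basis"
  shows "continuous_on UNIV (conv f (partial b (mollifier d)))"
  by (rule partial_mollifier_bounded[OF assms(2,3)])
     (rule continuous_conv[OF assms(1) partial_mollifier_uniformly_continuous[OF assms(2,3)]])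

lemma dir_deriv_conv_mollifier:
  assumes "integrable lebesgue f" "d > 0" "b \<in> Basis"
  shows "dir_deriv b (conv f (mollifier d)) (conv f (partial b (mollifier d)))"
  by (rule mollifier_bounded[OF assms(2)], rule partial_mollifier_bounded[OF assms(2,3)])
     (rule dir_deriv_conv[OF assms(1) dir_deriv_mollifier continuous_mollifier _
        partial_mollifier_uniformly_continuous[OF assms(2,3)]])

text \<open>Makes the reflected kernel centred at \<open>z\<close> admissible in the weak
  formulation. This is the one use of smoothness of the kernel beyond first order.\<close>

lemma test_fun_mollifier:
  assumes d: "d > 0" "cball z d \<subseteq> S"
  shows "test_fun S (\<lambda>y. mollifier d (z - y))"
proof -
  have "C_k_on k UNIV (\<lambda>y. 1 * mollifier d (z - y))" for k
    by (intro C_k_on_reflect C_k_mollifier)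
  then have "C_inf_on S (\<lambda>y. mollifier d (z - y))"
    by (auto simp: C_inf_on_def intro: C_k_on_subset)
  moreover have "closure {y. mollifier d (z - y) \<noteq> 0} \<subseteq> cball z d"
    by (rule closure_minimal)
       (use mollifier_zero[OF _ d(1)] in \<open>force simp: dist_norm not_le intro: less_imp_le\<close>, simp)
  moreover from this have "compact (closure {y. mollifier d (z - y) \<noteq> 0})"
    unfolding compact_eq_bounded_closed using bounded_subset[OF bounded_cball] by blast
  ultimately show ?thesis
    using d(2) unfolding test_fun_def by blast
qed

section \<open>Order and product estimates for mollified functions\<close>

lemma conv_mono:
  assumes "integrable lebesgue f" "integrable lebesgue g" "d > 0" "AE y in lebesgue. f y \<le> g y"
  shows "conv f (mollifier d) z \<le> conv g (mollifier d) z"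
  unfolding conv_def
  by (intro integral_mono_AE integrable_conv_mollifier assms)
     (use assms(4) in eventually_elim, simp add: mult_right_mono mollifier_nonneg)

lemma conv_add:
  assumes "integrable lebesgue f" "integrable lebesgue g" "d > 0"
  shows "conv (\<lambda>z. f z + g z) (mollifier d) z = conv f (mollifier d) z + conv g (mollifier d) z"
  unfolding conv_def distrib_right
  by (intro Bochner_Integration.integral_add integrable_conv_mollifier assms)

lemma conv_sum:
  assumes "\<And>i. i \<in> I \<Longrightarrow> integrable lebesgue (f i)" "d > 0"
  shows "conv (\<lambda>z. \<Sum>i\<in>I. f i z) (mollifier d) z = (\<Sum>i\<in>I. conv (f i) (mollifier d) z)"
  unfolding conv_def sum_distrib_right
  by (intro Bochner_Integration.integral_sum integrable_conv_mollifier assms)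

lemma abs_conv_le:
  assumes "integrable lebesgue f" "d > 0"
  shows "\<bar>conv f (mollifier d) z\<bar> \<le> conv (\<lambda>z. \<bar>f z\<bar>) (mollifier d) z"
proof -
  have "\<bar>conv f (mollifier d) z\<bar> \<le> (LINT y|lebesgue. \<bar>f y * mollifier d (z - y)\<bar>)"
    unfolding conv_def by (rule integral_abs_bound)
  then show ?thesis by (simp add: conv_def abs_mult mollifier_nonneg)
qed

lemma conv_const_mult: "conv (\<lambda>z. c * f z) \<rho> z = c * conv f \<rho> z"
  by (simp add: conv_def mult.assoc)

text \<open>The constant function \<open>c\<close> is not integrable, but convolving it with a mollifier of
  integral one gives \<open>c\<close> back.\<close>

lemma conv_le_const_add:
  assumes f: "integrable lebesgue f" and g: "integrable lebesgue g" and d: "d > 0"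
    and le: "\<And>y. f y \<le> c + g y"
  shows "conv f (mollifier d) z \<le> c + conv g (mollifier d) z"
proof -
  have mi: "integrable lebesgue (\<lambda>y. mollifier d (z - y))"
    using integral_mollifier_translate[OF d, of z] not_integrable_integral_eq by fastforce
  have "conv f (mollifier d) z \<le> (LINT y|lebesgue. c * mollifier d (z - y) + g y * mollifier d (z - y))"
    unfolding conv_def
  proof (rule integral_mono)
    show "f y * mollifier d (z - y) \<le> c * mollifier d (z - y) + g y * mollifier d (z - y)" for y
      using mult_right_mono[OF le mollifier_nonneg, of y d "z - y"] by (simp add: distrib_right)
  qed (intro Bochner_Integration.integrable_add integrable_mult_right integrable_conv_mollifier mi f g d)+
  also have "\<dots> = c + conv g (mollifier d) z"
    by (subst Bochner_Integration.integral_add)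
       (auto simp: conv_def mi integrable_conv_mollifier[OF g d] integral_mollifier_translate[OF d])
  finally show ?thesis .
qed

text \<open>The two-point bound is averaged twice against the kernel of mass one, first in
  \<open>y\<close> with \<open>y'\<close> fixed, then in \<open>y'\<close>. A bound at a common
  point would not do, as a product of averages pairs values at different points.\<close>

lemma conv_product_le:
  assumes f: "integrable lebesgue f" and g: "integrable lebesgue g"
    and P: "integrable lebesgue P" and Q: "integrable lebesgue Q" and d: "d > 0"
    and le: "\<And>y y'. \<bar>f y\<bar> * \<bar>g y'\<bar> \<le> P y + Q y'"
  shows "conv (\<lambda>z. \<bar>f z\<bar>) (mollifier d) z * conv (\<lambda>z. \<bar>g z\<bar>) (mollifier d) z
    \<le> conv P (mollifier d) z + conv Q (mollifier d) z"
proof -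
  let ?c = "conv (\<lambda>z. \<bar>f z\<bar>) (mollifier d) z"
  have 1: "?c * \<bar>g y'\<bar> \<le> Q y' + conv P (mollifier d) z" for y'
  proof -
    have "\<bar>g y'\<bar> * ?c = conv (\<lambda>z. \<bar>g y'\<bar> * \<bar>f z\<bar>) (mollifier d) z"
      by (simp add: conv_const_mult)
    also have "\<dots> \<le> Q y' + conv P (mollifier d) z"
      by (rule conv_le_const_add) (use le[of _ y'] f P d in \<open>auto simp: mult.commute add.commute\<close>)
    finally show ?thesis by (simp add: mult.commute)
  qed
  have "?c * conv (\<lambda>z. \<bar>g z\<bar>) (mollifier d) z = conv (\<lambda>z. ?c * \<bar>g z\<bar>) (mollifier d) z"
    by (simp add: conv_const_mult)
  also have "\<dots> \<le> conv P (mollifier d) z + conv Q (mollifier d) z"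
    by (rule conv_le_const_add) (use 1 f g Q d in \<open>auto simp: add.commute\<close>)
  finally show ?thesis .
qed

section \<open>The mollified inequality\<close>

text \<open>The bound \<open>\<bar>F i y\<bar> * \<bar>X i y'\<bar> \<le> P y + Q y'\<close> is required at two different points so that
  it passes to products of mollified functions. It replaces the dual integrability exponents of
  the flux and the gradient.\<close>

locale weak_inequality =
  fixes S :: "'a::euclidean_space set" and b0 :: 'a and b :: "'i::finite \<Rightarrow> 'a"
    and w wt g :: "'a \<Rightarrow> real" and F X :: "'i \<Rightarrow> 'a \<Rightarrow> real" and P Q :: "'a \<Rightarrow> real"
  assumes S: "open S"
    and b0: "b0 \<in> Basis" and b: "\<And>i. b i \<in> Basis"
    and w_t: "has_weak_partial S b0 w wt"
    and w_x: "\<And>i. has_weak_partial S (b i) w (X i)"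
    and F: "\<And>i. L_loc 1 S (F i)" and g: "L_loc 1 S g"
    and P: "L_loc 1 S P" and Q: "L_loc 1 S Q"
    and P0: "\<And>z. P z \<ge> 0" and Q0: "\<And>z. Q z \<ge> 0"
    and PQ: "\<And>i y y'. \<bar>F i y\<bar> * \<bar>X i y'\<bar> \<le> P y + Q y'"
    and w_nonneg: "AE z in lebesgue. z \<in> S \<longrightarrow> w z \<ge> 0"
    and ineq: "\<And>\<phi>. test_fun S \<phi> \<Longrightarrow> (\<And>z. \<phi> z \<ge> 0) \<Longrightarrow>
      (LINT z:S|lebesgue. wt z * \<phi> z + (\<Sum>i\<in>UNIV. F i z * partial (b i) \<phi> z) - g z * \<phi> z) \<ge> 0"
begin

lemma w: "L_loc 1 S w" and wt: "L_loc 1 S wt" and X: "L_loc 1 S (X i)"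
  using w_t w_x by (auto simp: has_weak_partial_def)

abbreviation restr :: "'a set \<Rightarrow> ('a \<Rightarrow> real) \<Rightarrow> 'a \<Rightarrow> real" where
  "restr K f \<equiv> (\<lambda>z. indicator K z * f z)"

text \<open>Convolution acts on functions on the whole space. Restriction to a compact
  \<open>K\<close> containing the support of the kernel makes the data globally integrable without
  changing the value.\<close>

lemma LINT_restr_conv:
  assumes "cball z d \<subseteq> K" "K \<subseteq> S" "\<And>y. y \<notin> cball z d \<Longrightarrow> h y = 0"
  shows "(LINT y:S|lebesgue. f y * h y) = (LINT y|lebesgue. restr K f y * h y)"
  unfolding set_lebesgue_integral_def
proof (intro Bochner_Integration.integral_cong refl)
  fix y
  show "indicator S y *\<^sub>R (f y * h y) = restr K f y * h y"
    using assms by (cases "y \<in> cball z d") (auto simp: indicator_def)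
qed

text \<open>The weak derivative is tested with the reflected kernel centred at \<open>z\<close>; the
  sign of the weak formula and the sign of the reflection cancel.\<close>

lemma conv_weak_partial:
  assumes wp: "has_weak_partial S c f fc" and c: "c \<in> Basis"
    and d: "d > 0" "cball z d \<subseteq> K" "K \<subseteq> S"
  shows "conv (restr K f) (partial c (mollifier d)) z = conv (restr K fc) (mollifier d) z"
proof -
  let ?\<phi> = "\<lambda>y. mollifier d (z - y)"
  have t: "test_fun S ?\<phi>" by (rule test_fun_mollifier) (use d in auto)
  have p: "partial c ?\<phi> y = - partial c (mollifier d) (z - y)" for y
    by (rule partial_reflect) (rule mollifier_differentiable)
  have z1: "y \<notin> cball z d \<Longrightarrow> partial c ?\<phi> y = 0" for y
    unfolding p using partial_mollifier_zero[of d "z - y" c] d(1) by (simp add: dist_norm)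
  have z2: "y \<notin> cball z d \<Longrightarrow> ?\<phi> y = 0" for y
    using mollifier_zero[of d "z - y"] d(1) by (simp add: dist_norm)
  have "(LINT y:S|lebesgue. f y * partial c ?\<phi> y) = - (LINT y:S|lebesgue. fc y * ?\<phi> y)"
    using wp t by (auto simp: has_weak_partial_def)
  then have "(LINT y|lebesgue. restr K f y * partial c ?\<phi> y) = - (LINT y|lebesgue. restr K fc y * ?\<phi> y)"
    using LINT_restr_conv[OF d(2,3) z1, where f = f] LINT_restr_conv[OF d(2,3) z2, where f = fc] by simp
  then show ?thesis by (simp add: p conv_def)
qed

text \<open>Testing with the kernel centred at \<open>z\<close> gives an inequality at the point
  \<open>z\<close> itself. All derivatives fall on the kernel, where they become derivatives of
  smooth convolutions.\<close>

lemma pointwise_ineq: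
  assumes d: "d > 0" "cball z d \<subseteq> K" "K \<subseteq> S" and K: "compact K"
  shows "0 \<le> conv (restr K w) (partial b0 (mollifier d)) z
    - (\<Sum>i\<in>UNIV. conv (restr K (F i)) (partial (b i) (mollifier d)) z)
    - conv (restr K g) (mollifier d) z"
proof -
  let ?\<phi> = "\<lambda>y. mollifier d (z - y)"
  have t: "test_fun S ?\<phi>" by (rule test_fun_mollifier) (use d in auto)
  have p: "partial c ?\<phi> y = - partial c (mollifier d) (z - y)" for y c
    by (rule partial_reflect) (rule mollifier_differentiable)
  have z1: "y \<notin> cball z d \<Longrightarrow> partial c ?\<phi> y = 0" for y c
    unfolding p using partial_mollifier_zero[of d "z - y" c] d(1) by (simp add: dist_norm)
  have z2: "y \<notin> cball z d \<Longrightarrow> ?\<phi> y = 0" for y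
    using mollifier_zero[of d "z - y"] d(1) by (simp add: dist_norm)
  note int = L_loc_1_integrable[OF _ S K d(3)]
  have "0 \<le> (LINT y:S|lebesgue. wt y * ?\<phi> y + (\<Sum>i\<in>UNIV. F i y * partial (b i) ?\<phi> y) - g y * ?\<phi> y)"
    by (rule ineq[OF t]) (rule mollifier_nonneg)
  also have "\<dots> = (LINT y|lebesgue. restr K wt y * ?\<phi> y
      - (\<Sum>i\<in>UNIV. restr K (F i) y * partial (b i) (mollifier d) (z - y)) - restr K g y * ?\<phi> y)"
    unfolding set_lebesgue_integral_def
  proof (intro Bochner_Integration.integral_cong refl)
    fix y
    show "indicator S y *\<^sub>R (wt y * ?\<phi> y + (\<Sum>i\<in>UNIV. F i y * partial (b i) ?\<phi> y) - g y * ?\<phi> y) =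
      restr K wt y * ?\<phi> y
      - (\<Sum>i\<in>UNIV. restr K (F i) y * partial (b i) (mollifier d) (z - y)) - restr K g y * ?\<phi> y"
    proof (cases "y \<in> cball z d")
      case True
      then have "y \<in> K" "y \<in> S" using d by auto
      then show ?thesis by (simp add: p sum_negf)
    next
      case False
      then show ?thesis using z1[OF False] z2[OF False] by (simp add: p)
    qed
  qed
  also have "\<dots> = conv (restr K wt) (mollifier d) z
    - (\<Sum>i\<in>UNIV. conv (restr K (F i)) (partial (b i) (mollifier d)) z) - conv (restr K g) (mollifier d) z"
    unfolding conv_def
    by (simp add: Bochner_Integration.integral_diff Bochner_Integration.integral_sum
        Bochner_Integration.integrable_diff Bochner_Integration.integrable_sum
        integrable_conv_mollifier[OF int[OF wt] d(1)] integrable_conv_mollifier[OF int[OF g] d(1)]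
        integrable_conv_partial[OF int[OF F] d(1) b])
  also have "conv (restr K wt) (mollifier d) z = conv (restr K w) (partial b0 (mollifier d)) z"
    by (rule conv_weak_partial[OF w_t b0 d, symmetric])
  finally show ?thesis .
qed

text \<open>The pointwise inequality is multiplied by \<open>\<beta> (W z) * \<psi> z\<close> and
  integrated by parts, with \<open>B\<close> an antiderivative of \<open>\<beta>\<close>.
  \<open>K\<close> carries \<psi>, and \<open>K'\<close> leaves room for the kernels centred in
  \<open>K\<close>. Hypotheses on the half-line are enough because mollified \<open>w\<close> is
  non-negative everywhere.\<close>

lemma mollified_inequality:
  fixes B \<beta> \<beta>' :: "real \<Rightarrow> real"
  assumes d: "d > 0" "\<And>z. z \<in> K \<Longrightarrow> cball z d \<subseteq> K'" "K' \<subseteq> S" and K: "compact K" "compact K'"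
    and B: "\<And>x. x \<ge> 0 \<Longrightarrow> (B has_real_derivative \<beta> x) (at x)"
    and \<beta>: "\<And>x. x \<ge> 0 \<Longrightarrow> (\<beta> has_real_derivative \<beta>' x) (at x)" "continuous_on {0..} \<beta>'"
    and \<beta>0: "\<And>x. x \<ge> 0 \<Longrightarrow> \<beta> x \<ge> 0"
    and \<psi>: "dir_deriv b0 \<psi> \<psi>0" "\<And>i. dir_deriv (b i) \<psi> (\<psi>x i)" "continuous_on UNIV \<psi>"
      "continuous_on UNIV \<psi>0" "\<And>i. continuous_on UNIV (\<psi>x i)" "\<And>z. \<psi> z \<ge> 0"
    and \<psi>K: "\<And>z. z \<notin> K \<Longrightarrow> \<psi> z = 0" "\<And>z. z \<notin> K \<Longrightarrow> \<psi>0 z = 0" "\<And>i z. z \<notin> K \<Longrightarrow> \<psi>x i z = 0"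
  defines "G \<equiv> \<lambda>wv Fv Xv gv z. - B wv * \<psi>0 z + (\<Sum>i\<in>UNIV. Fv i * (\<beta>' wv * Xv i * \<psi> z + \<beta> wv * \<psi>x i z)) - gv * \<beta> wv * \<psi> z"
  defines "GG \<equiv> \<lambda>z. G (conv (restr K' w) (mollifier d) z) (\<lambda>i. conv (restr K' (F i)) (mollifier d) z)
     (\<lambda>i. conv (restr K' (X i)) (mollifier d) z) (conv (restr K' g) (mollifier d) z) z"
  shows "integrable lebesgue GG" "0 \<le> (LINT z|lebesgue. GG z)"
    and "conv (restr K' w) (mollifier d) z \<ge> 0"
proof -
  note int = L_loc_1_integrable[OF _ S K(2) d(3)]
  let ?m = "mollifier d"
  define W where "W = conv (restr K' w) ?m"
  define W0 where "W0 = conv (restr K' w) (partial b0 ?m)"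
  define Wx where "Wx i = conv (restr K' w) (partial (b i) ?m)" for i
  define Fm where "Fm i = conv (restr K' (F i)) ?m" for i
  define Fx where "Fx i = conv (restr K' (F i)) (partial (b i) ?m)" for i
  define gm where "gm = conv (restr K' g) ?m"
  have W_pos: "W z \<ge> 0" for z
  proof -
    have "conv (\<lambda>_. 0) ?m z \<le> W z"
      unfolding W_def
      by (intro conv_mono int w d) (use w_nonneg d(3) in \<open>auto elim!: eventually_mono simp: indicator_def\<close>)
    then show ?thesis by (simp add: conv_def)
  qed
  then show "conv (restr K' w) (mollifier d) z \<ge> 0" by (simp add: W_def)
  have dd: "dir_deriv b0 W W0" "\<And>i. dir_deriv (b i) W (Wx i)" "\<And>i. dir_deriv (b i) (Fm i) (Fx i)"
    unfolding W_def W0_def Wx_def Fm_def Fx_def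
    by (intro dir_deriv_conv_mollifier int w F d b0 b)+
  have cont[continuous_intros]: "continuous_on UNIV W" "continuous_on UNIV W0" "continuous_on UNIV (Wx i)"
    "continuous_on UNIV (Fm i)" "continuous_on UNIV (Fx i)" "continuous_on UNIV gm" for i
    unfolding W_def W0_def Wx_def Fm_def Fx_def gm_def
    by (intro continuous_conv_mollifier continuous_conv_partial int w F g d b0 b)+
  have contB: "continuous_on {0..} B" "continuous_on {0..} \<beta>"
    using B \<beta>(1) by (auto intro!: continuous_at_imp_continuous_on dest: DERIV_isCont)
  have contW[continuous_intros]: "continuous_on UNIV (\<lambda>z. B (W z))" "continuous_on UNIV (\<lambda>z. \<beta> (W z))" "continuous_on UNIV (\<lambda>z. \<beta>' (W z))"
    by (rule continuous_on_compose2[OF contB(1) cont(1)] continuous_on_compose2[OF contB(2) cont(1)]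
        continuous_on_compose2[OF \<beta>(2) cont(1)], use W_pos in auto)+
  note \<psi>(3-5)[continuous_intros]
  have dB: "dir_deriv b0 (\<lambda>z. B (W z)) (\<lambda>z. \<beta> (W z) * W0 z)"
    "dir_deriv (b i) (\<lambda>z. \<beta> (W z)) (\<lambda>z. \<beta>' (W z) * Wx i z)" for i
    by (rule dir_deriv_compose; use dd B \<beta> W_pos in auto)+
  \<comment> \<open>\<open>p0\<close> and \<open>px i\<close> are the derivatives of the compactly
    supported products \<open>B (W z) * \<psi> z\<close> and
    \<open>Fm i z * (\<beta> (W z) * \<psi> z)\<close>, so their integrals vanish; \<open>r\<close>
    is the non-negative multiplied inequality.\<close>
  define p0 where "p0 z = (\<beta> (W z) * W0 z) * \<psi> z + B (W z) * \<psi>0 z" for z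
  define px where "px i z = Fx i z * (\<beta> (W z) * \<psi> z) + Fm i z * ((\<beta>' (W z) * Wx i z) * \<psi> z + \<beta> (W z) * \<psi>x i z)" for i z
  define r where "r z = (W0 z - (\<Sum>i\<in>UNIV. Fx i z) - gm z) * (\<beta> (W z) * \<psi> z)" for z
  have "(LINT z|lebesgue. p0 z) = 0"
    unfolding p0_def
    by (rule integral_dir_deriv_zero[OF dir_deriv_mult[OF dB(1) \<psi>(1)] _ _ K(1)])
       (intro continuous_intros | simp add: \<psi>K)+
  moreover have "(LINT z|lebesgue. px i z) = 0" for i
    unfolding px_def
    by (rule integral_dir_deriv_zero[OF dir_deriv_mult[OF dd(3) dir_deriv_mult[OF dB(2) \<psi>(2)]] _ _ K(1)])
       (intro continuous_intros | simp add: \<psi>K)+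
  moreover have cp: "continuous_on UNIV p0" "continuous_on UNIV (px i)" "continuous_on UNIV r" for i
    unfolding p0_def[abs_def] px_def[abs_def] r_def[abs_def] by (intro continuous_intros)+
  moreover have ip: "integrable lebesgue p0" "integrable lebesgue (px i)" "integrable lebesgue r" for i
    by (rule integrable_continuous_compact_support[OF cp(1) K(1)], simp add: p0_def \<psi>K)
       (rule integrable_continuous_compact_support[OF cp(2) K(1)], simp add: px_def \<psi>K,
        rule integrable_continuous_compact_support[OF cp(3) K(1)], simp add: r_def \<psi>K)
  \<comment> \<open>Derivatives move from the kernel back to \<open>w\<close> only where the ball of
    the kernel lies in \<open>K'\<close>, that is on \<open>K\<close>; elsewhere both sides vanish
    along with \<psi>.\<close>
  moreover have GG: "GG z = r z - p0 z + (\<Sum>i\<in>UNIV. px i z)" for z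
  proof (cases "z \<in> K")
    case True
    have x: "Wx i z = conv (restr K' (X i)) ?m z" for i
      unfolding Wx_def by (rule conv_weak_partial[OF w_x b d(1) d(2)[OF True] d(3)])
    have "(\<Sum>i\<in>UNIV. px i z) = (\<Sum>i\<in>UNIV. Fx i z) * (\<beta> (W z) * \<psi> z)
       + (\<Sum>i\<in>UNIV. Fm i z * (\<beta>' (W z) * Wx i z * \<psi> z + \<beta> (W z) * \<psi>x i z))"
      by (simp add: px_def sum.distrib sum_distrib_right)
    then show ?thesis
      unfolding GG_def G_def r_def p0_def x[symmetric] W_def[symmetric] Fm_def[symmetric] gm_def[symmetric]
      by (simp add: algebra_simps)
  next
    case False
    then show ?thesis by (simp add: GG_def G_def r_def p0_def px_def \<psi>K)
  qed
  ultimately show "integrable lebesgue GG" by (simp add: GG[abs_def])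
  have "(LINT z|lebesgue. r z) \<ge> 0"
  proof (rule Bochner_Integration.integral_nonneg)
    fix z
    show "r z \<ge> 0"
    proof (cases "z \<in> K")
      case True
      have "W0 z - (\<Sum>i\<in>UNIV. Fx i z) - gm z \<ge> 0"
        unfolding W0_def Fx_def gm_def by (rule pointwise_ineq[OF d(1) d(2)[OF True] d(3) K(2)])
      then show ?thesis unfolding r_def by (intro mult_nonneg_nonneg \<beta>0 W_pos \<psi>)
    qed (simp add: r_def \<psi>K)
  qed
  then show "0 \<le> (LINT z|lebesgue. GG z)"
    unfolding GG using ip \<open>(LINT z|lebesgue. p0 z) = 0\<close> \<open>\<And>i. (LINT z|lebesgue. px i z) = 0\<close>
    by (simp add: Bochner_Integration.integral_add Bochner_Integration.integral_diff Bochner_Integration.integral_sum)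
qed

end

context weak_inequality
begin

text \<open>Removal of the mollification. The growth bounds on \<open>B\<close>,
  \<open>\<beta>\<close> and \<open>\<beta>'\<close> reduce the convergence of all terms to that of
  the mollifications of a single integrable majorant \<open>h\<close>.\<close>

lemma energy_inequality:
  fixes B \<beta> \<beta>' :: "real \<Rightarrow> real"
  assumes K: "compact K" "K \<subseteq> S"
    and B: "\<And>x. x \<ge> 0 \<Longrightarrow> (B has_real_derivative \<beta> x) (at x)"
    and \<beta>: "\<And>x. x \<ge> 0 \<Longrightarrow> (\<beta> has_real_derivative \<beta>' x) (at x)" "continuous_on {0..} \<beta>'"
    and \<beta>0: "\<And>x. x \<ge> 0 \<Longrightarrow> \<beta> x \<ge> 0"
    and M: "M \<ge> 0" "\<And>x. x \<ge> 0 \<Longrightarrow> \<bar>B x\<bar> \<le> M * (1 + x)" "\<And>x. x \<ge> 0 \<Longrightarrow> \<beta> x \<le> M" "\<And>x. x \<ge> 0 \<Longrightarrow> \<bar>\<beta>' x\<bar> \<le> M"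
    and \<psi>: "dir_deriv b0 \<psi> \<psi>0" "\<And>i. dir_deriv (b i) \<psi> (\<psi>x i)" "continuous_on UNIV \<psi>"
      "continuous_on UNIV \<psi>0" "\<And>i. continuous_on UNIV (\<psi>x i)" "\<And>z. \<psi> z \<ge> 0"
    and \<psi>K: "\<And>z. z \<notin> K \<Longrightarrow> \<psi> z = 0" "\<And>z. z \<notin> K \<Longrightarrow> \<psi>0 z = 0" "\<And>i z. z \<notin> K \<Longrightarrow> \<psi>x i z = 0"
  defines "G \<equiv> \<lambda>wv Fv Xv gv z. - B wv * \<psi>0 z + (\<Sum>i\<in>UNIV. Fv i * (\<beta>' wv * Xv i * \<psi> z + \<beta> wv * \<psi>x i z)) - gv * \<beta> wv * \<psi> z"
  shows "integrable lebesgue (\<lambda>z. G (w z) (\<lambda>i. F i z) (\<lambda>i. X i z) (g z) z)"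
    and "0 \<le> (LINT z|lebesgue. G (w z) (\<lambda>i. F i z) (\<lambda>i. X i z) (g z) z)"
proof -
  obtain \<delta> where \<delta>: "\<delta> > 0" "(\<Union>x\<in>K. cball x \<delta>) \<subseteq> S"
    using compact_subset_open_imp_cball_epsilon_subset[OF K(1) S K(2)] by blast
  \<comment> \<open>The closed \<delta>-neighbourhood of \<open>K\<close>, written as a sum of two
    compact sets in order to be compact.\<close>
  define K' where "K' = {x + y | x y. x \<in> K \<and> y \<in> cball 0 \<delta>}"
  have K': "compact K'" unfolding K'_def by (intro compact_sums K compact_cball)
  have K'_eq: "K' = (\<Union>x\<in>K. cball x \<delta>)"
  proof (intro equalityI subsetI)
    fix z assume "z \<in> (\<Union>x\<in>K. cball x \<delta>)"
    then obtain x where x: "x \<in> K" "z \<in> cball x \<delta>" by blast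
    then have "z = x + (z - x)" "z - x \<in> cball 0 \<delta>" by (auto simp: dist_norm norm_minus_commute)
    then show "z \<in> K'" unfolding K'_def using x by blast
  next
    fix z assume "z \<in> K'"
    then obtain x y where "x \<in> K" "norm y \<le> \<delta>" "z = x + y" by (auto simp: K'_def)
    then show "z \<in> (\<Union>x\<in>K. cball x \<delta>)" by (auto intro!: bexI[of _ x] simp: dist_norm)
  qed
  then have K'S: "K' \<subseteq> S" using \<delta> by simp
  have KK': "K \<subseteq> K'" using \<delta>(1) unfolding K'_eq by force
  note int = L_loc_1_integrable[OF _ S K' K'S]
  note ints = int[OF w] int[OF g] int[OF F] int[OF X] int[OF P] int[OF Q]
  obtain M1 where M1: "M1 \<ge> 0" "\<And>z. \<psi> z \<le> M1" "\<And>z. \<bar>\<psi>0 z\<bar> \<le> M1" "\<And>i z. \<bar>\<psi>x i z\<bar> \<le> M1"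
  proof -
    obtain m1 where m1: "m1 > 0" "\<And>z. \<bar>\<psi> z\<bar> \<le> m1" using bounded_compact_support[OF \<psi>(3) K(1) \<psi>K(1)] by blast
    obtain m2 where m2: "m2 > 0" "\<And>z. \<bar>\<psi>0 z\<bar> \<le> m2" using bounded_compact_support[OF \<psi>(4) K(1) \<psi>K(2)] by blast
    have "\<exists>m>0. \<forall>z. \<bar>\<psi>x i z\<bar> \<le> m" for i using bounded_compact_support[OF \<psi>(5) K(1) \<psi>K(3)] by blast
    then obtain m3 where m3: "\<And>i. m3 i > 0" "\<And>i z. \<bar>\<psi>x i z\<bar> \<le> m3 i" by metis
    have s: "m3 i \<le> (\<Sum>i\<in>UNIV. m3 i)" for i
      by (rule member_le_sum) (use m3 in \<open>auto intro: less_imp_le\<close>)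
    have s0: "(\<Sum>i\<in>UNIV. m3 i) \<ge> 0" by (intro sum_nonneg less_imp_le m3)
    show ?thesis
    proof (rule that[of "m1 + m2 + (\<Sum>i\<in>UNIV. m3 i)"])
      show "0 \<le> m1 + m2 + (\<Sum>i\<in>UNIV. m3 i)" using m1(1) m2(1) s0 by linarith
      show "\<psi> z \<le> m1 + m2 + (\<Sum>i\<in>UNIV. m3 i)" for z using m1(2)[of z] m2(1) s0 by linarith
      show "\<bar>\<psi>0 z\<bar> \<le> m1 + m2 + (\<Sum>i\<in>UNIV. m3 i)" for z using m2(2)[of z] m1(1) s0 by linarith
      show "\<bar>\<psi>x i z\<bar> \<le> m1 + m2 + (\<Sum>i\<in>UNIV. m3 i)" for i z
        using m3(2)[where i = i and z = z] s[of i] m1(1) m2(1) by linarith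
    qed
  qed
  define c where "c = M * M1"
  have c0: "c \<ge> 0" using M M1 by (simp add: c_def)
  have G_bound: "\<bar>G wv Fv Xv gv z\<bar> \<le> c * (1 + (wv + (\<bar>gv\<bar> + (\<Sum>i\<in>UNIV. \<bar>Fv i\<bar> * \<bar>Xv i\<bar> + \<bar>Fv i\<bar>))))"
    if wv: "wv \<ge> 0" for wv Fv Xv gv z
  proof -
    have t1: "\<bar>- B wv * \<psi>0 z\<bar> \<le> c * (1 + wv)"
    proof -
      have "\<bar>B wv\<bar> * \<bar>\<psi>0 z\<bar> \<le> (M * (1 + wv)) * M1" by (intro mult_mono M M1 wv mult_nonneg_nonneg) (use wv in auto)
      then show ?thesis by (simp add: abs_mult c_def algebra_simps)
    qed
    have t2: "\<bar>gv * \<beta> wv * \<psi> z\<bar> \<le> c * \<bar>gv\<bar>"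
    proof -
      have "\<beta> wv * \<psi> z \<le> M * M1" by (intro mult_mono M M1 wv \<beta>0 \<psi>)
      then have "\<bar>gv\<bar> * (\<beta> wv * \<psi> z) \<le> \<bar>gv\<bar> * (M * M1)" by (rule mult_left_mono) simp
      then show ?thesis using \<beta>0[OF wv] \<psi>(6)[of z] by (simp add: abs_mult c_def algebra_simps)
    qed
    have t3: "\<bar>Fv i * (\<beta>' wv * Xv i * \<psi> z + \<beta> wv * \<psi>x i z)\<bar> \<le> c * (\<bar>Fv i\<bar> * \<bar>Xv i\<bar> + \<bar>Fv i\<bar>)" for i
    proof -
      have "\<bar>\<beta>' wv\<bar> * \<psi> z \<le> M * M1" "\<beta> wv * \<bar>\<psi>x i z\<bar> \<le> M * M1"
        by (intro mult_mono M M1 wv \<beta>0 \<psi> abs_ge_zero)+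
      then have "\<bar>\<beta>' wv\<bar> * \<psi> z * \<bar>Xv i\<bar> \<le> c * \<bar>Xv i\<bar>" "\<beta> wv * \<bar>\<psi>x i z\<bar> \<le> c"
        unfolding c_def by (auto intro: mult_right_mono)
      moreover have "\<bar>\<beta>' wv * Xv i * \<psi> z + \<beta> wv * \<psi>x i z\<bar> \<le> \<bar>\<beta>' wv\<bar> * \<psi> z * \<bar>Xv i\<bar> + \<beta> wv * \<bar>\<psi>x i z\<bar>"
        using abs_triangle_ineq[of "\<beta>' wv * Xv i * \<psi> z" "\<beta> wv * \<psi>x i z"] \<beta>0[OF wv] \<psi>(6)[of z]
        by (simp add: abs_mult mult_ac)
      ultimately have "\<bar>\<beta>' wv * Xv i * \<psi> z + \<beta> wv * \<psi>x i z\<bar> \<le> c * \<bar>Xv i\<bar> + c" by linarith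
      then have "\<bar>Fv i\<bar> * \<bar>\<beta>' wv * Xv i * \<psi> z + \<beta> wv * \<psi>x i z\<bar> \<le> \<bar>Fv i\<bar> * (c * \<bar>Xv i\<bar> + c)"
        by (rule mult_left_mono) simp
      also have "\<dots> = c * (\<bar>Fv i\<bar> * \<bar>Xv i\<bar> + \<bar>Fv i\<bar>)" by (simp add: algebra_simps)
      finally show ?thesis by (simp only: abs_mult)
    qed
    have "\<bar>\<Sum>i\<in>UNIV. Fv i * (\<beta>' wv * Xv i * \<psi> z + \<beta> wv * \<psi>x i z)\<bar> \<le> (\<Sum>i\<in>UNIV. c * (\<bar>Fv i\<bar> * \<bar>Xv i\<bar> + \<bar>Fv i\<bar>))"
      by (rule order_trans[OF sum_abs]) (rule sum_mono, rule t3)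
    also have "\<dots> = c * (\<Sum>i\<in>UNIV. \<bar>Fv i\<bar> * \<bar>Xv i\<bar> + \<bar>Fv i\<bar>)" by (simp add: sum_distrib_left)
    finally have "\<bar>G wv Fv Xv gv z\<bar> \<le> c * (1 + wv) + c * (\<Sum>i\<in>UNIV. \<bar>Fv i\<bar> * \<bar>Xv i\<bar> + \<bar>Fv i\<bar>) + c * \<bar>gv\<bar>"
      using t1 t2 unfolding G_def by linarith
    also have "\<dots> = c * (1 + (wv + (\<bar>gv\<bar> + (\<Sum>i\<in>UNIV. \<bar>Fv i\<bar> * \<bar>Xv i\<bar> + \<bar>Fv i\<bar>))))"
      by (simp add: algebra_simps)
    finally show ?thesis .
  qed
  \<comment> \<open>\<open>P\<close> and \<open>Q\<close> stand for the products of flux and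
    gradient: the mollified majorant must dominate a product of mollified factors, which
    \<open>conv_product_le\<close> bounds by the mollified \<open>P\<close> and
    \<open>Q\<close>.\<close>
  define h where "h z = \<bar>restr K' w z\<bar> + (\<bar>restr K' g z\<bar> + (\<Sum>i\<in>UNIV. (restr K' P z + restr K' Q z) + \<bar>restr K' (F i) z\<bar>))" for z
  have h0: "h z \<ge> 0" for z
    unfolding h_def by (intro add_nonneg_nonneg sum_nonneg) (auto simp: P0 Q0)
  have ih: "integrable lebesgue h"
    unfolding h_def
    by (intro Bochner_Integration.integrable_add integrable_abs Bochner_Integration.integrable_sum ints)
  \<comment> \<open>\<open>h\<close> joins the list so that the majorants converge along the same
    radii as the data.\<close>
  define I where "I = {restr K' w, restr K' g, h} \<union> range (\<lambda>i. restr K' (F i)) \<union> range (\<lambda>i. restr K' (X i))"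
  have "finite I" by (simp add: I_def)
  moreover have "\<And>f. f \<in> I \<Longrightarrow> integrable lebesgue (\<lambda>z. f z)" using ints ih by (auto simp: I_def)
  ultimately obtain d where d: "\<And>n. d n > 0" "\<And>n::nat. d n \<le> \<delta>" "d \<longlonglongrightarrow> 0"
    and lim: "AE z in lebesgue. \<forall>f\<in>I. (\<lambda>n. conv f (mollifier (d n)) z) \<longlonglongrightarrow> f z"
    using conv_mollifier_AE_subseq[of I "\<lambda>f. f" \<delta>] \<delta>(1) by blast
  have sub: "cball z (d n) \<subseteq> K'" if "z \<in> K" for z n
    using that d(2)[of n] unfolding K'_eq by (auto intro!: bexI[of _ z] intro: order_trans)
  define W where "W n = conv (restr K' w) (mollifier (d n))" for n
  define Fm where "Fm n z = (\<lambda>i. conv (restr K' (F i)) (mollifier (d n)) z)" for n z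
  define Xm where "Xm n z = (\<lambda>i. conv (restr K' (X i)) (mollifier (d n)) z)" for n z
  define gm where "gm n = conv (restr K' g) (mollifier (d n))" for n
  define hm where "hm n = conv h (mollifier (d n))" for n
  define Gn where "Gn n z = G (W n z) (Fm n z) (Xm n z) (gm n z) z" for n z
  note mi = mollified_inequality[OF d(1) sub K'S K(1) K' B \<beta> \<beta>0 \<psi> \<psi>K, folded G_def]
  have Gn: "integrable lebesgue (Gn n)" "0 \<le> (LINT z|lebesgue. Gn n z)" and W0: "W n z \<ge> 0" for n z
    using mi[of n] by (simp_all add: Gn_def[abs_def] G_def W_def Fm_def Xm_def gm_def)
  have Gn0: "Gn n z = 0" if "z \<notin> K" for n z
    using that by (simp add: Gn_def G_def \<psi>K)
  have Gn_le: "\<bar>Gn n z\<bar> \<le> c * (1 + hm n z)" for n z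
  proof -
    have h_eq: "hm n z = conv (\<lambda>z. \<bar>restr K' w z\<bar>) (mollifier (d n)) z + (conv (\<lambda>z. \<bar>restr K' g z\<bar>) (mollifier (d n)) z
       + (\<Sum>i\<in>UNIV. (conv (restr K' P) (mollifier (d n)) z + conv (restr K' Q) (mollifier (d n)) z)
          + conv (\<lambda>z. \<bar>restr K' (F i) z\<bar>) (mollifier (d n)) z))"
      unfolding hm_def h_def
      by (subst conv_add conv_sum, (intro Bochner_Integration.integrable_add integrable_abs Bochner_Integration.integrable_sum ints d)+)+
        (rule refl)
    have f: "\<bar>Fm n z i\<bar> \<le> conv (\<lambda>z. \<bar>restr K' (F i) z\<bar>) (mollifier (d n)) z" for i
      unfolding Fm_def by (intro abs_conv_le ints d)
    have x: "\<bar>Xm n z i\<bar> \<le> conv (\<lambda>z. \<bar>restr K' (X i) z\<bar>) (mollifier (d n)) z" for i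
      unfolding Xm_def by (intro abs_conv_le ints d)
    have fx: "\<bar>Fm n z i\<bar> * \<bar>Xm n z i\<bar> \<le> conv (restr K' P) (mollifier (d n)) z + conv (restr K' Q) (mollifier (d n)) z" for i
    proof -
      have "\<bar>Fm n z i\<bar> * \<bar>Xm n z i\<bar> \<le> conv (\<lambda>z. \<bar>restr K' (F i) z\<bar>) (mollifier (d n)) z * conv (\<lambda>z. \<bar>restr K' (X i) z\<bar>) (mollifier (d n)) z"
        by (intro mult_mono f x) (auto intro: order_trans[OF abs_ge_zero f])
      also have "\<dots> \<le> conv (restr K' P) (mollifier (d n)) z + conv (restr K' Q) (mollifier (d n)) z"
        by (rule conv_product_le[OF ints(3) ints(4) ints(5) ints(6) d(1)])
           (use PQ P0 Q0 in \<open>auto simp: indicator_def\<close>)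
      finally show ?thesis .
    qed
    have "W n z + (\<bar>gm n z\<bar> + (\<Sum>i\<in>UNIV. \<bar>Fm n z i\<bar> * \<bar>Xm n z i\<bar> + \<bar>Fm n z i\<bar>)) \<le> hm n z"
      unfolding h_eq
    proof (intro add_mono sum_mono f fx)
      show "W n z \<le> conv (\<lambda>z. \<bar>restr K' w z\<bar>) (mollifier (d n)) z"
        unfolding W_def by (rule order_trans[OF abs_ge_self abs_conv_le]) (intro ints d)+
      show "\<bar>gm n z\<bar> \<le> conv (\<lambda>z. \<bar>restr K' g z\<bar>) (mollifier (d n)) z"
        unfolding gm_def by (intro abs_conv_le ints d)
    qed
    then have "c * (1 + (W n z + (\<bar>gm n z\<bar> + (\<Sum>i\<in>UNIV. \<bar>Fm n z i\<bar> * \<bar>Xm n z i\<bar> + \<bar>Fm n z i\<bar>)))) \<le> c * (1 + hm n z)"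
      using c0 by (intro mult_left_mono) auto
    then show ?thesis unfolding Gn_def using G_bound[OF W0] by (rule order_trans[rotated])
  qed
  define L where "L z = G (w z) (\<lambda>i. F i z) (\<lambda>i. X i z) (g z) z" for z
  have L0: "L z = 0" if "z \<notin> K" for z using that by (simp add: L_def G_def \<psi>K)
  have contB: "continuous_on {0..} B" "continuous_on {0..} \<beta>"
    using B \<beta>(1) by (auto intro!: continuous_at_imp_continuous_on dest: DERIV_isCont)
  have L_lim: "AE z in lebesgue. (\<lambda>n. Gn n z) \<longlonglongrightarrow> L z \<and> (\<lambda>n. hm n z) \<longlonglongrightarrow> h z"
    using lim w_nonneg
  proof eventually_elim
    case (elim z)
    have hl: "(\<lambda>n. hm n z) \<longlonglongrightarrow> h z" using elim(1) by (auto simp: I_def hm_def)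
    show ?case
    proof (cases "z \<in> K")
      case True
      then have zK': "z \<in> K'" "z \<in> S" using KK' K by auto
      have 1: "(\<lambda>n. W n z) \<longlonglongrightarrow> w z" "(\<lambda>n. Fm n z i) \<longlonglongrightarrow> F i z" "(\<lambda>n. Xm n z i) \<longlonglongrightarrow> X i z" "(\<lambda>n. gm n z) \<longlonglongrightarrow> g z" for i
        using elim(1)[rule_format, of "restr K' w"] elim(1)[rule_format, of "restr K' (F i)"]
          elim(1)[rule_format, of "restr K' (X i)"] elim(1)[rule_format, of "restr K' g"] zK'(1)
        by (simp_all add: I_def W_def Fm_def Xm_def gm_def)
      have wz: "w z \<ge> 0" using elim(2) zK' by simp
      have 2: "(\<lambda>n. B (W n z)) \<longlonglongrightarrow> B (w z)" "(\<lambda>n. \<beta> (W n z)) \<longlonglongrightarrow> \<beta> (w z)" "(\<lambda>n. \<beta>' (W n z)) \<longlonglongrightarrow> \<beta>' (w z)"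
        by (rule continuous_on_tendsto_compose[OF contB(1) 1(1)] continuous_on_tendsto_compose[OF contB(2) 1(1)]
              continuous_on_tendsto_compose[OF \<beta>(2) 1(1)]; use wz W0 in simp)+
      have "(\<lambda>n. Gn n z) \<longlonglongrightarrow> L z"
        unfolding Gn_def L_def G_def by (intro tendsto_intros 1 2)
      then show ?thesis using hl by blast
    next
      case False
      then show ?thesis using hl by (simp add: Gn0 L0)
    qed
  qed
  txt \<open>The bound \<open>c * (1 + hm n z)\<close> of \<open>Gn n z\<close> moves with \<open>n\<close>; clipping at its limit makes
    dominated convergence applicable, at an error controlled by the mean convergence of \<open>hm n\<close>.\<close>
  define D where "D n z = indicator K z * max (- (c * (1 + h z))) (min (c * (1 + h z)) (Gn n z))" for n z
  have mG: "Gn n \<in> borel_measurable lebesgue" for n using Gn(1) by auto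
  have Ks: "K \<in> sets lebesgue" using K by (simp add: compact_imp_closed)
  have iw: "integrable lebesgue (\<lambda>z. indicator K z * (c * (1 + h z)))"
  proof -
    have "integrable lebesgue (\<lambda>z. c * indicator K z + c * (indicator K z * h z))"
    proof (intro Bochner_Integration.integrable_add integrable_mult_right)
      show "integrable lebesgue (\<lambda>z. indicator K z :: real)"
        using lmeasurable_compact[OF K(1)] by (auto simp: fmeasurable_def intro!: integrable_real_indicator)
      show "integrable lebesgue (\<lambda>z. indicator K z * h z)"
        using integrable_mult_indicator[OF Ks ih] by simp
    qed
    moreover have "(\<lambda>z. c * indicator K z + c * (indicator K z * h z)) = (\<lambda>z. indicator K z * (c * (1 + h z)))"
      by (auto simp: algebra_simps)
    ultimately show ?thesis by simp
  qed
  have mD: "D n \<in> borel_measurable lebesgue" for n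
  proof -
    have [measurable]: "h \<in> borel_measurable lebesgue" using ih by auto
    note [measurable] = mG[of n] Ks
    show ?thesis unfolding D_def by measurable
  qed
  \<comment> \<open>The data are known to be measurable only on \<open>S\<close>, so measurability
    of \<open>L\<close> is read off from its being an almost everywhere limit of mollified
    integrands.\<close>
  have mL: "L \<in> borel_measurable lebesgue"
  proof (rule borel_measurable_AE)
    show "(\<lambda>z. lim (\<lambda>n. Gn n z)) \<in> borel_measurable lebesgue"
      by (rule borel_measurable_lim_metric[OF mG])
    show "AE z in lebesgue. lim (\<lambda>n. Gn n z) = L z"
      using L_lim by eventually_elim (auto intro: limI)
  qed
  have dom: "AE z in lebesgue. norm (D n z) \<le> indicator K z * (c * (1 + h z))" for n
  proof (rule AE_I2)
    fix z
    have "0 \<le> c * (1 + h z)" using c0 h0 by simp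
    then show "norm (D n z) \<le> indicator K z * (c * (1 + h z))" by (auto simp: D_def indicator_def)
  qed
  have D_lim: "AE z in lebesgue. (\<lambda>n. D n z) \<longlonglongrightarrow> L z"
    using L_lim
  proof eventually_elim
    case (elim z)
    have "\<bar>L z\<bar> \<le> c * (1 + h z)"
    proof (rule tendsto_le[OF _ _ tendsto_rabs])
      show "(\<lambda>n. c * (1 + hm n z)) \<longlonglongrightarrow> c * (1 + h z)" using elim by (auto intro!: tendsto_intros)
      show "(\<lambda>n. Gn n z) \<longlonglongrightarrow> L z" using elim by simp
    qed (use Gn_le in auto)
    then have "L z = indicator K z * max (- (c * (1 + h z))) (min (c * (1 + h z)) (L z))"
      using L0 by (auto simp: indicator_def)
    moreover have "(\<lambda>n. D n z) \<longlonglongrightarrow> indicator K z * max (- (c * (1 + h z))) (min (c * (1 + h z)) (L z))"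
      unfolding D_def using elim by (intro tendsto_intros) auto
    ultimately show ?case by simp
  qed
  show "integrable lebesgue (\<lambda>z. G (w z) (\<lambda>i. F i z) (\<lambda>i. X i z) (g z) z)"
    using integrable_dominated_convergence[OF mL mD iw D_lim dom] by (simp add: L_def[abs_def])
  have iD: "integrable lebesgue (D n)" for n
    using integrable_dominated_convergence2[OF mL mD iw D_lim dom] .
  have ihm: "integrable lebesgue (\<lambda>z. \<bar>hm n z - h z\<bar>)" for n
    unfolding hm_def by (intro integrable_abs Bochner_Integration.integrable_diff conv_L1_bound ih d)
  have "0 \<le> (LINT z|lebesgue. D n z) + c * (LINT z|lebesgue. \<bar>hm n z - h z\<bar>)" for n
  proof -
    have "(LINT z|lebesgue. Gn n z) \<le> (LINT z|lebesgue. D n z + c * \<bar>hm n z - h z\<bar>)"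
    proof (rule integral_mono)
      fix z
      show "Gn n z \<le> D n z + c * \<bar>hm n z - h z\<bar>"
      proof (cases "z \<in> K")
        case True
        have "c * (hm n z - h z) \<le> c * \<bar>hm n z - h z\<bar>" using c0 by (intro mult_left_mono) auto
        moreover have "0 \<le> c * (1 + h z)" "0 \<le> c * \<bar>hm n z - h z\<bar>" using c0 h0 by auto
        moreover have "c * (1 + hm n z) = c * (1 + h z) + c * (hm n z - h z)" by (simp add: algebra_simps)
        ultimately show ?thesis
          using True Gn_le[of n z] by (simp add: D_def max_def min_def abs_le_iff)
      qed (use c0 in \<open>simp add: Gn0 D_def\<close>)
    qed (intro Gn Bochner_Integration.integrable_add iD integrable_mult_right ihm)+
    also have "\<dots> = (LINT z|lebesgue. D n z) + c * (LINT z|lebesgue. \<bar>hm n z - h z\<bar>)"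
      using iD[of n] ihm[of n] by simp
    finally show ?thesis using Gn(2)[of n] by linarith
  qed
  moreover have "(\<lambda>n. (LINT z|lebesgue. D n z) + c * (LINT z|lebesgue. \<bar>hm n z - h z\<bar>)) \<longlonglongrightarrow> (LINT z|lebesgue. L z) + c * 0"
    unfolding hm_def
    by (intro tendsto_intros integral_dominated_convergence[OF mL mD iw D_lim dom] conv_mollifier_L1 ih d)
  ultimately have "0 \<le> (LINT z|lebesgue. L z) + c * 0"
    by (intro tendsto_lowerbound) auto
  then show "0 \<le> (LINT z|lebesgue. G (w z) (\<lambda>i. F i z) (\<lambda>i. X i z) (g z) z)"
    by (simp add: L_def[abs_def])
qed

end

section \<open>Elementary inequalities and local integrability\<close>

lemma powr_add_le:
  fixes x y a :: real
  assumes "x \<ge> 0" "y \<ge> 0" "a \<ge> 0"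
  shows "(x + y) powr a \<le> 2 powr a * (x powr a + y powr a)"
proof -
  have "(x + y) powr a \<le> (2 * max x y) powr a" using assms by (intro powr_mono2) auto
  also have "\<dots> = 2 powr a * max x y powr a" using assms by (simp add: powr_mult)
  also have "max x y powr a \<le> x powr a + y powr a" by (simp add: max_def)
  finally show ?thesis by (simp add: mult_left_mono)
qed

text \<open>A crude form without the factors \<open>1 / r\<close> and \<open>1 / p\<close>: on
  either side of the threshold \<open>y = x powr (r - 1)\<close> one of the two powers alone
  dominates the product.\<close>

lemma Young_powr:
  fixes x y p r :: real
  assumes "x \<ge> 0" "y \<ge> 0" "p > 1" "r = p / (p - 1)"
  shows "x * y \<le> x powr r + y powr p"
proof (cases "x = 0 \<or> y = 0")
  case False
  then have x: "x > 0" "y > 0" using assms by auto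
  have r: "r > 1" unfolding assms(4) using assms(3) by (subst less_divide_eq) auto
  show ?thesis
  proof (cases "y \<le> x powr (r - 1)")
    case True
    then have "x * y \<le> x * x powr (r - 1)" using x by (intro mult_left_mono) auto
    also have "\<dots> = x powr r" using x by (simp add: powr_mult_base)
    finally show ?thesis by (simp add: add_increasing2)
  next
    case False
    have e: "(r - 1) * (p - 1) = 1" using assms by (simp add: field_simps)
    have "x = (x powr (r - 1)) powr (p - 1)" using x e by (simp add: powr_powr)
    also have "\<dots> \<le> y powr (p - 1)" using False assms by (intro powr_mono2) auto
    finally have "x * y \<le> y powr (p - 1) * y" using x by (intro mult_right_mono) auto
    also have "\<dots> = y powr p" using x by (simp add: powr_mult_base mult.commute)
    finally show ?thesis by (simp add: add_increasing)
  qed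
qed auto

text \<open>The weight is inserted as \<open>D powr (1 / r)\<close> on one factor and its reciprocal
  on the other; \<open>1 - p\<close> is the exponent of the reciprocal after raising it to the power
  \<open>p\<close>.\<close>

lemma Young_powr_weighted:
  fixes f y p r D :: real
  assumes "f \<ge> 0" "y \<ge> 0" "p > 1" "r = p / (p - 1)" "D > 0"
  shows "f * y \<le> D * f powr r + D powr (1 - p) * y powr p"
proof -
  have r: "r > 1" unfolding assms(4) using assms(3) by (subst less_divide_eq) auto
  have e: "- (1 / r) * p = 1 - p" unfolding assms(4) using assms(3) by (simp add: field_simps)
  have "f * y = (f * D powr (1 / r)) * (y * D powr (- (1 / r)))"
    using assms by (simp add: powr_minus)
  also have "\<dots> \<le> (f * D powr (1 / r)) powr r + (y * D powr (- (1 / r))) powr p"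
    by (intro Young_powr) (use assms in auto)
  also have "\<dots> = D * f powr r + D powr (1 - p) * y powr p"
    using assms r by (simp add: powr_mult powr_powr e mult.commute)
  finally show ?thesis .
qed

text \<open>Either \<open>x\<close> is so large that the left side is absorbed by the first term, or
  a power of \<open>x\<close> is bounded by one of \<epsilon> divided by powers of \<delta> and
  \<zeta>. In the second case a non-negative power of \<zeta> must be left over, which is the lower
  bound on \<open>k\<close>. The loss \<open>j\<close> is 1 or \<open>p\<close>: one derivative of
  the cutoff, possibly raised to the power \<open>p\<close>.\<close>

lemma Young_powr_cutoff:
  fixes x \<epsilon> \<zeta> \<alpha> \<beta> j k \<delta> :: real
  assumes "x \<ge> 0" "\<epsilon> > 0" "0 < \<zeta>" "\<zeta> \<le> 1" "0 < \<alpha>" "\<alpha> < \<beta>" "j > 0" "k \<ge> j * \<beta> / (\<beta> - \<alpha>)" "\<delta> > 0"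
  shows "\<epsilon> powr (\<beta> - \<alpha>) * x powr \<alpha> * \<zeta> powr (k - j)
    \<le> \<delta> * (x powr \<beta> * \<zeta> powr k) + \<delta> powr (- (\<alpha> / (\<beta> - \<alpha>))) * \<epsilon> powr \<beta>"
proof (cases "\<epsilon> powr (\<beta> - \<alpha>) \<le> \<delta> * x powr (\<beta> - \<alpha>) * \<zeta> powr j")
  case True
  then have "\<epsilon> powr (\<beta> - \<alpha>) * (x powr \<alpha> * \<zeta> powr (k - j)) \<le> \<delta> * x powr (\<beta> - \<alpha>) * \<zeta> powr j * (x powr \<alpha> * \<zeta> powr (k - j))"
    by (intro mult_right_mono) auto
  also have "\<dots> = \<delta> * ((x powr (\<beta> - \<alpha>) * x powr \<alpha>) * (\<zeta> powr j * \<zeta> powr (k - j)))" by (simp add: mult_ac)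
  also have "\<dots> = \<delta> * (x powr \<beta> * \<zeta> powr k)" by (simp add: powr_add[symmetric])
  finally show ?thesis by (simp add: mult.assoc add_increasing2)
next
  case False
  define c where "c = \<beta> - \<alpha>"
  have c: "c > 0" using assms by (simp add: c_def)
  have "x powr c * (\<delta> * \<zeta> powr j) < \<epsilon> powr c" using False by (simp add: c_def mult_ac)
  then have "x powr c \<le> \<epsilon> powr c / (\<delta> * \<zeta> powr j)" using assms by (simp add: field_simps)
  then have "(x powr c) powr (\<alpha> / c) \<le> (\<epsilon> powr c / (\<delta> * \<zeta> powr j)) powr (\<alpha> / c)"
    using c assms by (intro powr_mono2) auto
  then have "x powr \<alpha> \<le> \<epsilon> powr \<alpha> / (\<delta> powr (\<alpha> / c) * \<zeta> powr (j * \<alpha> / c))"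
    using c assms by (simp add: powr_powr powr_divide powr_mult)
  then have "\<epsilon> powr c * x powr \<alpha> * \<zeta> powr (k - j) \<le> \<epsilon> powr c * (\<epsilon> powr \<alpha> / (\<delta> powr (\<alpha> / c) * \<zeta> powr (j * \<alpha> / c))) * \<zeta> powr (k - j)"
    by (intro mult_left_mono mult_right_mono) auto
  also have "\<dots> = \<delta> powr (- (\<alpha> / c)) * (\<epsilon> powr c * \<epsilon> powr \<alpha>) * (\<zeta> powr (k - j) / \<zeta> powr (j * \<alpha> / c))"
    by (simp add: powr_minus divide_simps)
  also have "\<epsilon> powr c * \<epsilon> powr \<alpha> = \<epsilon> powr \<beta>"
    unfolding powr_add[symmetric] by (simp add: c_def)
  also have "\<zeta> powr (k - j) / \<zeta> powr (j * \<alpha> / c) = \<zeta> powr (k - j - j * \<alpha> / c)"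
    by (rule powr_diff[symmetric])
  also have "\<delta> powr (- (\<alpha> / c)) * \<epsilon> powr \<beta> * \<zeta> powr (k - j - j * \<alpha> / c) \<le> \<delta> powr (- (\<alpha> / c)) * \<epsilon> powr \<beta> * 1"
  proof (intro mult_left_mono)
    have "k - j - j * \<alpha> / c \<ge> 0" using assms(8) c unfolding c_def[symmetric]
      by (simp add: field_simps c_def)
    then show "\<zeta> powr (k - j - j * \<alpha> / c) \<le> 1" using assms by (intro powr_le1) auto
  qed auto
  finally show ?thesis using assms by (simp add: c_def add_increasing)
qed

text \<open>The vector field behind the p-Laplacian; for \<open>p > 1\<close> it is the gradient of
  |\<xi>|^p / p.\<close>

definition p_field :: "real \<Rightarrow> 'v::real_inner \<Rightarrow> 'v" where
  "p_field p \<xi> = norm \<xi> powr (p - 2) *\<^sub>R \<xi>"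

lemma norm_p_field: "norm (p_field p \<xi>) = norm \<xi> powr (p - 1)"
proof (cases "\<xi> = 0")
  case False
  then have "norm \<xi> powr (p - 2) * norm \<xi> = norm \<xi> powr (p - 2 + 1)"
    by (subst powr_add) simp
  then show ?thesis by (simp add: p_field_def)
qed (simp add: p_field_def)

text \<open>Fields of conjugate exponents invert each other: the powers of the norm cancel because
  \<open>(p - 1) * r = p\<close>.\<close>

lemma p_field_inverse:
  assumes "p > 1" "r = p / (p - 1)"
  shows "p_field r (p_field p \<xi>) = \<xi>"
proof (cases "\<xi> = 0")
  case False
  have e: "(p - 1) * (r - 2) + (p - 2) = 0" using assms by (simp add: field_simps)
  have "p_field r (p_field p \<xi>) = (norm \<xi> powr ((p - 1) * (r - 2)) * norm \<xi> powr (p - 2)) *\<^sub>R \<xi>"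
    unfolding p_field_def[of r] norm_p_field by (simp add: p_field_def powr_powr)
  also have "\<dots> = norm \<xi> powr 0 *\<^sub>R \<xi>" by (simp add: powr_add[symmetric] e)
  finally show ?thesis using False by simp
qed (simp add: p_field_def)

text \<open>Strong monotonicity written with \<open>b\<close> for \<open>- b\<close>, since the
  sub-solution enters with reversed sign. The product splits into
  \<open>(\<alpha> + \<beta>) / 2\<close> times the squared norm of \<open>a + b\<close> and a
  remainder that is non-negative because the weights are ordered like the norms. The larger of the
  two norms is at least half that of \<open>a + b\<close>, whence the constant.\<close>

lemma p_field_strong_monotone:
  fixes a b :: "'v::real_inner"
  assumes r: "r \<ge> 2"
  shows "2 powr (1 - r) * norm (a + b) powr r \<le> (p_field r a + p_field r b) \<bullet> (a + b)"
proof -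
  define \<alpha> \<beta> where "\<alpha> = norm a powr (r - 2)" and "\<beta> = norm b powr (r - 2)"
  have eq: "(p_field r a + p_field r b) \<bullet> (a + b) =
     (\<alpha> + \<beta>) * (norm (a + b))\<^sup>2 / 2 + (\<alpha> - \<beta>) * ((norm a)\<^sup>2 - (norm b)\<^sup>2) / 2"
    unfolding p_field_def \<alpha>_def[symmetric] \<beta>_def[symmetric] power2_norm_eq_inner
    by (simp add: inner_add_left inner_add_right inner_commute[of b a] field_simps)
  have m: "0 \<le> (\<alpha> - \<beta>) * ((norm a)\<^sup>2 - (norm b)\<^sup>2)"
  proof (cases "norm a \<le> norm b")
    case True
    then have "\<alpha> \<le> \<beta>" "(norm a)\<^sup>2 \<le> (norm b)\<^sup>2"
      unfolding \<alpha>_def \<beta>_def using r by (auto intro!: powr_mono2 power_mono)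
    then show ?thesis by (simp add: mult_nonpos_nonpos)
  next
    case False
    then have "\<beta> \<le> \<alpha>" "(norm b)\<^sup>2 \<le> (norm a)\<^sup>2"
      unfolding \<alpha>_def \<beta>_def using r by (auto intro!: powr_mono2 power_mono)
    then show ?thesis by simp
  qed
  show ?thesis
  proof (cases "a + b = 0")
    case False
    define N where "N = norm (a + b)"
    have N: "N > 0" using False by (simp add: N_def)
    have "N / 2 \<le> max (norm a) (norm b)" using norm_triangle_ineq[of a b] by (simp add: N_def max_def)
    then have "(N / 2) powr (r - 2) \<le> max (norm a) (norm b) powr (r - 2)" using N r by (intro powr_mono2) auto
    also have "\<dots> \<le> \<alpha> + \<beta>" by (simp add: max_def \<alpha>_def \<beta>_def)
    finally have "(N / 2) powr (r - 2) * N\<^sup>2 / 2 \<le> (\<alpha> + \<beta>) * N\<^sup>2 / 2"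
      by (intro divide_right_mono mult_right_mono) auto
    moreover have "(N / 2) powr (r - 2) * N\<^sup>2 / 2 = 2 powr (1 - r) * N powr r"
    proof -
      have "N powr r = N powr (r - 2) * N powr 2" using N by (subst powr_add[symmetric]) simp
      moreover have "2 powr (1 - r) = 1 / (2 powr (r - 2) * 2)"
      proof -
        have "1 - r = - (r - 2) + - 1" by simp
        then have "2 powr (1 - r) = 2 powr (- (r - 2)) * (2::real) powr (- 1)" by (simp only: powr_add)
        then show ?thesis by (simp only: powr_minus_divide) simp
      qed
      ultimately show ?thesis using N by (simp add: powr_divide powr_numeral)
    qed
    ultimately show ?thesis using m eq by (simp add: N_def)
  qed simp
qed

text \<open>Strong monotonicity of the inverse field, evaluated at the fluxes. For
  \<open>p > 1\<close> the condition \<open>r \<ge> 2\<close> means exactly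
  \<open>p \<le> 2\<close>.\<close>

lemma p_field_coercive:
  fixes \<xi> \<eta> :: "'v::real_inner"
  assumes "1 < p" "p \<le> 2" "r = p / (p - 1)"
  shows "2 powr (1 - r) * norm (p_field p \<xi> + p_field p \<eta>) powr r \<le> (p_field p \<xi> + p_field p \<eta>) \<bullet> (\<xi> + \<eta>)"
proof -
  have "r \<ge> 2" unfolding assms(3) using assms(1,2) by (subst le_divide_eq) auto
  from p_field_strong_monotone[OF this, of "p_field p \<xi>" "p_field p \<eta>"]
  show ?thesis by (simp add: p_field_inverse[OF assms(1,3)] inner_commute)
qed

text \<open>By symmetry \<open>b \<le> a\<close>. If \<open>b\<close> is non-negative, then
  \<open>a + b \<le> 2 * a\<close> gives the constant. If \<open>b\<close> is negative, put
  \<open>c = - b\<close>; superadditivity, (a - c)^q + c^q <= a^q, gives the bound even with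
  constant 1.\<close>

lemma signed_powr_add_ge:
  fixes a b q :: real
  assumes "q > 1" "a + b \<ge> 0"
  shows "2 powr (- q) * (a + b) powr q \<le> \<bar>a\<bar> powr (q - 1) * a + \<bar>b\<bar> powr (q - 1) * b"
proof -
  have *: "2 powr (- q) * (a + b) powr q \<le> \<bar>a\<bar> powr (q - 1) * a + \<bar>b\<bar> powr (q - 1) * b"
    if ab: "a + b \<ge> 0" "b \<le> a" for a b :: real
  proof -
    have a0: "a \<ge> 0" using ab by linarith
    have pa: "\<bar>x\<bar> powr (q - 1) * x = x powr q" if "x \<ge> 0" for x
      using that powr_mult_base[of x "q - 1"] by (simp add: mult.commute)
    show ?thesis
    proof (cases "b \<ge> 0")
      case True
      have "(a + b) powr q \<le> (2 * a) powr q" using ab True assms by (intro powr_mono2) auto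
      then have "2 powr (- q) * (a + b) powr q \<le> a powr q"
        using a0 by (simp add: powr_mult powr_minus field_simps)
      also have "\<dots> \<le> a powr q + b powr q" by simp
      finally show ?thesis using True a0 by (simp only: pa)
    next
      case False
      define c where "c = - b"
      have c: "c > 0" "c \<le> a" using False ab by (auto simp: c_def)
      have e: "\<bar>b\<bar> powr (q - 1) * b = - (c powr q)"
        using pa[of c] c by (simp add: c_def)
      have "c powr q = c * c powr (q - 1)" using c by (simp add: powr_mult_base)
      also have "\<dots> \<le> c * a powr (q - 1)" using c assms by (intro mult_left_mono powr_mono2) auto
      finally have 1: "c powr q \<le> c * a powr (q - 1)" .
      have "(a - c) powr q = (a - c) * (a - c) powr (q - 1)" using c by (simp add: powr_mult_base)
      also have "\<dots> \<le> (a - c) * a powr (q - 1)" using c assms by (intro mult_left_mono powr_mono2) auto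
      also have "\<dots> = a powr q - c * a powr (q - 1)"
        using a0 powr_mult_base[of a "q - 1"] by (simp add: left_diff_distrib)
      finally have 2: "(a + b) powr q \<le> a powr q - c powr q" using 1 by (simp add: c_def)
      have "2 powr (- q) \<le> (1::real)" using powr_mono[of "- q" 0 "2::real"] assms by simp
      then have "2 powr (- q) * (a + b) powr q \<le> 1 * (a + b) powr q" by (intro mult_right_mono) auto
      then show ?thesis using 2 e pa[OF a0] by simp
    qed
  qed
  show ?thesis using *[of a b] *[of b a] assms by (cases "b \<le> a") (auto simp: add.commute)
qed

section \<open>Closure properties of local integrability and pairing with test functions\<close>

lemma L_loc_bound:
  assumes "f \<in> borel_measurable (lebesgue_on S)" "open S" "L_loc 1 S h" "\<And>z. \<bar>f z\<bar> \<le> h z"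
  shows "L_loc 1 S f"
  unfolding L_loc_def
proof (intro conjI allI impI assms(1))
  fix K assume K: "compact K \<and> K \<subseteq> S"
  have h: "integrable lebesgue (\<lambda>z. indicator K z * h z)"
    using L_loc_1_integrable[OF assms(3,2)] K by blast
  have Ks: "K \<in> sets lebesgue" using K by (simp add: compact_imp_closed)
  have "(\<lambda>z. indicator S z *\<^sub>R f z) \<in> borel_measurable lebesgue"
    using assms(1,2) borel_measurable_restrict_space_iff[of S lebesgue f] by simp
  then have "(\<lambda>z. indicator K z * \<bar>indicator S z *\<^sub>R f z\<bar>) \<in> borel_measurable lebesgue"
    using Ks by (intro borel_measurable_times borel_measurable_indicator borel_measurable_abs)
  moreover have "(\<lambda>z. indicator K z * \<bar>indicator S z *\<^sub>R f z\<bar>) = (\<lambda>z. indicator K z * \<bar>f z\<bar>)"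
    using K by (auto simp: indicator_def fun_eq_iff)
  ultimately have "integrable lebesgue (\<lambda>z. indicator K z * \<bar>f z\<bar>)"
    using assms(4) by (intro Bochner_Integration.integrable_bound[OF h])
      (auto simp: indicator_def intro: order_trans[OF _ abs_ge_self])
  then show "set_integrable lebesgue K (\<lambda>z. \<bar>f z\<bar> powr 1)"
    by (simp add: set_integrable_def)
qed

lemma L_loc_abs_powr:
  assumes "L_loc r S f"
  shows "L_loc 1 S (\<lambda>z. \<bar>f z\<bar> powr r)"
  using assms unfolding L_loc_def by (auto intro!: powr_real_measurable)

lemma L_loc_add:
  assumes "L_loc 1 S f" "L_loc 1 S h" "open S"
  shows "L_loc 1 S (\<lambda>z. f z + h z)"
proof -
  have "(\<lambda>z. f z + h z) \<in> borel_measurable (lebesgue_on S)"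
    using assms by (auto simp: L_loc_def)
  moreover have "set_integrable lebesgue K (\<lambda>z. \<bar>f z + h z\<bar> powr 1)" if "compact K" "K \<subseteq> S" for K
  proof -
    have "integrable lebesgue (\<lambda>z. \<bar>indicator K z * f z + indicator K z * h z\<bar>)"
      by (intro integrable_abs Bochner_Integration.integrable_add
          L_loc_1_integrable[OF assms(1,3) that] L_loc_1_integrable[OF assms(2,3) that])
    moreover have "(\<lambda>z. \<bar>indicator K z * f z + indicator K z * h z\<bar>) = (\<lambda>z. indicator K z * \<bar>f z + h z\<bar>)"
      by (auto simp: indicator_def)
    ultimately show ?thesis by (simp add: set_integrable_def)
  qed
  ultimately show ?thesis by (simp add: L_loc_def)
qed

lemma L_loc_const: "L_loc 1 S (\<lambda>z::'a::euclidean_space. c)"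
proof -
  have "set_integrable lebesgue K (\<lambda>z::'a. \<bar>c\<bar> powr 1)" if "compact K" for K
  proof -
    have "integrable lebesgue (indicator K :: 'a \<Rightarrow> real)"
      using lmeasurable_compact[OF that] by (intro integrable_real_indicator) (auto simp: fmeasurable_def)
    then show ?thesis by (simp add: set_integrable_def)
  qed
  then show ?thesis by (simp add: L_loc_def)
qed

lemma L_loc_cmult:
  assumes "L_loc 1 S f"
  shows "L_loc 1 S (\<lambda>z. c * f z)"
  using assms unfolding L_loc_def by (auto simp: abs_mult set_integrable_def mult.left_commute[of _ "\<bar>c\<bar>"])

lemma set_integrable_L_loc_mult:
  assumes f: "L_loc 1 S f" and S: "open S" and K: "compact K" "K \<subseteq> S"
    and h: "continuous_on S h" "\<And>z. z \<in> S - K \<Longrightarrow> h z = 0"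
  shows "set_integrable lebesgue S (\<lambda>z. f z * h z)"
proof -
  have "bounded (h ` K)"
    by (intro compact_imp_bounded compact_continuous_image continuous_on_subset[OF h(1)] K)
  then obtain B where B: "\<And>z. z \<in> K \<Longrightarrow> \<bar>h z\<bar> \<le> B" "B \<ge> 0" by (auto simp: bounded_pos intro: less_imp_le)
  have "(\<lambda>z. indicator K z * f z * (indicator S z *\<^sub>R h z)) \<in> borel_measurable lebesgue"
  proof (rule borel_measurable_times[OF borel_measurable_integrable[OF L_loc_1_integrable[OF f S K]]])
    show "(\<lambda>z. indicator S z *\<^sub>R h z) \<in> borel_measurable lebesgue"
      using borel_measurable_continuous_on_indicator[of S h] h(1) S
      by (intro borel_imp_lebesgue_measurable) auto
  qed
  then have "integrable lebesgue (\<lambda>z. indicator K z * f z * (indicator S z *\<^sub>R h z))"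
  proof (rule Bochner_Integration.integrable_bound[rotated])
    show "integrable lebesgue (\<lambda>z. B * (indicator K z * f z))"
      using L_loc_1_integrable[OF f S K] by simp
    show "AE z in lebesgue. norm (indicator K z * f z * (indicator S z *\<^sub>R h z)) \<le> norm (B * (indicator K z * f z))"
    proof (rule AE_I2)
      fix z
      show "norm (indicator K z * f z * (indicator S z *\<^sub>R h z)) \<le> norm (B * (indicator K z * f z))"
        using B mult_right_mono[OF B(1), of z "\<bar>f z\<bar>"] by (auto simp: indicator_def abs_mult mult_ac)
    qed
  qed
  moreover have "(\<lambda>z. indicator K z * f z * (indicator S z *\<^sub>R h z)) = (\<lambda>z. indicator S z *\<^sub>R (f z * h z))"
    using h(2) K by (auto simp: indicator_def fun_eq_iff)
  ultimately show ?thesis by (simp add: set_integrable_def)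
qed

lemma test_fun_continuous: "test_fun S \<phi> \<Longrightarrow> continuous_on S \<phi>"
  using C_k_on.simps(1)[of S \<phi>] by (auto simp only: test_fun_def C_inf_on_def)

lemma test_fun_continuous_partial: "test_fun S \<phi> \<Longrightarrow> b \<in> Basis \<Longrightarrow> continuous_on S (partial b \<phi>)"
proof -
  assume "test_fun S \<phi>" "b \<in> Basis"
  then have "C_k_on (Suc 0) S \<phi>" "b \<in> Basis" by (auto simp: test_fun_def C_inf_on_def)
  then show ?thesis by simp
qed

lemma test_fun_zero: "z \<notin> closure {z. \<phi> z \<noteq> 0} \<Longrightarrow> \<phi> z = 0"
  using closure_subset[of "{z. \<phi> z \<noteq> 0}"] by (meson mem_Collect_eq subsetD)

lemma test_fun_partial_zero:
  fixes \<phi> :: "'a::euclidean_space \<Rightarrow> real"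
  assumes "z \<notin> closure {z. \<phi> z \<noteq> 0}"
  shows "partial b \<phi> z = 0"
proof -
  have "((\<lambda>_. 0) has_derivative (\<lambda>_. 0)) (at z)" by simp
  then have "(\<phi> has_derivative (\<lambda>_. 0)) (at z)"
    by (rule has_derivative_transform_within_open[of _ _ _ _ "- closure {z. \<phi> z \<noteq> 0}"])
       (use assms test_fun_zero in auto)
  from frechet_derivative_at[OF this, symmetric] show ?thesis by (simp add: partial_def)
qed

lemma test_fun_set_integrable:
  fixes \<phi> :: "'a::euclidean_space \<Rightarrow> real"
  assumes \<phi>: "test_fun S \<phi>" and f: "L_loc 1 S f" and S: "open S"
  shows "set_integrable lebesgue S (\<lambda>z. f z * \<phi> z)"
    and "b \<in> Basis \<Longrightarrow> set_integrable lebesgue S (\<lambda>z. f z * partial b \<phi> z)"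
proof -
  have K: "compact (closure {z. \<phi> z \<noteq> 0})" "closure {z. \<phi> z \<noteq> 0} \<subseteq> S" using \<phi> by (auto simp: test_fun_def)
  show "set_integrable lebesgue S (\<lambda>z. f z * \<phi> z)"
    by (rule set_integrable_L_loc_mult[OF f S K test_fun_continuous[OF \<phi>]]) (use test_fun_zero in blast)
  show "set_integrable lebesgue S (\<lambda>z. f z * partial b \<phi> z)" if "b \<in> Basis"
    by (rule set_integrable_L_loc_mult[OF f S K test_fun_continuous_partial[OF \<phi> that]]) (use test_fun_partial_zero in blast)
qed

lemma has_weak_partial_add:
  assumes "has_weak_partial S b f f'" "has_weak_partial S b h h'" "open S" "b \<in> Basis"
  shows "has_weak_partial S b (\<lambda>z. f z + h z) (\<lambda>z. f' z + h' z)"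
  unfolding has_weak_partial_def
proof (intro conjI allI impI L_loc_add assms)
  show "L_loc 1 S f" "L_loc 1 S h" "L_loc 1 S f'" "L_loc 1 S h'" using assms by (auto simp: has_weak_partial_def)
  note L = this
  fix \<phi> assume t: "test_fun S \<phi>"
  have "(LINT z:S|lebesgue. f z * partial b \<phi> z) = - (LINT z:S|lebesgue. f' z * \<phi> z)"
     "(LINT z:S|lebesgue. h z * partial b \<phi> z) = - (LINT z:S|lebesgue. h' z * \<phi> z)"
    using assms(1,2) t by (auto simp: has_weak_partial_def)
  then show "(LINT z:S|lebesgue. (f z + h z) * partial b \<phi> z) = - (LINT z:S|lebesgue. (f' z + h' z) * \<phi> z)"
    unfolding distrib_right using test_fun_set_integrable[OF t _ assms(3)] L assms(4)
    by (simp add: set_integral_add)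
qed

section \<open>Pointwise estimates\<close>

text \<open>After \<open>k \<ge> 2\<close>, the bounds on \<open>k\<close> are the thresholds of
  \<open>Young_powr_cutoff\<close> for four choices of its parameters: exponents
  \<open>p - 1 - s\<close> and \<open>1 - s\<close> against \<open>q - s\<close> for the test
  depending on \<open>w\<close>, and \<open>(s + 1) * (p - 1)\<close> and 1 against \<open>q\<close>
  for the cutoff alone. The conditions on \<open>s\<close> make these lower exponents positive and
  smaller than the upper ones.\<close>

locale exponents =
  fixes p q r s k c0 c1 :: real
  assumes p: "1 < p" "p \<le> 2" and q: "1 < q" and r: "r = p / (p - 1)"
    and s: "0 < s" "s < p - 1" "(s + 1) * (p - 1) < q"
    and c: "c0 > 0" "c1 > 0"
    and k: "k \<ge> 2" "k \<ge> p * (q - s) / ((q - s) - (p - 1 - s))" "k \<ge> 1 * (q - s) / ((q - s) - (1 - s))"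
      "k \<ge> p * q / (q - (s + 1) * (p - 1))" "k \<ge> 1 * q / (q - 1)"
begin

text \<open>The weight \<open>D\<close> is chosen so that the flux term becomes \<theta> times the
  quantity to be absorbed. The exponent \<open>e\<close> is \<open>- s\<close> in the first estimate
  and 0 in the second, leaving the powers \<open>p - 1 - s\<close> and
  \<open>(s + 1) * (p - 1)\<close> of \<open>W\<close>.\<close>

lemma flux_Young:
  assumes "f \<ge> 0" "W > 0" "\<zeta> > 0" "\<theta> > 0" "C \<ge> 0" "\<rho> \<ge> 0" "m \<ge> 0"
  shows "f * (W powr e * C * \<rho> * \<zeta> powr (k - 1) * m) \<le>
    \<theta> * (f powr r * W powr (- s - 1) * \<zeta> powr k)
    + \<theta> powr (1 - p) * (C powr p * \<rho> powr p * m powr p * W powr (e * p + (s + 1) * (p - 1)) * \<zeta> powr (k - p))"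
proof -
  define D where "D = \<theta> * (W powr (- s - 1) * \<zeta> powr k)"
  define y where "y = W powr e * C * \<rho> * \<zeta> powr (k - 1) * m"
  have "f * y \<le> D * f powr r + D powr (1 - p) * y powr p"
    by (rule Young_powr_weighted) (use assms p r in \<open>auto simp: D_def y_def\<close>)
  also have "D powr (1 - p) = \<theta> powr (1 - p) * (W powr ((s + 1) * (p - 1)) * \<zeta> powr (k * (1 - p)))"
  proof -
    have "(- s - 1) * (1 - p) = (s + 1) * (p - 1)" by (simp add: algebra_simps)
    then show ?thesis using assms by (simp add: D_def powr_mult powr_powr)
  qed
  also have "y powr p = W powr (e * p) * C powr p * \<rho> powr p * \<zeta> powr ((k - 1) * p) * m powr p"
    using assms by (simp add: y_def powr_mult powr_powr)
  also have "\<theta> powr (1 - p) * (W powr ((s + 1) * (p - 1)) * \<zeta> powr (k * (1 - p))) *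
      (W powr (e * p) * C powr p * \<rho> powr p * \<zeta> powr ((k - 1) * p) * m powr p)
    = \<theta> powr (1 - p) * (C powr p * \<rho> powr p * m powr p * (W powr (e * p) * W powr ((s + 1) * (p - 1)))
        * (\<zeta> powr (k * (1 - p)) * \<zeta> powr ((k - 1) * p)))"
    by (simp add: mult_ac)
  also have "W powr (e * p) * W powr ((s + 1) * (p - 1)) = W powr (e * p + (s + 1) * (p - 1))"
    by (rule powr_add[symmetric])
  also have "\<zeta> powr (k * (1 - p)) * \<zeta> powr ((k - 1) * p) = \<zeta> powr (k - p)"
    unfolding powr_add[symmetric] by (simp add: algebra_simps)
  finally show ?thesis by (simp add: y_def D_def mult_ac)
qed

text \<open>The flux term takes half of the coercive term; what Young's inequality leaves of it, and
  the time term, are absorbed by the source. The errors are multiples of \<epsilon>^(q-s) with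
  constants independent of \<nu>.\<close>

lemma first_estimate_pointwise:
  "\<exists>C\<ge>0. \<forall>\<epsilon> \<nu> w \<zeta> f. 0 < \<epsilon> \<and> 0 < \<nu> \<and> \<nu> \<le> \<epsilon> \<and> w \<ge> 0 \<and> 0 < \<zeta> \<and> \<zeta> \<le> 1 \<and> f \<ge> 0 \<longrightarrow>
    f * ((w + \<nu>) powr (- s) * (2 * k) * \<epsilon> powr ((q - p + 1) / p) * \<zeta> powr (k - 1))
    + (w + \<nu>) powr (1 - s) / (1 - s) * (2 * k * \<epsilon> powr (q - 1) * \<zeta> powr (k - 1))
    - s * c0 * (f powr r * (w + \<nu>) powr (- s - 1) * \<zeta> powr k)
    - c1 * (w powr q * (w + \<nu>) powr (- s) * \<zeta> powr k)
    \<le> C * \<epsilon> powr (q - s) - s * c0 / 2 * (f powr r * (w + \<nu>) powr (- s - 1) * \<zeta> powr k)"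
proof -
  have s1: "s < 1" using s p by linarith
  define \<theta> where "\<theta> = s * c0 / 2"
  define C1 where "C1 = \<theta> powr (1 - p) * (2 * k) powr p"
  define C2 where "C2 = 2 * k / (1 - s)"
  have pos: "\<theta> > 0" "C1 > 0" "C2 > 0" using s s1 c k by (auto simp: \<theta>_def C1_def C2_def)
  \<comment> \<open>Each of the two cutoff terms may use half of the source, whose lower bound in
    terms of \<open>W\<close> carries the constant \<open>c1 * 2 powr (- q)\<close>.\<close>
  define \<delta>1 where "\<delta>1 = c1 * 2 powr (- q) / (2 * C1)"
  define \<delta>2 where "\<delta>2 = c1 * 2 powr (- q) / (2 * C2)"
  have \<delta>: "\<delta>1 > 0" "\<delta>2 > 0" using pos c by (auto simp: \<delta>1_def \<delta>2_def)
  define C3 where "C3 = C1 * \<delta>1 powr (- ((p - 1 - s) / ((q - s) - (p - 1 - s))))"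
  define C4 where "C4 = C2 * \<delta>2 powr (- ((1 - s) / ((q - s) - (1 - s))))"
  have C34: "C3 \<ge> 0" "C4 \<ge> 0" using pos by (auto simp: C3_def C4_def)
  show ?thesis
  proof (intro exI[of _ "C3 + C4 + c1"] conjI allI impI)
    show "0 \<le> C3 + C4 + c1" using C34 c by simp
    fix \<epsilon> \<nu> w \<zeta> f :: real
    assume "0 < \<epsilon> \<and> 0 < \<nu> \<and> \<nu> \<le> \<epsilon> \<and> w \<ge> 0 \<and> 0 < \<zeta> \<and> \<zeta> \<le> 1 \<and> f \<ge> 0"
    then have h: "0 < \<epsilon>" "0 < \<nu>" "\<nu> \<le> \<epsilon>" "w \<ge> 0" "0 < \<zeta>" "\<zeta> \<le> 1" "f \<ge> 0" by auto
    define W where "W = w + \<nu>"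
    have W: "W > 0" "W \<ge> \<nu>" using h by (auto simp: W_def)
    have E: "(\<epsilon> powr ((q - p + 1) / p)) powr p = \<epsilon> powr (q - p + 1)" using p by (simp add: powr_powr)
    have e1: "- s * p + (s + 1) * (p - 1) = p - 1 - s" by (simp add: algebra_simps)
    have "f * (W powr (- s) * (2 * k) * \<epsilon> powr ((q - p + 1) / p) * \<zeta> powr (k - 1) * 1) \<le>
      \<theta> * (f powr r * W powr (- s - 1) * \<zeta> powr k)
      + \<theta> powr (1 - p) * ((2 * k) powr p * (\<epsilon> powr ((q - p + 1) / p)) powr p * 1 powr p * W powr (- s * p + (s + 1) * (p - 1)) * \<zeta> powr (k - p))"
      by (rule flux_Young) (use h W pos k in auto)
    then have 1: "f * (W powr (- s) * (2 * k) * \<epsilon> powr ((q - p + 1) / p) * \<zeta> powr (k - 1)) \<le>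
      \<theta> * (f powr r * W powr (- s - 1) * \<zeta> powr k) + C1 * (\<epsilon> powr (q - p + 1) * W powr (p - 1 - s) * \<zeta> powr (k - p))"
      unfolding E e1 C1_def by (simp add: mult_ac)
    have "\<epsilon> powr ((q - s) - (p - 1 - s)) * W powr (p - 1 - s) * \<zeta> powr (k - p)
      \<le> \<delta>1 * (W powr (q - s) * \<zeta> powr k) + \<delta>1 powr (- ((p - 1 - s) / ((q - s) - (p - 1 - s)))) * \<epsilon> powr (q - s)"
      by (rule Young_powr_cutoff) (use h W p q s \<delta> k in auto)
    then have "C1 * (\<epsilon> powr ((q - s) - (p - 1 - s)) * W powr (p - 1 - s) * \<zeta> powr (k - p))
      \<le> C1 * (\<delta>1 * (W powr (q - s) * \<zeta> powr k) + \<delta>1 powr (- ((p - 1 - s) / ((q - s) - (p - 1 - s)))) * \<epsilon> powr (q - s))"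
      using pos by (intro mult_left_mono) auto
    moreover have "\<epsilon> powr ((q - s) - (p - 1 - s)) = \<epsilon> powr (q - p + 1)"
      by (simp add: algebra_simps)
    moreover have "C1 * \<delta>1 = c1 * 2 powr (- q) / 2" using pos by (simp add: \<delta>1_def)
    ultimately have 2: "C1 * (\<epsilon> powr (q - p + 1) * W powr (p - 1 - s) * \<zeta> powr (k - p))
      \<le> c1 * 2 powr (- q) / 2 * (W powr (q - s) * \<zeta> powr k) + C3 * \<epsilon> powr (q - s)"
      by (simp only: C3_def distrib_left mult.assoc[symmetric])
    have "\<epsilon> powr ((q - s) - (1 - s)) * W powr (1 - s) * \<zeta> powr (k - 1)
      \<le> \<delta>2 * (W powr (q - s) * \<zeta> powr k) + \<delta>2 powr (- ((1 - s) / ((q - s) - (1 - s)))) * \<epsilon> powr (q - s)"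
      by (rule Young_powr_cutoff) (use h W p q s s1 \<delta> k in auto)
    then have "C2 * (\<epsilon> powr ((q - s) - (1 - s)) * W powr (1 - s) * \<zeta> powr (k - 1))
      \<le> C2 * (\<delta>2 * (W powr (q - s) * \<zeta> powr k) + \<delta>2 powr (- ((1 - s) / ((q - s) - (1 - s)))) * \<epsilon> powr (q - s))"
      using pos by (intro mult_left_mono) auto
    moreover have "\<epsilon> powr ((q - s) - (1 - s)) = \<epsilon> powr (q - 1)" by simp
    moreover have "C2 * \<delta>2 = c1 * 2 powr (- q) / 2" using pos by (simp add: \<delta>2_def)
    ultimately have "C2 * (\<epsilon> powr (q - 1) * W powr (1 - s) * \<zeta> powr (k - 1))
      \<le> c1 * 2 powr (- q) / 2 * (W powr (q - s) * \<zeta> powr k) + C4 * \<epsilon> powr (q - s)"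
      by (simp only: C4_def distrib_left mult.assoc[symmetric])
    moreover have "C2 * (\<epsilon> powr (q - 1) * W powr (1 - s) * \<zeta> powr (k - 1)) = W powr (1 - s) / (1 - s) * (2 * k * \<epsilon> powr (q - 1) * \<zeta> powr (k - 1))"
      by (simp add: C2_def)
    ultimately have 3: "W powr (1 - s) / (1 - s) * (2 * k * \<epsilon> powr (q - 1) * \<zeta> powr (k - 1))
      \<le> c1 * 2 powr (- q) / 2 * (W powr (q - s) * \<zeta> powr k) + C4 * \<epsilon> powr (q - s)" by simp
    \<comment> \<open>The source is a power of \<open>w\<close>, the absorbed terms are powers of
      \<open>W = w + \<nu>\<close>. Passing from one to the other costs a multiple of \<nu>^(q-s),
      and \<open>\<nu> \<le> \<epsilon>\<close>.\<close>
    have 4: "c1 * 2 powr (- q) * (W powr (q - s) * \<zeta> powr k) \<le> c1 * (w powr q * W powr (- s) * \<zeta> powr k) + c1 * \<epsilon> powr (q - s)"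
    proof -
      have "W powr q \<le> 2 powr q * (w powr q + \<nu> powr q)"
        unfolding W_def by (rule powr_add_le) (use h q in auto)
      then have "2 powr (- q) * W powr q \<le> w powr q + \<nu> powr q"
        by (simp add: powr_minus field_simps)
      then have "2 powr (- q) * W powr q * W powr (- s) \<le> (w powr q + \<nu> powr q) * W powr (- s)"
        by (intro mult_right_mono) auto
      moreover have "W powr q * W powr (- s) = W powr (q - s)" by (simp add: powr_add[symmetric])
      moreover have "\<nu> powr q * W powr (- s) \<le> \<nu> powr q * \<nu> powr (- s)"
        using W h s by (intro mult_left_mono powr_mono2') auto
      moreover have "\<nu> powr q * \<nu> powr (- s) = \<nu> powr (q - s)" by (simp add: powr_add[symmetric])
      moreover have "\<nu> powr (q - s) \<le> \<epsilon> powr (q - s)" using h q s1 by (intro powr_mono2) auto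
      ultimately have "2 powr (- q) * W powr (q - s) \<le> w powr q * W powr (- s) + \<epsilon> powr (q - s)"
        by (simp add: distrib_right mult.assoc)
      then have "2 powr (- q) * W powr (q - s) * \<zeta> powr k \<le> (w powr q * W powr (- s) + \<epsilon> powr (q - s)) * \<zeta> powr k"
        by (intro mult_right_mono) auto
      also have "\<dots> \<le> w powr q * W powr (- s) * \<zeta> powr k + \<epsilon> powr (q - s) * 1"
        unfolding distrib_right using h k by (intro add_left_mono mult_left_mono powr_le1) auto
      finally have "c1 * (2 powr (- q) * W powr (q - s) * \<zeta> powr k) \<le> c1 * (w powr q * W powr (- s) * \<zeta> powr k + \<epsilon> powr (q - s) * 1)"
        using c by (intro mult_left_mono) auto
      then show ?thesis by (simp add: algebra_simps)
    qed
    have "(C3 + C4 + c1) * \<epsilon> powr (q - s) = C3 * \<epsilon> powr (q - s) + C4 * \<epsilon> powr (q - s) + c1 * \<epsilon> powr (q - s)"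
      by (simp add: distrib_right)
    then show "f * ((w + \<nu>) powr (- s) * (2 * k) * \<epsilon> powr ((q - p + 1) / p) * \<zeta> powr (k - 1))
    + (w + \<nu>) powr (1 - s) / (1 - s) * (2 * k * \<epsilon> powr (q - 1) * \<zeta> powr (k - 1))
    - s * c0 * (f powr r * (w + \<nu>) powr (- s - 1) * \<zeta> powr k)
    - c1 * (w powr q * (w + \<nu>) powr (- s) * \<zeta> powr k)
    \<le> (C3 + C4 + c1) * \<epsilon> powr (q - s) - s * c0 / 2 * (f powr r * (w + \<nu>) powr (- s - 1) * \<zeta> powr k)"
      using 1 2 3 4 unfolding W_def[symmetric] \<theta>_def by (simp add: field_simps)
  qed
qed

text \<open>The power of \<open>W\<close> that Young's inequality leaves when the test function does
  not depend on \<open>w\<close>; \<open>a < q\<close> makes it comparable with the source.\<close>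

definition a where "a = (s + 1) * (p - 1)"

lemma a: "a > 0" "a < q" using s p by (auto simp: a_def)

text \<open>\<open>m\<close> will be the factor \<open>\<sigma>\<close>. It is kept on the w^q term,
  so that this term can vanish with \<epsilon> for any fixed \<eta> and \<open>A\<close>. The
  coefficient of \<epsilon>^q is afterwards made small by large \<open>A\<close> and then small
  \<eta>.\<close>

lemma second_estimate_pointwise:
  "\<exists>C>0. \<forall>\<eta> A \<epsilon> w \<zeta> m f. 0 < \<eta> \<and> \<eta> \<le> 1 \<and> A > 0 \<and> 0 < \<epsilon> \<and> w \<ge> 0 \<and> 0 < \<zeta> \<and> \<zeta> \<le> 1 \<and> 0 \<le> m \<and> m \<le> 1 \<and> f \<ge> 0 \<longrightarrow>
    f * ((2 * k) * \<epsilon> powr ((q - p + 1) / p) * \<zeta> powr (k - 1) * m)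
    + w * (2 * k * \<epsilon> powr (q - 1) * \<zeta> powr (k - 1) * m)
    \<le> \<eta> * \<epsilon> powr s * (f powr r * (w + \<eta> powr (p / a) * \<epsilon>) powr (- s - 1) * \<zeta> powr k)
      + C * \<eta> powr (1 - p) * A * (m * (w powr q * \<zeta> powr k))
      + C * (\<eta> + \<eta> powr (1 - p) * (A powr (- (a / (q - a))) + A powr (- (1 / (q - 1))))) * \<epsilon> powr q"
proof -
  define C1 where "C1 = (2 * k) powr p * 2 powr a"
  have C1: "C1 > 0" "2 * k > 0" using k by (auto simp: C1_def)
  show ?thesis
  proof (intro exI[of _ "C1 + 2 * k"] conjI allI impI)
    show "0 < C1 + 2 * k" using C1 by simp
    fix \<eta> A \<epsilon> w \<zeta> m f :: real
    assume "0 < \<eta> \<and> \<eta> \<le> 1 \<and> A > 0 \<and> 0 < \<epsilon> \<and> w \<ge> 0 \<and> 0 < \<zeta> \<and> \<zeta> \<le> 1 \<and> 0 \<le> m \<and> m \<le> 1 \<and> f \<ge> 0"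
    then have h: "0 < \<eta>" "\<eta> \<le> 1" "A > 0" "0 < \<epsilon>" "w \<ge> 0" "0 < \<zeta>" "\<zeta> \<le> 1" "0 \<le> m" "m \<le> 1" "f \<ge> 0" by auto
    \<comment> \<open>With this choice \<nu>^a \<epsilon>^(q-a) is \<eta>^p \<epsilon>^q, so that it
      contributes a multiple of \<eta> \<epsilon>^q in spite of the factor \<eta>^(1-p).\<close>
    define \<nu> where "\<nu> = \<eta> powr (p / a) * \<epsilon>"
    have \<nu>: "\<nu> > 0" using h by (simp add: \<nu>_def)
    define W where "W = w + \<nu>"
    have W: "W > 0" using h \<nu> by (auto simp: W_def)
    \<comment> \<open>\<epsilon>^s is the factor under which the first estimate bounds the weighted
      flux integral, so that only \<eta> remains in front.\<close>
    define \<theta> where "\<theta> = \<eta> * \<epsilon> powr s"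
    have \<theta>: "\<theta> > 0" using h by (simp add: \<theta>_def)
    define L where "L = \<eta> powr (1 - p)"
    have L: "L \<ge> 1" using h p powr_mono'[of "1 - p" 0 \<eta>] by (simp add: L_def)
    define g1 where "g1 = A powr (- (a / (q - a)))"
    define g2 where "g2 = A powr (- (1 / (q - 1)))"
    have g: "g1 \<ge> 0" "g2 \<ge> 0" by (auto simp: g1_def g2_def)
    have E: "(\<epsilon> powr ((q - p + 1) / p)) powr p = \<epsilon> powr (q - p + 1)" using p by (simp add: powr_powr)
    have T: "\<theta> powr (1 - p) = L * \<epsilon> powr (s * (1 - p))" using h by (simp add: \<theta>_def L_def powr_mult powr_powr)
    have E2: "\<epsilon> powr (s * (1 - p)) * \<epsilon> powr (q - p + 1) = \<epsilon> powr (q - a)"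
      unfolding powr_add[symmetric] by (simp add: a_def algebra_simps)
    have "f * (W powr 0 * (2 * k) * \<epsilon> powr ((q - p + 1) / p) * \<zeta> powr (k - 1) * m) \<le>
      \<theta> * (f powr r * W powr (- s - 1) * \<zeta> powr k)
      + \<theta> powr (1 - p) * ((2 * k) powr p * (\<epsilon> powr ((q - p + 1) / p)) powr p * m powr p * W powr (0 * p + (s + 1) * (p - 1)) * \<zeta> powr (k - p))"
      by (rule flux_Young) (use h W \<theta> k in auto)
    also have "\<theta> powr (1 - p) * ((2 * k) powr p * (\<epsilon> powr ((q - p + 1) / p)) powr p * m powr p * W powr (0 * p + (s + 1) * (p - 1)) * \<zeta> powr (k - p))
      = L * ((2 * k) powr p * ((\<epsilon> powr (s * (1 - p)) * \<epsilon> powr (q - p + 1)) * (m powr p * W powr a * \<zeta> powr (k - p))))"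
      unfolding E T a_def by (simp add: mult_ac)
    also have "\<dots> = L * ((2 * k) powr p * (\<epsilon> powr (q - a) * (m powr p * W powr a * \<zeta> powr (k - p))))"
      unfolding E2 ..
    also have "\<dots> \<le> L * ((2 * k) powr p * (\<epsilon> powr (q - a) * (m * (2 powr a * (w powr a + \<nu> powr a)) * \<zeta> powr (k - p))))"
    proof -
      have "m powr p \<le> m"
        using h p powr_mono'[of 1 p m] by (cases "m = 0") auto
      moreover have "W powr a \<le> 2 powr a * (w powr a + \<nu> powr a)"
        unfolding W_def by (rule powr_add_le) (use h \<nu> a in auto)
      ultimately show ?thesis using h L by (intro mult_left_mono mult_right_mono mult_mono) auto
    qed
    also have "\<dots> = L * C1 * (m * (\<epsilon> powr (q - a) * w powr a * \<zeta> powr (k - p)))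
       + L * C1 * (m * (\<epsilon> powr (q - a) * \<nu> powr a * \<zeta> powr (k - p)))"
      by (simp add: C1_def algebra_simps)
    finally have 1: "f * ((2 * k) * \<epsilon> powr ((q - p + 1) / p) * \<zeta> powr (k - 1) * m) \<le>
      \<theta> * (f powr r * W powr (- s - 1) * \<zeta> powr k)
      + (L * C1 * (m * (\<epsilon> powr (q - a) * w powr a * \<zeta> powr (k - p)))
       + L * C1 * (m * (\<epsilon> powr (q - a) * \<nu> powr a * \<zeta> powr (k - p))))" using W by simp
    have "\<epsilon> powr (q - a) * w powr a * \<zeta> powr (k - p) \<le> A * (w powr q * \<zeta> powr k) + g1 * \<epsilon> powr q"
      unfolding g1_def by (rule Young_powr_cutoff) (use h a p q k in \<open>auto simp: a_def\<close>)
    then have "m * (\<epsilon> powr (q - a) * w powr a * \<zeta> powr (k - p)) \<le> m * (A * (w powr q * \<zeta> powr k) + g1 * \<epsilon> powr q)"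
      using h by (intro mult_left_mono)
    also have "\<dots> \<le> A * (m * (w powr q * \<zeta> powr k)) + 1 * (g1 * \<epsilon> powr q)"
      unfolding distrib_left using h g by (intro add_mono mult_right_mono) auto
    finally have 2: "L * C1 * (m * (\<epsilon> powr (q - a) * w powr a * \<zeta> powr (k - p))) \<le> L * C1 * (A * (m * (w powr q * \<zeta> powr k)) + g1 * \<epsilon> powr q)"
      using L C1 by (intro mult_left_mono) auto
    have 3: "L * C1 * (m * (\<epsilon> powr (q - a) * \<nu> powr a * \<zeta> powr (k - p))) \<le> C1 * \<eta> * \<epsilon> powr q"
    proof -
      have "k - p \<ge> 0" using k p by simp
      then have "m * (\<epsilon> powr (q - a) * \<nu> powr a * \<zeta> powr (k - p)) \<le> 1 * (\<epsilon> powr (q - a) * \<nu> powr a * 1)"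
        using h by (intro mult_mono mult_left_mono powr_le1) auto
      also have "\<dots> = \<eta> powr p * (\<epsilon> powr (q - a) * \<epsilon> powr a)"
        using h a by (simp add: \<nu>_def powr_mult powr_powr)
      also have "\<epsilon> powr (q - a) * \<epsilon> powr a = \<epsilon> powr q" by (simp add: powr_add[symmetric])
      finally have "L * C1 * (m * (\<epsilon> powr (q - a) * \<nu> powr a * \<zeta> powr (k - p))) \<le> L * C1 * (\<eta> powr p * \<epsilon> powr q)"
        using L C1 by (intro mult_left_mono) auto
      also have "\<dots> = C1 * (\<eta> powr (1 - p) * \<eta> powr p) * \<epsilon> powr q" by (simp add: L_def)
      also have "\<eta> powr (1 - p) * \<eta> powr p = \<eta>" using h unfolding powr_add[symmetric] by simp
      finally show ?thesis .
    qed
    have 4: "w * (2 * k * \<epsilon> powr (q - 1) * \<zeta> powr (k - 1) * m) \<le> L * (2 * k) * (A * (m * (w powr q * \<zeta> powr k)) + g2 * \<epsilon> powr q)"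
    proof -
      have "\<epsilon> powr (q - 1) * w powr 1 * \<zeta> powr (k - 1) \<le> A * (w powr q * \<zeta> powr k) + g2 * \<epsilon> powr q"
        unfolding g2_def by (rule Young_powr_cutoff) (use h q k in auto)
      then have "m * (\<epsilon> powr (q - 1) * w powr 1 * \<zeta> powr (k - 1)) \<le> m * (A * (w powr q * \<zeta> powr k) + g2 * \<epsilon> powr q)"
        using h by (intro mult_left_mono)
      also have "\<dots> \<le> A * (m * (w powr q * \<zeta> powr k)) + 1 * (g2 * \<epsilon> powr q)"
        unfolding distrib_left using h g by (intro add_mono mult_right_mono) auto
      finally have "(2 * k) * (m * (\<epsilon> powr (q - 1) * w powr 1 * \<zeta> powr (k - 1))) \<le> (2 * k) * (A * (m * (w powr q * \<zeta> powr k)) + g2 * \<epsilon> powr q)"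
        using C1 by (intro mult_left_mono) auto
      also have "\<dots> \<le> L * ((2 * k) * (A * (m * (w powr q * \<zeta> powr k)) + g2 * \<epsilon> powr q))"
        using L h g C1 mult_right_mono[of 1 L "(2 * k) * (A * (m * (w powr q * \<zeta> powr k)) + g2 * \<epsilon> powr q)"] by simp
      finally show ?thesis using h by (simp add: mult_ac)
    qed
    define Z where "Z = m * (w powr q * \<zeta> powr k)"
    define Y where "Y = \<epsilon> powr q"
    have ZY: "Z \<ge> 0" "Y \<ge> 0" using h by (auto simp: Z_def Y_def)
    have "L * C1 * (A * Z + g1 * Y) + C1 * \<eta> * Y + L * (2 * k) * (A * Z + g2 * Y)
        \<le> (C1 + 2 * k) * L * A * Z + (C1 + 2 * k) * (\<eta> + L * (g1 + g2)) * Y"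
    proof -
      have "0 \<le> 2 * k * \<eta> * Y + 2 * k * L * g1 * Y + C1 * L * g2 * Y"
        using h L C1 g ZY by (intro add_nonneg_nonneg mult_nonneg_nonneg) auto
      then show ?thesis by (simp add: algebra_simps)
    qed
    then show "f * ((2 * k) * \<epsilon> powr ((q - p + 1) / p) * \<zeta> powr (k - 1) * m)
      + w * (2 * k * \<epsilon> powr (q - 1) * \<zeta> powr (k - 1) * m)
      \<le> \<eta> * \<epsilon> powr s * (f powr r * (w + \<eta> powr (p / a) * \<epsilon>) powr (- s - 1) * \<zeta> powr k)
        + (C1 + 2 * k) * \<eta> powr (1 - p) * A * (m * (w powr q * \<zeta> powr k))
        + (C1 + 2 * k) * (\<eta> + \<eta> powr (1 - p) * (A powr (- (a / (q - a))) + A powr (- (1 / (q - 1))))) * \<epsilon> powr q"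
      using 1 2 3 4
      unfolding \<nu>_def[symmetric] W_def[symmetric] g1_def[symmetric] g2_def[symmetric] L_def[symmetric] Z_def[symmetric] Y_def[symmetric] \<theta>_def[symmetric]
      by linarith
  qed
qed

end

section \<open>Cutoff functions\<close>

text \<open>The condition \<open>k \<ge> 2\<close> makes the derivative continuous across 0;
  first-order regularity is what \<open>energy_inequality\<close> asks of a cutoff.\<close>

lemma max_power_has_derivative:
  assumes "k \<ge> 2"
  shows "((\<lambda>x. max 0 x ^ k) has_real_derivative real k * max 0 x ^ (k - 1)) (at x)"
proof -
  obtain j where j: "k = Suc (Suc j)" using assms by (metis add_2_eq_Suc le_Suc_ex)
  consider "x > 0" | "x < 0" | "x = 0" by linarith
  then show ?thesis
  proof cases
    case 1
    have "((\<lambda>x. x ^ k) has_real_derivative real k * max 0 x ^ (k - 1)) (at x)"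
      using 1 by (auto intro!: derivative_eq_intros)
    then show ?thesis
      by (rule has_field_derivative_transform_within_open[of _ _ _ "{0<..}"]) (use 1 in auto)
  next
    case 2
    have "((\<lambda>x. 0) has_real_derivative real k * max 0 x ^ (k - 1)) (at x)"
      using 2 j by simp
    then show ?thesis
      by (rule has_field_derivative_transform_within_open[of _ _ _ "{..<0}"]) (use 2 j in auto)
  next
    case 3
    have "(\<lambda>h::real. max 0 h ^ k / h) \<midarrow>0\<rightarrow> 0"
    proof (rule Lim_null_comparison)
      show "eventually (\<lambda>h. norm (max 0 h ^ k / h) \<le> \<bar>h\<bar> ^ Suc j) (at (0::real))"
        by (rule always_eventually) (auto simp: j max_def intro: mult_nonpos_nonneg)
      show "(\<lambda>h. \<bar>h\<bar> ^ Suc j) \<midarrow>0\<rightarrow> (0::real)"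
        by (auto intro!: tendsto_eq_intros)
    qed
    then show ?thesis using 3 j by (simp add: DERIV_def)
  qed
qed

lemma max_power_chain:
  assumes "k \<ge> 2" "(f has_real_derivative f') (at x)"
  shows "((\<lambda>x. max 0 (f x) ^ k) has_real_derivative real k * max 0 (f x) ^ (k - 1) * f') (at x)"
  by (rule DERIV_chain2[where f = "\<lambda>x. max 0 x ^ k" and g = f, OF max_power_has_derivative[OF assms(1)] assms(2)])

text \<open>A rational step of class C1: non-decreasing, 0 up to time \<tau>, and tending to 1 at
  each fixed positive time as \<tau> tends to 0.\<close>

definition time_cutoff :: "real \<Rightarrow> real \<Rightarrow> real" where
  "time_cutoff \<tau> t = max 0 (t - \<tau>) ^ 2 / (max 0 (t - \<tau>) ^ 2 + \<tau>\<^sup>2)"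

definition time_cutoff_deriv :: "real \<Rightarrow> real \<Rightarrow> real" where
  "time_cutoff_deriv \<tau> t = 2 * max 0 (t - \<tau>) * \<tau>\<^sup>2 / (max 0 (t - \<tau>) ^ 2 + \<tau>\<^sup>2)\<^sup>2"

lemma time_cutoff_denominator: "\<tau> > 0 \<Longrightarrow> max 0 (t - \<tau>) ^ 2 + \<tau>\<^sup>2 > (0::real)"
  by (simp add: add_nonneg_pos)

lemma time_cutoff_has_derivative:
  assumes "\<tau> > 0"
  shows "(time_cutoff \<tau> has_real_derivative time_cutoff_deriv \<tau> t) (at t)"
proof -
  have d: "((\<lambda>t. max 0 (t - \<tau>) ^ 2) has_real_derivative 2 * max 0 (t - \<tau>)) (at t)"
    by (rule DERIV_cong[OF max_power_chain[of 2 "\<lambda>t. t - \<tau>" 1 t]]) (auto intro!: derivative_eq_intros)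
  have n: "max 0 (t - \<tau>) ^ 2 + \<tau>\<^sup>2 \<noteq> 0" using time_cutoff_denominator[OF assms, of t] by linarith
  show ?thesis
    unfolding time_cutoff_def[abs_def] time_cutoff_deriv_def
    by (rule derivative_eq_intros d refl n)+ (simp add: power2_eq_square algebra_simps)
qed

lemma time_cutoff_bounds: "0 \<le> time_cutoff \<tau> t" "time_cutoff \<tau> t \<le> 1" "0 \<le> time_cutoff_deriv \<tau> t"
proof -
  have "x / (x + y\<^sup>2) \<le> 1" if "x \<ge> 0" for x y :: real
    using that zero_le_power2[of y] by (cases "x + y\<^sup>2 = 0") (simp, subst divide_le_eq_1_pos, linarith, linarith)
  then show "time_cutoff \<tau> t \<le> 1" by (simp add: time_cutoff_def)
qed (auto simp: time_cutoff_def time_cutoff_deriv_def)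

lemma time_cutoff_zero: "t \<le> \<tau> \<Longrightarrow> time_cutoff \<tau> t = 0" "t \<le> \<tau> \<Longrightarrow> time_cutoff_deriv \<tau> t = 0"
  by (auto simp: time_cutoff_def time_cutoff_deriv_def)

lemma continuous_time_cutoff:
  assumes "\<tau> > 0"
  shows "continuous_on UNIV (time_cutoff \<tau>)" "continuous_on UNIV (time_cutoff_deriv \<tau>)"
proof -
  have "max 0 (t - \<tau>) ^ 2 + \<tau>\<^sup>2 \<noteq> 0" for t using time_cutoff_denominator[OF assms, of t] by linarith
  then show "continuous_on UNIV (time_cutoff \<tau>)" "continuous_on UNIV (time_cutoff_deriv \<tau>)"
    unfolding time_cutoff_def[abs_def] time_cutoff_deriv_def[abs_def]
    by (intro continuous_intros; simp)+
qed

text \<open>The square of a radius: its root bounds both the rescaled time and the rescaled space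
  variable, and the square itself is smooth at the origin.\<close>

definition par_radius :: "real \<Rightarrow> real \<Rightarrow> real \<times> (real ^ 'n) \<Rightarrow> real" where
  "par_radius T R z = (fst z / T)\<^sup>2 + (snd z \<bullet> snd z) / R\<^sup>2"

definition bowl :: "real \<Rightarrow> real \<Rightarrow> real \<times> (real ^ 'n) \<Rightarrow> real" where
  "bowl T R z = max 0 (1 - par_radius T R z)"

definition cutoff :: "nat \<Rightarrow> real \<Rightarrow> real \<Rightarrow> real \<Rightarrow> real \<times> (real ^ 'n) \<Rightarrow> real" where
  "cutoff k \<tau> T R z = time_cutoff \<tau> (fst z) * bowl T R z ^ k"

definition cutoff_t :: "nat \<Rightarrow> real \<Rightarrow> real \<Rightarrow> real \<Rightarrow> real \<times> (real ^ 'n) \<Rightarrow> real" where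
  "cutoff_t k \<tau> T R z = time_cutoff_deriv \<tau> (fst z) * bowl T R z ^ k
     - time_cutoff \<tau> (fst z) * (real k * bowl T R z ^ (k - 1) * (2 * fst z / T\<^sup>2))"

definition cutoff_x :: "nat \<Rightarrow> real \<Rightarrow> real \<Rightarrow> real \<Rightarrow> 'n \<Rightarrow> real \<times> (real ^ 'n) \<Rightarrow> real" where
  "cutoff_x k \<tau> T R i z = - (time_cutoff \<tau> (fst z) * (real k * bowl T R z ^ (k - 1) * (2 * (snd z $ i) / R\<^sup>2)))"

definition cut_box :: "real \<Rightarrow> real \<Rightarrow> (real \<times> (real ^ 'n)) set" where
  "cut_box T R = cbox (0, vec (- R)) (T, vec R)"

lemma par_radius_nonneg: "par_radius T R z \<ge> 0"
  by (simp add: par_radius_def)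

lemma bowl_bounds: "0 \<le> bowl T R z" "bowl T R z \<le> 1"
  using par_radius_nonneg[of T R z] by (auto simp: bowl_def)

lemma dir_deriv_par_radius:
  fixes b :: "real \<times> (real ^ 'n)"
  shows "dir_deriv b (par_radius T R) (\<lambda>z. 2 * fst z * fst b / T\<^sup>2 + 2 * (snd z \<bullet> snd b) / R\<^sup>2)"
proof -
  have "((\<lambda>z. fst z * fst z * (1 / T\<^sup>2) + (snd z \<bullet> snd z) * (1 / R\<^sup>2)) has_derivative
     (\<lambda>h. (fst z * fst h + fst h * fst z) * (1 / T\<^sup>2) + (snd z \<bullet> snd h + snd h \<bullet> snd z) * (1 / R\<^sup>2))) (at z)"
    for z :: "real \<times> (real ^ 'n)"
    by (intro has_derivative_add has_derivative_mult_left has_derivative_mult has_derivative_inner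
        has_derivative_fst has_derivative_snd has_derivative_ident)
  from has_derivative_imp_dir_deriv[OF this, of b]
  show ?thesis
    by (simp add: par_radius_def[abs_def] power_divide power2_eq_square inner_commute[of "snd b"] algebra_simps add_divide_distrib[symmetric])
qed

lemma dir_deriv_cutoff:
  fixes b :: "real \<times> (real ^ 'n)"
  assumes "k \<ge> 2" "\<tau> > 0"
  shows "dir_deriv b (cutoff k \<tau> T R)
    (\<lambda>z. time_cutoff_deriv \<tau> (fst z) * fst b * bowl T R z ^ k + time_cutoff \<tau> (fst z) *
       (- (real k * bowl T R z ^ (k - 1)) * (2 * fst z * fst b / T\<^sup>2 + 2 * (snd z \<bullet> snd b) / R\<^sup>2)))"
proof -
  have f: "dir_deriv b fst (\<lambda>z. fst b)"
    by (rule has_derivative_imp_dir_deriv) (auto intro!: derivative_eq_intros)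
  have 1: "dir_deriv b (\<lambda>z. time_cutoff \<tau> (fst z)) (\<lambda>z. time_cutoff_deriv \<tau> (fst z) * fst b)"
    by (rule dir_deriv_compose[OF f]) (rule time_cutoff_has_derivative[OF assms(2)])
  have "((\<lambda>x. max 0 (1 - x) ^ k) has_real_derivative - (real k * max 0 (1 - x) ^ (k - 1))) (at x)" for x
    by (rule DERIV_cong[OF max_power_chain[OF assms(1), of "\<lambda>x. 1 - x" "- 1" x]]) (auto intro!: derivative_eq_intros)
  then have 2: "dir_deriv b (\<lambda>z. max 0 (1 - par_radius T R z) ^ k)
      (\<lambda>z. - (real k * max 0 (1 - par_radius T R z) ^ (k - 1)) * (2 * fst z * fst b / T\<^sup>2 + 2 * (snd z \<bullet> snd b) / R\<^sup>2))"
    by (intro dir_deriv_compose[OF dir_deriv_par_radius])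
  show ?thesis
    using dir_deriv_mult[OF 1 2] by (simp add: cutoff_def[abs_def] bowl_def)
qed

lemma dir_deriv_cutoff_t:
  assumes "k \<ge> 2" "\<tau> > 0"
  shows "dir_deriv t_dir (cutoff k \<tau> T R) (cutoff_t k \<tau> T R)"
  using dir_deriv_cutoff[OF assms, of t_dir T R]
  by (simp add: cutoff_t_def[abs_def] t_dir_def)

lemma dir_deriv_cutoff_x:
  assumes "k \<ge> 2" "\<tau> > 0"
  shows "dir_deriv (x_dir i) (cutoff k \<tau> T R) (cutoff_x k \<tau> T R i)"
  using dir_deriv_cutoff[OF assms, of "x_dir i" T R]
  by (simp add: cutoff_x_def[abs_def] x_dir_def inner_axis)

lemma continuous_par_radius: "continuous_on UNIV (par_radius T R)"
  unfolding par_radius_def[abs_def] by (simp add: divide_inverse, intro continuous_intros)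

lemma continuous_cutoff:
  assumes "\<tau> > 0"
  shows "continuous_on UNIV (cutoff k \<tau> T R)" "continuous_on UNIV (cutoff_t k \<tau> T R)"
    "continuous_on UNIV (cutoff_x k \<tau> T R i)"
proof -
  note c = continuous_on_compose2[OF continuous_time_cutoff(1)[OF assms] continuous_on_fst[OF continuous_on_id]]
    continuous_on_compose2[OF continuous_time_cutoff(2)[OF assms] continuous_on_fst[OF continuous_on_id]]
  show "continuous_on UNIV (cutoff k \<tau> T R)" "continuous_on UNIV (cutoff_t k \<tau> T R)"
    "continuous_on UNIV (cutoff_x k \<tau> T R i)"
    unfolding cutoff_def[abs_def] cutoff_t_def[abs_def] cutoff_x_def[abs_def] bowl_def divide_inverse
    by (intro continuous_intros c continuous_par_radius; simp)+
qed

lemma cutoff_nonneg: "cutoff k \<tau> T R z \<ge> 0"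
  by (simp add: cutoff_def time_cutoff_bounds bowl_bounds)

lemma bowl_pos_imp:
  fixes z :: "real \<times> (real ^ 'n)"
  assumes "bowl T R z > 0" "T > 0" "R > 0"
  shows "\<bar>fst z\<bar> \<le> T" "norm (snd z) \<le> R" "par_radius T R z < 1" "bowl T R z = 1 - par_radius T R z"
    "\<bar>fst z\<bar> / T \<le> sqrt (par_radius T R z)" "norm (snd z) / R \<le> sqrt (par_radius T R z)"
proof -
  show lt: "par_radius T R z < 1" and "bowl T R z = 1 - par_radius T R z"
    using assms by (auto simp: bowl_def max_def split: if_splits)
  have e: "par_radius T R z = (\<bar>fst z\<bar> / T)\<^sup>2 + (norm (snd z) / R)\<^sup>2"
    by (simp add: par_radius_def power_divide power2_norm_eq_inner)
  show 1: "\<bar>fst z\<bar> / T \<le> sqrt (par_radius T R z)" "norm (snd z) / R \<le> sqrt (par_radius T R z)"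
    by (rule real_le_rsqrt, simp add: e)+
  have "sqrt (par_radius T R z) < 1" using lt by simp
  then have "\<bar>fst z\<bar> / T \<le> 1" "norm (snd z) / R \<le> 1" using 1 by linarith+
  then show "\<bar>fst z\<bar> \<le> T" "norm (snd z) \<le> R" using assms by simp_all
qed

lemma cutoff_support:
  fixes z :: "real \<times> (real ^ 'n)"
  assumes "k \<ge> 2" "\<tau> > 0" "T > 0" "R > 0" and z: "z \<notin> cbox (\<tau>, vec (- R)) (T, vec R)"
  shows "cutoff k \<tau> T R z = 0" "cutoff_t k \<tau> T R z = 0" "cutoff_x k \<tau> T R i z = 0"
proof -
  have "fst z \<le> \<tau> \<or> bowl T R z = 0"
  proof (rule ccontr)
    assume "\<not> ?thesis"
    then have h: "fst z > \<tau>" "bowl T R z > 0" using bowl_bounds(1)[of T R z] by auto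
    have "\<bar>snd z $ i\<bar> \<le> R" for i
      using bowl_pos_imp(2)[OF h(2) assms(3,4)] component_le_norm_cart[of "snd z" i] by linarith
    then have "z \<in> cbox (\<tau>, vec (- R)) (T, vec R)"
      using h bowl_pos_imp(1)[OF h(2) assms(3,4)]
      by (cases z) (auto simp: cbox_Pair_eq mem_box_cart abs_le_iff minus_le_iff)
    then show False using z by simp
  qed
  then show "cutoff k \<tau> T R z = 0" "cutoff_t k \<tau> T R z = 0" "cutoff_x k \<tau> T R i z = 0"
    using assms(1) by (auto simp: cutoff_def cutoff_t_def cutoff_x_def time_cutoff_zero power_0_left)
qed

lemma cutoff_box_subset_half_space: "\<tau> > 0 \<Longrightarrow> cbox (\<tau>, vec (- R)) (T, vec R) \<subseteq> half_space"
  by (auto simp: half_space_def cbox_Pair_eq)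

lemma in_cut_box:
  fixes z :: "real \<times> (real ^ 'n)"
  assumes "bowl T R z > 0" "T > 0" "R > 0" "z \<in> half_space"
  shows "z \<in> cut_box T R"
proof -
  have "\<bar>snd z $ i\<bar> \<le> R" for i
    using bowl_pos_imp(2)[OF assms(1-3)] component_le_norm_cart[of "snd z" i] by linarith
  then show ?thesis
    using bowl_pos_imp(1)[OF assms(1-3)] assms(4)
    by (cases z) (auto simp: cut_box_def half_space_def cbox_Pair_eq mem_box_cart abs_le_iff minus_le_iff)
qed

lemma measure_cut_box:
  assumes "T > 0" "R > 0"
  shows "measure lebesgue (cut_box T R :: (real \<times> (real ^ 'n)) set) = T * (2 * R) ^ CARD('n)"
proof -
  have "cbox (vec (- R)) (vec R :: real ^ 'n) \<noteq> {}"
    using assms by (auto simp: interval_ne_empty_cart)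
  then have "measure lebesgue (cut_box T R :: (real \<times> (real ^ 'n)) set) = T * (\<Prod>i\<in>(UNIV::'n set). R - (- R))"
    using assms by (simp add: cut_box_def content_Pair content_cbox_cart)
  then show ?thesis by simp
qed

lemma cutoff_tendsto_1:
  assumes z: "z \<in> half_space" and T: "filterlim T at_top F" and R: "filterlim R at_top F" and \<tau>: "(\<tau> \<longlongrightarrow> 0) F"
  shows "((\<lambda>n. cutoff k (\<tau> n) (T n) (R n) z) \<longlongrightarrow> 1) F" "((\<lambda>n. par_radius (T n) (R n) z) \<longlongrightarrow> 0) F"
proof -
  have t: "fst z > 0" using z by (auto simp: half_space_def)
  have "((\<lambda>n. (fst z / T n)\<^sup>2 + (snd z \<bullet> snd z) / (R n)\<^sup>2) \<longlongrightarrow> 0\<^sup>2 + 0) F"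
    by (intro tendsto_add tendsto_power tendsto_divide_0[OF tendsto_const] filterlim_at_top_imp_at_infinity T
        filterlim_pow_at_top R) simp
  then show 1: "((\<lambda>n. par_radius (T n) (R n) z) \<longlongrightarrow> 0) F" by (simp add: par_radius_def)
  have 2: "((\<lambda>n. time_cutoff (\<tau> n) (fst z)) \<longlongrightarrow> max 0 (fst z - 0) ^ 2 / (max 0 (fst z - 0) ^ 2 + 0\<^sup>2)) F"
    unfolding time_cutoff_def by (intro tendsto_intros \<tau>) (use t in auto)
  have "((\<lambda>n. cutoff k (\<tau> n) (T n) (R n) z) \<longlongrightarrow> max 0 (fst z - 0) ^ 2 / (max 0 (fst z - 0) ^ 2 + 0\<^sup>2) * max 0 (1 - 0) ^ k) F"
    unfolding cutoff_def bowl_def by (intro tendsto_intros 1 2)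
  then show "((\<lambda>n. cutoff k (\<tau> n) (T n) (R n) z) \<longlongrightarrow> 1) F" using t by simp
qed

section \<open>Integral estimates\<close>

lemma integrable_L_loc_mult:
  fixes h :: "'a::euclidean_space \<Rightarrow> real"
  assumes h: "L_loc 1 S h" "open S" and K: "compact K" "K \<subseteq> S"
    and c: "continuous_on UNIV c" "\<And>z. z \<notin> K \<Longrightarrow> c z = 0"
  shows "integrable lebesgue (\<lambda>z. h z * c z)"
proof -
  obtain B where B: "\<And>z. \<bar>c z\<bar> \<le> B" using bounded_compact_support[OF c(1) K(1) c(2)] by blast
  have "integrable lebesgue (\<lambda>z. indicator K z * h z * c z)"
    by (rule integrable_mult_bounded[OF L_loc_1_integrable[OF h K] _ B])
       (intro borel_imp_lebesgue_measurable borel_measurable_continuous_onI c)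
  moreover have "(\<lambda>z. indicator K z * h z * c z) = (\<lambda>z. h z * c z)"
    using c(2) by (auto simp: indicator_def fun_eq_iff)
  ultimately show ?thesis by simp
qed

locale comparison = weak_inequality half_space t_dir x_dir w wt g F X P Q + exponents p q r s "real k" c0 c1
  for w wt g :: "real \<times> (real ^ 'n) \<Rightarrow> real" and F X :: "'n \<Rightarrow> real \<times> (real ^ 'n) \<Rightarrow> real"
    and P Q :: "real \<times> (real ^ 'n) \<Rightarrow> real" and p q r s :: real and k :: nat and c0 c1 :: real +
  assumes coercive: "\<And>z. c0 * norm (\<chi> i. F i z) powr r \<le> (\<Sum>i\<in>UNIV. F i z * X i z)"
    and source: "\<And>z. w z \<ge> 0 \<Longrightarrow> c1 * \<bar>w z\<bar> powr q \<le> g z"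
    and flux_loc: "L_loc 1 half_space (\<lambda>z. norm (\<chi> i. F i z) powr r)"
    and source_loc: "L_loc 1 half_space (\<lambda>z. \<bar>w z\<bar> powr q)"
    and critical: "q \<le> p - 1 + p / real CARD('n)"
begin

definition flux :: "real \<times> (real ^ 'n) \<Rightarrow> real" where "flux z = norm (\<chi> i. F i z)"

text \<open>The parabolic scaling that leaves the equation invariant when \<open>w\<close> is measured in units
  of \<open>\<epsilon>\<close>.\<close>

definition T :: "real \<Rightarrow> real" where "T \<epsilon> = \<epsilon> powr (- (q - 1))"
definition R :: "real \<Rightarrow> real" where "R \<epsilon> = \<epsilon> powr (- ((q - p + 1) / p))"

definition \<mu> :: "real \<Rightarrow> real \<times> (real ^ 'n) \<Rightarrow> real" where "\<mu> \<epsilon> = cutoff k \<epsilon> (T \<epsilon>) (R \<epsilon>)"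
definition \<mu>t :: "real \<Rightarrow> real \<times> (real ^ 'n) \<Rightarrow> real" where "\<mu>t \<epsilon> = cutoff_t k \<epsilon> (T \<epsilon>) (R \<epsilon>)"
definition \<mu>x :: "real \<Rightarrow> 'n \<Rightarrow> real \<times> (real ^ 'n) \<Rightarrow> real" where "\<mu>x \<epsilon> i = cutoff_x k \<epsilon> (T \<epsilon>) (R \<epsilon>) i"
text \<open>The derivatives of the cutoff contain the factors t / T and |x| / R, both at most
  \<open>\<sigma>\<close>. At a fixed point \<open>\<sigma>\<close> tends to 0 with \<epsilon>; it
  plays the part of a support condition in an outer annulus.\<close>

definition \<sigma> :: "real \<Rightarrow> real \<times> (real ^ 'n) \<Rightarrow> real" where "\<sigma> \<epsilon> z = sqrt (par_radius (T \<epsilon>) (R \<epsilon>) z)"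
definition \<zeta> :: "real \<Rightarrow> real \<times> (real ^ 'n) \<Rightarrow> real" where "\<zeta> \<epsilon> = bowl (T \<epsilon>) (R \<epsilon>)"
text \<open>\<open>supp \<epsilon>\<close> starts at time \<epsilon> and is therefore compact in the
  half-space; \<open>bx \<epsilon>\<close> starts at time 0 and has the volume given by the scaling
  alone.\<close>

definition supp :: "real \<Rightarrow> (real \<times> (real ^ 'n)) set" where "supp \<epsilon> = cbox (\<epsilon>, vec (- R \<epsilon>)) (T \<epsilon>, vec (R \<epsilon>))"
definition bx :: "real \<Rightarrow> (real \<times> (real ^ 'n)) set" where "bx \<epsilon> = cut_box (T \<epsilon>) (R \<epsilon>)"

lemma k2: "k \<ge> 2" using k(1) by simp

lemma TR: "\<epsilon> > 0 \<Longrightarrow> T \<epsilon> > 0" "\<epsilon> > 0 \<Longrightarrow> R \<epsilon> > 0"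
  by (auto simp: T_def R_def)

lemma supp: "compact (supp \<epsilon>)" "\<epsilon> > 0 \<Longrightarrow> supp \<epsilon> \<subseteq> half_space"
  by (simp_all add: supp_def cutoff_box_subset_half_space)

lemma \<mu>_props:
  assumes "\<epsilon> > 0"
  shows "dir_deriv t_dir (\<mu> \<epsilon>) (\<mu>t \<epsilon>)" "\<And>i. dir_deriv (x_dir i) (\<mu> \<epsilon>) (\<mu>x \<epsilon> i)" "continuous_on UNIV (\<mu> \<epsilon>)"
    "continuous_on UNIV (\<mu>t \<epsilon>)" "\<And>i. continuous_on UNIV (\<mu>x \<epsilon> i)" "\<And>z. \<mu> \<epsilon> z \<ge> 0"
    "\<And>z. z \<notin> supp \<epsilon> \<Longrightarrow> \<mu> \<epsilon> z = 0" "\<And>z. z \<notin> supp \<epsilon> \<Longrightarrow> \<mu>t \<epsilon> z = 0" "\<And>i z. z \<notin> supp \<epsilon> \<Longrightarrow> \<mu>x \<epsilon> i z = 0"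
  unfolding \<mu>_def \<mu>t_def \<mu>x_def supp_def
  by (intro dir_deriv_cutoff_t dir_deriv_cutoff_x continuous_cutoff cutoff_nonneg cutoff_support k2 assms TR; assumption)+

text \<open>In dimension n the powers of \<epsilon> add up to 1 - n (q - p + 1) / p, which is
  non-negative precisely under \<open>critical\<close>.\<close>

lemma volume_bound:
  assumes "0 < \<epsilon>" "\<epsilon> \<le> 1"
  shows "\<epsilon> powr q * measure lebesgue (bx \<epsilon>) \<le> 2 ^ CARD('n)"
proof -
  let ?n = "real CARD('n)"
  have n: "?n > 0" by simp
  have "R \<epsilon> ^ CARD('n) = \<epsilon> powr (- ((q - p + 1) / p) * ?n)"
    using assms TR(2)[OF assms(1)] by (simp add: powr_realpow[symmetric] R_def powr_powr)
  then have "\<epsilon> powr q * measure lebesgue (bx \<epsilon>) = 2 ^ CARD('n) * (\<epsilon> powr q * \<epsilon> powr (- (q - 1)) * \<epsilon> powr (- ((q - p + 1) / p) * ?n))"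
    using measure_cut_box[OF TR[OF assms(1)], where 'n = 'n] by (simp add: bx_def power_mult_distrib T_def)
  also have "\<epsilon> powr q * \<epsilon> powr (- (q - 1)) * \<epsilon> powr (- ((q - p + 1) / p) * ?n) = \<epsilon> powr (1 - (q - p + 1) / p * ?n)"
    unfolding powr_add[symmetric] by simp
  also have "\<dots> \<le> 1"
  proof (rule powr_le1)
    have "(q - p + 1) \<le> p / ?n" using critical by simp
    then have "(q - p + 1) * ?n \<le> p" using n by (simp add: field_simps)
    then have "(q - p + 1) / p * ?n \<le> 1" using p by (simp add: field_simps)
    then show "0 \<le> 1 - (q - p + 1) / p * ?n" by simp
  qed (use assms in auto)
  finally show ?thesis by simp
qed

lemma integrable_bx: "integrable lebesgue (indicator (bx \<epsilon>) :: _ \<Rightarrow> real)"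
  using lmeasurable_cbox[of "(0, vec (- R \<epsilon>)) :: real \<times> (real ^ 'n)"]
  by (intro integrable_real_indicator) (auto simp: bx_def cut_box_def fmeasurable_def)

lemma scale_inverse:
  assumes "\<epsilon> > 0"
  shows "1 / T \<epsilon> = \<epsilon> powr (q - 1)" "1 / R \<epsilon> = \<epsilon> powr ((q - p + 1) / p)"
proof -
  have "1 / \<epsilon> powr (- x) = \<epsilon> powr x" for x by (simp add: powr_minus inverse_eq_divide)
  then show "1 / T \<epsilon> = \<epsilon> powr (q - 1)" "1 / R \<epsilon> = \<epsilon> powr ((q - p + 1) / p)"
    unfolding T_def R_def by blast+
qed

text \<open>Stated for arbitrary non-negative \<open>B\<close> and \<open>\<beta>\<close>, so that
  both tests can use it. Of the two factors \<open>1 / T \<epsilon>\<close> one becomes a power of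
  \<epsilon>, the other one rescales the time and is bounded by \<open>\<sigma>\<close>; likewise
  for \<open>R \<epsilon>\<close> and space.\<close>

lemma cutoff_gradient_bounds:
  fixes B \<beta> :: real
  assumes \<epsilon>: "\<epsilon> > 0" and z: "z \<in> half_space" and pos: "\<zeta> \<epsilon> z > 0" and B: "B \<ge> 0" "\<beta> \<ge> 0"
  shows "- B * \<mu>t \<epsilon> z \<le> time_cutoff \<epsilon> (fst z) * (B * (2 * real k * \<epsilon> powr (q - 1) * \<zeta> \<epsilon> z powr (real k - 1) * \<sigma> \<epsilon> z))"
    and "(\<Sum>i\<in>UNIV. F i z * (\<beta> * \<mu>x \<epsilon> i z)) \<le>
      time_cutoff \<epsilon> (fst z) * (flux z * (\<beta> * (2 * real k) * \<epsilon> powr ((q - p + 1) / p) * \<zeta> \<epsilon> z powr (real k - 1) * \<sigma> \<epsilon> z))"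
    and "\<mu> \<epsilon> z = time_cutoff \<epsilon> (fst z) * \<zeta> \<epsilon> z powr real k"
    and "0 \<le> \<sigma> \<epsilon> z" "\<sigma> \<epsilon> z \<le> 1" "0 \<le> time_cutoff \<epsilon> (fst z)" "time_cutoff \<epsilon> (fst z) \<le> 1" "z \<in> bx \<epsilon>" "\<zeta> \<epsilon> z \<le> 1"
proof -
  let ?\<chi> = "time_cutoff \<epsilon> (fst z)"
  note b = bowl_pos_imp[OF pos[unfolded \<zeta>_def] TR[OF \<epsilon>]]
  show \<chi>: "0 \<le> ?\<chi>" "?\<chi> \<le> 1" by (rule time_cutoff_bounds)+
  show "0 \<le> \<sigma> \<epsilon> z" "\<sigma> \<epsilon> z \<le> 1" using b(3) by (auto simp: \<sigma>_def par_radius_nonneg)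
  show "z \<in> bx \<epsilon>" unfolding bx_def by (rule in_cut_box[OF pos[unfolded \<zeta>_def] TR[OF \<epsilon>] z])
  show "\<zeta> \<epsilon> z \<le> 1" by (simp add: \<zeta>_def bowl_bounds)
  have pk: "bowl (T \<epsilon>) (R \<epsilon>) z ^ (k - 1) = \<zeta> \<epsilon> z powr (real k - 1)" "bowl (T \<epsilon>) (R \<epsilon>) z ^ k = \<zeta> \<epsilon> z powr real k"
    using pos k2 powr_realpow[OF pos, of "k - 1"] powr_realpow[OF pos, of k] by (simp_all add: \<zeta>_def of_nat_diff)
  show "\<mu> \<epsilon> z = ?\<chi> * \<zeta> \<epsilon> z powr real k" by (simp add: \<mu>_def cutoff_def pk)
  define Z where "Z = \<zeta> \<epsilon> z powr (real k - 1)"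
  have Z: "Z \<ge> 0" by (simp add: Z_def)
  have t: "fst z > 0" using z by (auto simp: half_space_def)
  have tT: "fst z / (T \<epsilon>)\<^sup>2 \<le> \<epsilon> powr (q - 1) * \<sigma> \<epsilon> z"
  proof -
    have "fst z / (T \<epsilon>)\<^sup>2 = (1 / T \<epsilon>) * (fst z / T \<epsilon>)" by (simp add: power2_eq_square)
    also have "\<dots> \<le> (1 / T \<epsilon>) * \<sigma> \<epsilon> z"
      using b(5) t TR[OF \<epsilon>] unfolding \<sigma>_def by (intro mult_left_mono) auto
    finally show ?thesis by (simp only: scale_inverse[OF \<epsilon>])
  qed
  have "- B * \<mu>t \<epsilon> z = B * (?\<chi> * (2 * real k * Z)) * (fst z / (T \<epsilon>)\<^sup>2) - B * (time_cutoff_deriv \<epsilon> (fst z) * \<zeta> \<epsilon> z powr real k)"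
    unfolding \<mu>t_def cutoff_t_def pk Z_def[symmetric] by (simp add: algebra_simps)
  \<comment> \<open>The derivative of the time cutoff is dropped here: it is non-negative, comes
    with a minus sign, and \<open>B \<ge> 0\<close>.\<close>
  also have "\<dots> \<le> B * (?\<chi> * (2 * real k * Z)) * (fst z / (T \<epsilon>)\<^sup>2)"
    using B time_cutoff_bounds(3)[of \<epsilon> "fst z"] by simp
  also have "\<dots> \<le> B * (?\<chi> * (2 * real k * Z)) * (\<epsilon> powr (q - 1) * \<sigma> \<epsilon> z)"
    by (intro mult_left_mono tT mult_nonneg_nonneg B \<chi> Z) auto
  finally show "- B * \<mu>t \<epsilon> z \<le> ?\<chi> * (B * (2 * real k * \<epsilon> powr (q - 1) * \<zeta> \<epsilon> z powr (real k - 1) * \<sigma> \<epsilon> z))"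
    by (simp add: Z_def mult_ac)
  have xR: "norm (snd z) / (R \<epsilon>)\<^sup>2 \<le> \<epsilon> powr ((q - p + 1) / p) * \<sigma> \<epsilon> z"
  proof -
    have "norm (snd z) / (R \<epsilon>)\<^sup>2 = (1 / R \<epsilon>) * (norm (snd z) / R \<epsilon>)" by (simp add: power2_eq_square)
    also have "\<dots> \<le> (1 / R \<epsilon>) * \<sigma> \<epsilon> z"
      using b(6) TR[OF \<epsilon>] unfolding \<sigma>_def by (intro mult_left_mono) auto
    finally show ?thesis by (simp only: scale_inverse[OF \<epsilon>])
  qed
  have fx: "- (\<Sum>i\<in>UNIV. F i z * (snd z $ i)) \<le> flux z * norm (snd z)"
    using Cauchy_Schwarz_ineq2[of "\<chi> i. F i z" "snd z"] by (simp add: inner_vec_def flux_def abs_le_iff)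
  have "(\<Sum>i\<in>UNIV. F i z * (\<beta> * \<mu>x \<epsilon> i z)) = (\<beta> * (?\<chi> * (2 * real k * Z)) / (R \<epsilon>)\<^sup>2) * (- (\<Sum>i\<in>UNIV. F i z * (snd z $ i)))"
    unfolding \<mu>x_def cutoff_x_def pk Z_def[symmetric] sum_negf[symmetric] sum_distrib_left
    by (intro sum.cong refl) (simp add: field_simps)
  also have "\<dots> \<le> (\<beta> * (?\<chi> * (2 * real k * Z)) / (R \<epsilon>)\<^sup>2) * (flux z * norm (snd z))"
    by (intro mult_left_mono fx divide_nonneg_nonneg mult_nonneg_nonneg B \<chi> Z) auto
  also have "\<dots> = \<beta> * (?\<chi> * (2 * real k * Z)) * flux z * (norm (snd z) / (R \<epsilon>)\<^sup>2)" by simp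
  also have "\<dots> \<le> \<beta> * (?\<chi> * (2 * real k * Z)) * flux z * (\<epsilon> powr ((q - p + 1) / p) * \<sigma> \<epsilon> z)"
    by (intro mult_left_mono xR mult_nonneg_nonneg B \<chi> Z) (auto simp: flux_def)
  finally show "(\<Sum>i\<in>UNIV. F i z * (\<beta> * \<mu>x \<epsilon> i z)) \<le>
      ?\<chi> * (flux z * (\<beta> * (2 * real k) * \<epsilon> powr ((q - p + 1) / p) * \<zeta> \<epsilon> z powr (real k - 1) * \<sigma> \<epsilon> z))"
    by (simp add: Z_def mult_ac)
qed

lemma outside_bowl:
  assumes "\<not> \<zeta> \<epsilon> z > 0"
  shows "\<mu> \<epsilon> z = 0" "\<mu>t \<epsilon> z = 0" "\<mu>x \<epsilon> i z = 0"
proof -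
  have "bowl (T \<epsilon>) (R \<epsilon>) z = 0" using assms bowl_bounds(1)[of "T \<epsilon>" "R \<epsilon>" z] by (simp add: \<zeta>_def)
  then show "\<mu> \<epsilon> z = 0" "\<mu>t \<epsilon> z = 0" "\<mu>x \<epsilon> i z = 0"
    using k2 by (auto simp: \<mu>_def \<mu>t_def \<mu>x_def cutoff_def cutoff_t_def cutoff_x_def power_0_left)
qed

section \<open>The weighted flux estimate\<close>

lemma w_measurable: "(\<lambda>z. indicator (supp \<epsilon>) z * w z) \<in> borel_measurable lebesgue" if "\<epsilon> > 0"
  using L_loc_1_integrable[OF w S supp(1) supp(2)[OF that]] by auto

lemma integrable_weighted_flux:
  assumes "0 < \<epsilon>" "0 < \<nu>"
  shows "integrable lebesgue (\<lambda>z. flux z powr r * (w z + \<nu>) powr (- s - 1) * \<mu> \<epsilon> z)"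
proof -
  note \<mu> = \<mu>_props[OF assms(1)]
  let ?w = "\<lambda>z. indicator (supp \<epsilon>) z * w z"
  have i: "integrable lebesgue (\<lambda>z. flux z powr r * \<mu> \<epsilon> z)"
    unfolding flux_def by (rule integrable_L_loc_mult[OF flux_loc S supp(1) supp(2)[OF assms(1)] \<mu>(3) \<mu>(7)])
  \<comment> \<open>\<open>w\<close> is measurable only inside the half-space and non-negative only
    almost everywhere. Restricting it and taking \<open>max 0\<close> gives a weight that is
    measurable and bounded by \<open>\<nu> powr (- s - 1)\<close> everywhere.\<close>
  have "integrable lebesgue (\<lambda>z. (flux z powr r * \<mu> \<epsilon> z) * (max 0 (?w z) + \<nu>) powr (- s - 1))"
  proof (rule integrable_mult_bounded[OF i])
    note [measurable] = w_measurable[OF assms(1)]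
    show "(\<lambda>z. (max 0 (?w z) + \<nu>) powr (- s - 1)) \<in> borel_measurable lebesgue" by measurable
    show "\<bar>(max 0 (?w z) + \<nu>) powr (- s - 1)\<bar> \<le> \<nu> powr (- s - 1)" for z
      using assms s powr_mono2'[of "- s - 1" \<nu> "max 0 (?w z) + \<nu>"] by simp
  qed
  then show ?thesis
  proof (rule integrable_cong_AE_imp)
    have e: "AE z in lebesgue. flux z powr r * (w z + \<nu>) powr (- s - 1) * \<mu> \<epsilon> z =
      (flux z powr r * \<mu> \<epsilon> z) * (max 0 (?w z) + \<nu>) powr (- s - 1)"
      using w_nonneg
    proof eventually_elim
      case (elim z)
      then show ?case using supp(2)[OF assms(1)] \<mu>(7)[of z] by (cases "z \<in> supp \<epsilon>") (auto simp: max_def)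
    qed
    then show "AE z in lebesgue. (flux z powr r * \<mu> \<epsilon> z) * (max 0 (?w z) + \<nu>) powr (- s - 1) =
      flux z powr r * (w z + \<nu>) powr (- s - 1) * \<mu> \<epsilon> z"
      by eventually_elim (rule sym)
    note e' = this
    show "(\<lambda>z. flux z powr r * (w z + \<nu>) powr (- s - 1) * \<mu> \<epsilon> z) \<in> borel_measurable lebesgue"
      by (rule borel_measurable_AE[OF borel_measurable_integrable[OF \<open>integrable lebesgue (\<lambda>z. (flux z powr r * \<mu> \<epsilon> z) * (max 0 (?w z) + \<nu>) powr (- s - 1))\<close>]])
         (rule e')
  qed
qed

text \<open>Integrating the pointwise bound produces \<epsilon>^(q-s) times the volume of the box;
  the factor \<epsilon>^s completes this to the product in \<open>volume_bound\<close>. Uniformity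
  in \<nu> is what later allows \<nu> to be coupled to \<eta>.\<close>

lemma first_estimate:
  "\<exists>C\<ge>0. \<forall>\<epsilon> \<nu>. 0 < \<epsilon> \<and> \<epsilon> \<le> 1 \<and> 0 < \<nu> \<and> \<nu> \<le> \<epsilon> \<longrightarrow>
    \<epsilon> powr s * (LINT z|lebesgue. flux z powr r * (w z + \<nu>) powr (- s - 1) * \<mu> \<epsilon> z) \<le> C"
proof -
  obtain C where C: "C \<ge> 0" and pw: "\<And>\<epsilon> \<nu> w \<zeta> f. 0 < \<epsilon> \<Longrightarrow> 0 < \<nu> \<Longrightarrow> \<nu> \<le> \<epsilon> \<Longrightarrow> w \<ge> 0 \<Longrightarrow> 0 < \<zeta> \<Longrightarrow> \<zeta> \<le> 1 \<Longrightarrow> f \<ge> 0 \<Longrightarrow>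
    f * ((w + \<nu>) powr (- s) * (2 * real k) * \<epsilon> powr ((q - p + 1) / p) * \<zeta> powr (real k - 1))
    + (w + \<nu>) powr (1 - s) / (1 - s) * (2 * real k * \<epsilon> powr (q - 1) * \<zeta> powr (real k - 1))
    - s * c0 * (f powr r * (w + \<nu>) powr (- s - 1) * \<zeta> powr real k)
    - c1 * (w powr q * (w + \<nu>) powr (- s) * \<zeta> powr real k)
    \<le> C * \<epsilon> powr (q - s) - s * c0 / 2 * (f powr r * (w + \<nu>) powr (- s - 1) * \<zeta> powr real k)"
    using first_estimate_pointwise by blast
  have s1: "s < 1" using s p by linarith
  show ?thesis
  proof (intro exI[of _ "C * 2 ^ CARD('n) / (s * c0 / 2)"] conjI allI impI)
    show "0 \<le> C * 2 ^ CARD('n) / (s * c0 / 2)" using C s c by simp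
    fix \<epsilon> \<nu> :: real assume "0 < \<epsilon> \<and> \<epsilon> \<le> 1 \<and> 0 < \<nu> \<and> \<nu> \<le> \<epsilon>"
    then have h: "0 < \<epsilon>" "\<epsilon> \<le> 1" "0 < \<nu>" "\<nu> \<le> \<epsilon>" by auto
    note \<mu> = \<mu>_props[OF h(1)]
    define B where "B x = (x + \<nu>) powr (1 - s) / (1 - s)" for x
    define \<beta> where "\<beta> x = (x + \<nu>) powr (- s)" for x
    define \<beta>' where "\<beta>' x = - s * (x + \<nu>) powr (- s - 1)" for x
    \<comment> \<open>\<open>M\<close> blows up as \<nu> tends to 0. It serves only to verify the
      growth hypotheses of \<open>energy_inequality\<close>, which are qualitative.\<close>
    define M where "M = 2 / (1 - s) + \<nu> powr (- s) + s * \<nu> powr (- s - 1)"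
    have Mb: "M \<ge> 2 / (1 - s)" "M \<ge> \<nu> powr (- s)" "M \<ge> s * \<nu> powr (- s - 1)"
      using s s1 by (auto simp: M_def)
    have "M \<ge> 0" using Mb(2) powr_ge_zero[of \<nu> "- s"] by linarith
    define Y where "Y z = flux z powr r * (w z + \<nu>) powr (- s - 1) * \<mu> \<epsilon> z" for z
    define G where "G z = - B (w z) * \<mu>t \<epsilon> z + (\<Sum>i\<in>UNIV. F i z * (\<beta>' (w z) * X i z * \<mu> \<epsilon> z + \<beta> (w z) * \<mu>x \<epsilon> i z)) - g z * \<beta> (w z) * \<mu> \<epsilon> z" for z
    have G: "integrable lebesgue G" "0 \<le> (LINT z|lebesgue. G z)"
    proof -
      have 1: "(B has_real_derivative \<beta> x) (at x)" if "x \<ge> 0" for x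
      proof -
        have "((\<lambda>x. (x + \<nu>) powr (1 - s)) has_real_derivative (1 - s) * (x + \<nu>) powr (- s)) (at x)"
          using that h by (auto intro!: derivative_eq_intros)
        from DERIV_cdivide[OF this, of "1 - s"] show ?thesis
          using s1 by (simp add: B_def[abs_def] \<beta>_def)
      qed
      have 2: "(\<beta> has_real_derivative \<beta>' x) (at x)" if "x \<ge> 0" for x
        unfolding \<beta>_def[abs_def] \<beta>'_def using that h
        by (auto intro!: derivative_eq_intros)
      have 3: "continuous_on {0..} \<beta>'"
        unfolding \<beta>'_def[abs_def] using h by (intro continuous_intros) auto
      have 4: "\<beta> x \<ge> 0" for x by (simp add: \<beta>_def)
      have 5: "\<beta> x \<le> M" if "x \<ge> 0" for x
        using that h s powr_mono2'[of "- s" \<nu> "x + \<nu>"] Mb(2) by (simp add: \<beta>_def)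
      have 6: "\<bar>\<beta>' x\<bar> \<le> M" if "x \<ge> 0" for x
      proof -
        have "s * (x + \<nu>) powr (- s - 1) \<le> s * \<nu> powr (- s - 1)"
          using that h s powr_mono2'[of "- s - 1" \<nu> "x + \<nu>"] by (intro mult_left_mono) auto
        also have "\<dots> \<le> M" by (rule Mb(3))
        finally show ?thesis using s by (simp add: \<beta>'_def abs_mult)
      qed
      have 7: "\<bar>B x\<bar> \<le> M * (1 + x)" if "x \<ge> 0" for x
      proof -
        have "(x + \<nu>) powr (1 - s) \<le> (2 * (1 + x)) powr (1 - s)"
          using that h s1 by (intro powr_mono2) auto
        also have "\<dots> \<le> (2 * (1 + x)) powr 1" using that s by (intro powr_mono) auto
        finally have "(x + \<nu>) powr (1 - s) / (1 - s) \<le> 2 * (1 + x) / (1 - s)"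
          using that s1 by (intro divide_right_mono) auto
        also have "\<dots> \<le> M * (1 + x)" using mult_right_mono[OF Mb(1), of "1 + x"] that by simp
        finally show ?thesis using s1 by (simp add: B_def)
      qed
      show "integrable lebesgue G" "0 \<le> (LINT z|lebesgue. G z)"
        using energy_inequality[OF supp(1) supp(2)[OF h(1)] 1 2 3 4 \<open>M \<ge> 0\<close> 7 5 6 \<mu>]
        by (simp_all add: G_def[abs_def])
    qed
    have iY: "integrable lebesgue Y" unfolding Y_def by (rule integrable_weighted_flux[OF h(1,3)])
    have "AE z in lebesgue. G z \<le> C * \<epsilon> powr (q - s) * indicator (bx \<epsilon>) z - s * c0 / 2 * Y z"
      using w_nonneg
    proof eventually_elim
      case (elim z)
      show ?case
      proof (cases "z \<in> half_space \<and> \<zeta> \<epsilon> z > 0")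
        case False
        have "\<mu> \<epsilon> z = 0 \<and> \<mu>t \<epsilon> z = 0 \<and> (\<forall>i. \<mu>x \<epsilon> i z = 0)"
        proof (cases "z \<in> half_space")
          case True
          then show ?thesis using False outside_bowl by blast
        next
          case False
          then have "z \<notin> supp \<epsilon>" using supp(2)[OF h(1)] by blast
          then show ?thesis using \<mu>(7-9) by blast
        qed
        then show ?thesis using C by (simp add: G_def Y_def)
      next
        case True
        then have z: "z \<in> half_space" "\<zeta> \<epsilon> z > 0" by auto
        have wz: "w z \<ge> 0" using elim z by simp
        define \<kappa> where "\<kappa> = time_cutoff \<epsilon> (fst z)"
        define Z where "Z = \<zeta> \<epsilon> z"
        have B0: "B (w z) \<ge> 0" "\<beta> (w z) \<ge> 0" using s1 by (auto simp: B_def \<beta>_def)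
        note cb = cutoff_gradient_bounds[OF h(1) z(1) z(2) B0(1) B0(2), folded \<kappa>_def Z_def]
        have Z: "Z > 0" "Z \<le> 1" using z cb(9) by (auto simp: Z_def)
        have f0: "flux z \<ge> 0" by (simp add: flux_def)
        have 1: "(\<Sum>i\<in>UNIV. F i z * (\<beta>' (w z) * X i z * \<mu> \<epsilon> z + \<beta> (w z) * \<mu>x \<epsilon> i z)) =
          (\<Sum>i\<in>UNIV. F i z * (\<beta> (w z) * \<mu>x \<epsilon> i z)) - s * (w z + \<nu>) powr (- s - 1) * \<mu> \<epsilon> z * (\<Sum>i\<in>UNIV. F i z * X i z)"
          unfolding sum_distrib_left sum_subtractf[symmetric]
          by (intro sum.cong refl) (simp add: \<beta>'_def algebra_simps)
        have 2: "s * (w z + \<nu>) powr (- s - 1) * \<mu> \<epsilon> z * (c0 * flux z powr r) \<le> s * (w z + \<nu>) powr (- s - 1) * \<mu> \<epsilon> z * (\<Sum>i\<in>UNIV. F i z * X i z)"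
          using s \<mu>(6) coercive[of z] unfolding flux_def by (intro mult_left_mono) auto
        have 3: "c1 * w z powr q * \<beta> (w z) * \<mu> \<epsilon> z \<le> g z * \<beta> (w z) * \<mu> \<epsilon> z"
          using source[OF wz] wz B0 \<mu>(6) by (intro mult_right_mono) auto
        \<comment> \<open>The gain \<open>\<sigma> \<epsilon> z\<close> is given up, being at most
          1: the first estimate aims at a bound and not at smallness.\<close>
        have "\<kappa> * (B (w z) * (2 * real k * \<epsilon> powr (q - 1) * Z powr (real k - 1) * \<sigma> \<epsilon> z)) \<le>
          \<kappa> * (B (w z) * (2 * real k * \<epsilon> powr (q - 1) * Z powr (real k - 1) * 1))"
          using cb B0 by (intro mult_left_mono) auto
        note order_trans[OF cb(1) this]
        then have 4: "- B (w z) * \<mu>t \<epsilon> z \<le> \<kappa> * (B (w z) * (2 * real k * \<epsilon> powr (q - 1) * Z powr (real k - 1)))"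
          by (simp only: mult_1_right)
        have "\<kappa> * (flux z * (\<beta> (w z) * (2 * real k) * \<epsilon> powr ((q - p + 1) / p) * Z powr (real k - 1) * \<sigma> \<epsilon> z)) \<le>
           \<kappa> * (flux z * (\<beta> (w z) * (2 * real k) * \<epsilon> powr ((q - p + 1) / p) * Z powr (real k - 1) * 1))"
          using cb B0 f0 by (intro mult_left_mono) auto
        note order_trans[OF cb(2) this]
        then have 5: "(\<Sum>i\<in>UNIV. F i z * (\<beta> (w z) * \<mu>x \<epsilon> i z)) \<le> \<kappa> * (flux z * (\<beta> (w z) * (2 * real k) * \<epsilon> powr ((q - p + 1) / p) * Z powr (real k - 1)))"
          by (simp only: mult_1_right)
        have 6: "\<kappa> * (flux z * (\<beta> (w z) * (2 * real k) * \<epsilon> powr ((q - p + 1) / p) * Z powr (real k - 1))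
            + B (w z) * (2 * real k * \<epsilon> powr (q - 1) * Z powr (real k - 1))
            - s * c0 * (flux z powr r * (w z + \<nu>) powr (- s - 1) * Z powr real k)
            - c1 * (w z powr q * \<beta> (w z) * Z powr real k))
          \<le> \<kappa> * (C * \<epsilon> powr (q - s) - s * c0 / 2 * (flux z powr r * (w z + \<nu>) powr (- s - 1) * Z powr real k))"
          unfolding B_def \<beta>_def using pw[OF h(1) h(3,4) wz Z f0] cb(6) by (rule mult_left_mono)
        have 7: "\<kappa> * (C * \<epsilon> powr (q - s)) \<le> 1 * (C * \<epsilon> powr (q - s))"
          using C cb by (intro mult_right_mono) auto
        have "G z \<le> C * \<epsilon> powr (q - s) - s * c0 / 2 * Y z"
          using 1 2 3 4 5 6 7 unfolding G_def Y_def cb(3) by (simp add: algebra_simps)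
        then show ?thesis using cb(8) by simp
      qed
    qed
    then have "(LINT z|lebesgue. G z) \<le> (LINT z|lebesgue. C * \<epsilon> powr (q - s) * indicator (bx \<epsilon>) z - s * c0 / 2 * Y z)"
      by (intro integral_mono_AE G Bochner_Integration.integrable_diff integrable_mult_right integrable_bx iY)
    also have "\<dots> = C * \<epsilon> powr (q - s) * measure lebesgue (bx \<epsilon>) - s * c0 / 2 * (LINT z|lebesgue. Y z)"
      using iY integrable_bx by (subst Bochner_Integration.integral_diff) auto
    finally have "s * c0 / 2 * (LINT z|lebesgue. Y z) \<le> C * (\<epsilon> powr (q - s) * measure lebesgue (bx \<epsilon>))" using G by simp
    then have "\<epsilon> powr s * (s * c0 / 2 * (LINT z|lebesgue. Y z)) \<le> \<epsilon> powr s * (C * (\<epsilon> powr (q - s) * measure lebesgue (bx \<epsilon>)))"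
      by (intro mult_left_mono) auto
    also have "\<dots> = C * ((\<epsilon> powr s * \<epsilon> powr (q - s)) * measure lebesgue (bx \<epsilon>))" by simp
    also have "\<epsilon> powr s * \<epsilon> powr (q - s) = \<epsilon> powr q" by (simp add: powr_add[symmetric])
    also have "C * (\<epsilon> powr q * measure lebesgue (bx \<epsilon>)) \<le> C * 2 ^ CARD('n)"
      using C volume_bound[OF h(1,2)] by (intro mult_left_mono)
    finally have "(\<epsilon> powr s * (LINT z|lebesgue. Y z)) * (s * c0 / 2) \<le> C * 2 ^ CARD('n)" by (simp add: mult_ac)
    moreover have "s * c0 / 2 > 0" using s c by simp
    ultimately show "\<epsilon> powr s * (LINT z|lebesgue. flux z powr r * (w z + \<nu>) powr (- s - 1) * \<mu> \<epsilon> z) \<le> C * 2 ^ CARD('n) / (s * c0 / 2)"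
      unfolding Y_def by (simp only: pos_le_divide_eq)
  qed
qed

end

section \<open>Bound of the source integral and passage to the limit\<close>

context comparison
begin

lemma integrable_source:
  assumes "0 < \<epsilon>"
  shows "integrable lebesgue (\<lambda>z. \<bar>w z\<bar> powr q * \<mu> \<epsilon> z)"
    and "integrable lebesgue (\<lambda>z. \<bar>w z\<bar> powr q * (\<sigma> \<epsilon> z * \<mu> \<epsilon> z))"
proof -
  note \<mu> = \<mu>_props[OF assms]
  show "integrable lebesgue (\<lambda>z. \<bar>w z\<bar> powr q * \<mu> \<epsilon> z)"
    by (rule integrable_L_loc_mult[OF source_loc S supp(1) supp(2)[OF assms] \<mu>(3) \<mu>(7)])
  have "continuous_on UNIV (\<lambda>z. \<sigma> \<epsilon> z * \<mu> \<epsilon> z)"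
    unfolding \<sigma>_def by (intro continuous_intros continuous_par_radius \<mu>(3))
  then show "integrable lebesgue (\<lambda>z. \<bar>w z\<bar> powr q * (\<sigma> \<epsilon> z * \<mu> \<epsilon> z))"
    by (rule integrable_L_loc_mult[OF source_loc S supp(1) supp(2)[OF assms]]) (simp add: \<mu>(7))
qed

definition I :: "real \<Rightarrow> real" where "I \<epsilon> = (LINT z|lebesgue. \<bar>w z\<bar> powr q * \<mu> \<epsilon> z)"
text \<open>The source weighted by \<open>\<sigma>\<close>. Before integrability of the source is
  known, \<open>J\<close> is controlled by \<open>I\<close>; afterwards it tends to 0 with
  \<epsilon>.\<close>

definition J :: "real \<Rightarrow> real" where "J \<epsilon> = (LINT z|lebesgue. \<bar>w z\<bar> powr q * (\<sigma> \<epsilon> z * \<mu> \<epsilon> z))"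

text \<open>Testing with the cutoff alone leaves the flux without a coercive partner. It is paid for
  by the first estimate at the value \<eta>^(p/a) \<epsilon> of \<nu>, which is at most \<epsilon>
  since \<open>\<eta> \<le> 1\<close>.\<close>

lemma second_estimate:
  "\<exists>C>0. \<forall>\<eta> A \<epsilon>. 0 < \<eta> \<and> \<eta> \<le> 1 \<and> 0 < A \<and> 0 < \<epsilon> \<and> \<epsilon> \<le> 1 \<longrightarrow>
    I \<epsilon> \<le> C * (\<eta> + \<eta> powr (1 - p) * (A powr (- (a / (q - a))) + A powr (- (1 / (q - 1))))) + C * \<eta> powr (1 - p) * A * J \<epsilon>"
proof -
  obtain C1 where C1: "C1 \<ge> 0" "\<And>\<epsilon> \<nu>. 0 < \<epsilon> \<Longrightarrow> \<epsilon> \<le> 1 \<Longrightarrow> 0 < \<nu> \<Longrightarrow> \<nu> \<le> \<epsilon> \<Longrightarrow>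
    \<epsilon> powr s * (LINT z|lebesgue. flux z powr r * (w z + \<nu>) powr (- s - 1) * \<mu> \<epsilon> z) \<le> C1"
    using first_estimate by blast
  obtain C where C: "C > 0" and pw: "\<And>\<eta> A \<epsilon> w \<zeta> m f. 0 < \<eta> \<Longrightarrow> \<eta> \<le> 1 \<Longrightarrow> A > 0 \<Longrightarrow> 0 < \<epsilon> \<Longrightarrow> w \<ge> 0 \<Longrightarrow>
      0 < \<zeta> \<Longrightarrow> \<zeta> \<le> 1 \<Longrightarrow> 0 \<le> m \<Longrightarrow> m \<le> 1 \<Longrightarrow> f \<ge> 0 \<Longrightarrow>
    f * ((2 * real k) * \<epsilon> powr ((q - p + 1) / p) * \<zeta> powr (real k - 1) * m)
    + w * (2 * real k * \<epsilon> powr (q - 1) * \<zeta> powr (real k - 1) * m)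
    \<le> \<eta> * \<epsilon> powr s * (f powr r * (w + \<eta> powr (p / a) * \<epsilon>) powr (- s - 1) * \<zeta> powr real k)
      + C * \<eta> powr (1 - p) * A * (m * (w powr q * \<zeta> powr real k))
      + C * (\<eta> + \<eta> powr (1 - p) * (A powr (- (a / (q - a))) + A powr (- (1 / (q - 1))))) * \<epsilon> powr q"
    using second_estimate_pointwise by blast
  define C2 where "C2 = (C1 + C * 2 ^ CARD('n) + C) / c1"
  have C2: "C2 > 0" using C C1 c by (auto simp: C2_def intro!: divide_pos_pos add_nonneg_pos)
  show ?thesis
  proof (intro exI[of _ C2] conjI allI impI)
    fix \<eta> A \<epsilon> :: real assume "0 < \<eta> \<and> \<eta> \<le> 1 \<and> 0 < A \<and> 0 < \<epsilon> \<and> \<epsilon> \<le> 1"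
    then have h: "0 < \<eta>" "\<eta> \<le> 1" "0 < A" "0 < \<epsilon>" "\<epsilon> \<le> 1" by auto
    note \<mu> = \<mu>_props[OF h(4)]
    define \<nu> where "\<nu> = \<eta> powr (p / a) * \<epsilon>"
    have \<nu>: "0 < \<nu>" "\<nu> \<le> \<epsilon>"
    proof -
      show "0 < \<nu>" using h by (simp add: \<nu>_def)
      have "\<eta> powr (p / a) \<le> 1" using h p a by (intro powr_le1) auto
      then have "\<eta> powr (p / a) * \<epsilon> \<le> 1 * \<epsilon>" using h by (intro mult_right_mono) auto
      then show "\<nu> \<le> \<epsilon>" by (simp add: \<nu>_def)
    qed
    define E where "E = \<eta> + \<eta> powr (1 - p) * (A powr (- (a / (q - a))) + A powr (- (1 / (q - 1))))"
    have E: "E \<ge> \<eta>" unfolding E_def by simp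
    define Y where "Y z = flux z powr r * (w z + \<nu>) powr (- s - 1) * \<mu> \<epsilon> z" for z
    define V where "V z = \<bar>w z\<bar> powr q * \<mu> \<epsilon> z" for z
    define U where "U z = \<bar>w z\<bar> powr q * (\<sigma> \<epsilon> z * \<mu> \<epsilon> z)" for z
    define G where "G z = - w z * \<mu>t \<epsilon> z + (\<Sum>i\<in>UNIV. F i z * (0 * X i z * \<mu> \<epsilon> z + 1 * \<mu>x \<epsilon> i z)) - g z * 1 * \<mu> \<epsilon> z" for z
    have G: "integrable lebesgue G" "0 \<le> (LINT z|lebesgue. G z)"
      \<comment> \<open>\<open>B x = x\<close>, \<open>\<beta> = 1\<close> and
        \<open>\<beta>' = 0\<close> encode the test without a factor depending on
        \<open>w\<close>.\<close>
      using energy_inequality[OF supp(1) supp(2)[OF h(4)], of "\<lambda>x. x" "\<lambda>x. 1" "\<lambda>x. 0" 1, OF _ _ _ _ _ _ _ _ \<mu>]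
      by (simp_all add: G_def[abs_def])
    have iY: "integrable lebesgue Y" unfolding Y_def by (rule integrable_weighted_flux[OF h(4) \<nu>(1)])
    have iV: "integrable lebesgue V" unfolding V_def by (rule integrable_source(1)[OF h(4)])
    have iU: "integrable lebesgue U" unfolding U_def by (rule integrable_source(2)[OF h(4)])
    define L where "L = C * \<eta> powr (1 - p) * A"
    have L: "L \<ge> 0" using C h by (simp add: L_def)
    have "AE z in lebesgue. G z \<le> \<eta> * \<epsilon> powr s * Y z + L * U z + C * E * \<epsilon> powr q * indicator (bx \<epsilon>) z - c1 * V z"
      using w_nonneg
    proof eventually_elim
      case (elim z)
      show ?case
      proof (cases "z \<in> half_space \<and> \<zeta> \<epsilon> z > 0")
        case False
        have "\<mu> \<epsilon> z = 0 \<and> \<mu>t \<epsilon> z = 0 \<and> (\<forall>i. \<mu>x \<epsilon> i z = 0)"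
        proof (cases "z \<in> half_space")
          case True
          then show ?thesis using False outside_bowl by blast
        next
          case False
          then have "z \<notin> supp \<epsilon>" using supp(2)[OF h(4)] by blast
          then show ?thesis using \<mu>(7-9) by blast
        qed
        then show ?thesis using C E h by (simp add: G_def Y_def U_def V_def)
      next
        case True
        then have z: "z \<in> half_space" "\<zeta> \<epsilon> z > 0" by auto
        have wz: "w z \<ge> 0" using elim z by simp
        define \<kappa> where "\<kappa> = time_cutoff \<epsilon> (fst z)"
        define Z where "Z = \<zeta> \<epsilon> z"
        note cb = cutoff_gradient_bounds[OF h(4) z(1) z(2) wz zero_le_one, folded \<kappa>_def Z_def]
        have Z: "Z > 0" "Z \<le> 1" using z cb(9) by (auto simp: Z_def)
        have f0: "flux z \<ge> 0" by (simp add: flux_def)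
        have 3: "c1 * V z \<le> g z * \<mu> \<epsilon> z"
          using mult_right_mono[OF source[OF wz] \<mu>(6)[of z]] by (simp add: V_def mult.assoc)
        have "\<kappa> * (flux z * ((2 * real k) * \<epsilon> powr ((q - p + 1) / p) * Z powr (real k - 1) * \<sigma> \<epsilon> z)
            + w z * (2 * real k * \<epsilon> powr (q - 1) * Z powr (real k - 1) * \<sigma> \<epsilon> z))
          \<le> \<kappa> * (\<eta> * \<epsilon> powr s * (flux z powr r * (w z + \<nu>) powr (- s - 1) * Z powr real k)
            + L * (\<sigma> \<epsilon> z * (w z powr q * Z powr real k)) + C * E * \<epsilon> powr q)"
          using pw[OF h(1-4) wz Z cb(4,5) f0] cb(6) unfolding \<nu>_def L_def E_def by (rule mult_left_mono)
        also have "\<dots> = \<eta> * \<epsilon> powr s * Y z + L * U z + \<kappa> * (C * E * \<epsilon> powr q)"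
          using wz by (simp add: Y_def U_def cb(3) algebra_simps)
        also have "\<kappa> * (C * E * \<epsilon> powr q) \<le> 1 * (C * E * \<epsilon> powr q)"
          using C E h cb by (intro mult_right_mono) auto
        finally have 6: "\<kappa> * (flux z * ((2 * real k) * \<epsilon> powr ((q - p + 1) / p) * Z powr (real k - 1) * \<sigma> \<epsilon> z))
            + \<kappa> * (w z * (2 * real k * \<epsilon> powr (q - 1) * Z powr (real k - 1) * \<sigma> \<epsilon> z))
            \<le> \<eta> * \<epsilon> powr s * Y z + L * U z + C * E * \<epsilon> powr q" by (simp add: distrib_left)
        have "G z \<le> \<eta> * \<epsilon> powr s * Y z + L * U z + C * E * \<epsilon> powr q - c1 * V z"
          using 3 6 cb(1,2) unfolding G_def by simp
        then show ?thesis using cb(8) by simp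
      qed
    qed
    then have "(LINT z|lebesgue. G z) \<le> (LINT z|lebesgue. \<eta> * \<epsilon> powr s * Y z + L * U z + C * E * \<epsilon> powr q * indicator (bx \<epsilon>) z - c1 * V z)"
      by (intro integral_mono_AE G Bochner_Integration.integrable_diff Bochner_Integration.integrable_add integrable_mult_right integrable_bx iY iV iU)
    also have "\<dots> = \<eta> * \<epsilon> powr s * (LINT z|lebesgue. Y z) + L * (LINT z|lebesgue. U z) + C * E * \<epsilon> powr q * measure lebesgue (bx \<epsilon>) - c1 * (LINT z|lebesgue. V z)"
      using iY iV iU integrable_bx[of \<epsilon>] by simp
    finally have "c1 * I \<epsilon> \<le> \<eta> * (\<epsilon> powr s * (LINT z|lebesgue. Y z)) + L * J \<epsilon> + C * E * (\<epsilon> powr q * measure lebesgue (bx \<epsilon>))"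
      using G by (simp add: I_def J_def U_def V_def mult.assoc)
    also have "\<dots> \<le> E * C1 + L * J \<epsilon> + C * E * 2 ^ CARD('n)"
    proof (intro add_mono order_refl)
      have "\<eta> * (\<epsilon> powr s * (LINT z|lebesgue. Y z)) \<le> \<eta> * C1"
        unfolding Y_def using h C1(2)[OF h(4,5) \<nu>] by (intro mult_left_mono) auto
      also have "\<dots> \<le> E * C1" using E C1 by (intro mult_right_mono) auto
      finally show "\<eta> * (\<epsilon> powr s * (LINT z|lebesgue. Y z)) \<le> E * C1" .
      show "C * E * (\<epsilon> powr q * measure lebesgue (bx \<epsilon>)) \<le> C * E * 2 ^ CARD('n)"
        using C E h volume_bound[OF h(4,5)] by (intro mult_left_mono mult_nonneg_nonneg) auto
    qed
    also have "\<dots> \<le> c1 * (C2 * E + C2 * \<eta> powr (1 - p) * A * J \<epsilon>)"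
    proof -
      have J: "J \<epsilon> \<ge> 0"
        unfolding J_def using \<mu>(6) by (intro Bochner_Integration.integral_nonneg) (auto simp: \<sigma>_def par_radius_nonneg)
      have c2: "c1 * C2 = C1 + C * 2 ^ CARD('n) + C" using c by (simp add: C2_def)
      define H where "H = \<eta> powr (1 - p) * A * J \<epsilon>"
      have H: "H \<ge> 0" using h J by (simp add: H_def)
      have "E * C1 + C * H + C * E * 2 ^ CARD('n) \<le> (C1 + C * 2 ^ CARD('n) + C) * (E + H)"
      proof -
        have "0 \<le> C1 * H + C * 2 ^ CARD('n) * H + C * E" using C C1 H E h by (intro add_nonneg_nonneg mult_nonneg_nonneg) auto
        then show ?thesis by (simp add: algebra_simps)
      qed
      then show ?thesis unfolding c2[symmetric] L_def H_def by (simp add: algebra_simps)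
    qed
    finally show "I \<epsilon> \<le> C2 * (\<eta> + \<eta> powr (1 - p) * (A powr (- (a / (q - a))) + A powr (- (1 / (q - 1))))) + C2 * \<eta> powr (1 - p) * A * J \<epsilon>"
      using c by (simp add: E_def)
  qed (rule C2)
qed

lemma J_le_I: "\<epsilon> > 0 \<Longrightarrow> J \<epsilon> \<le> I \<epsilon>"
proof -
  assume e: "\<epsilon> > 0"
  note \<mu> = \<mu>_props[OF e]
  show "J \<epsilon> \<le> I \<epsilon>"
    unfolding I_def J_def
  proof (intro integral_mono integrable_source e mult_left_mono)
    fix z
    show "\<sigma> \<epsilon> z * \<mu> \<epsilon> z \<le> \<mu> \<epsilon> z"
    proof (cases "\<zeta> \<epsilon> z > 0")
      case True
      then have "\<sigma> \<epsilon> z \<le> 1"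
        using bowl_pos_imp(3)[OF True[unfolded \<zeta>_def] TR[OF e]] by (simp add: \<sigma>_def)
      then have "\<sigma> \<epsilon> z * \<mu> \<epsilon> z \<le> 1 * \<mu> \<epsilon> z" using \<mu>(6) by (intro mult_right_mono) auto
      then show ?thesis by simp
    qed (simp add: outside_bowl)
  qed auto
qed

text \<open>The second estimate is used twice. With \<eta> and \<open>A\<close> fixed it bounds
  \<open>I\<close> uniformly, hence w^q is integrable and \<open>J\<close> tends to 0. With \<eta>
  and \<open>A\<close> free it then forces the integral of w^q to be 0.\<close>

lemma vanishes: "AE z in lebesgue. z \<in> half_space \<longrightarrow> w z = 0"
proof -
  obtain C where C: "C > 0" and est: "\<And>\<eta> A \<epsilon>. 0 < \<eta> \<Longrightarrow> \<eta> \<le> 1 \<Longrightarrow> 0 < A \<Longrightarrow> 0 < \<epsilon> \<Longrightarrow> \<epsilon> \<le> 1 \<Longrightarrow>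
    I \<epsilon> \<le> C * (\<eta> + \<eta> powr (1 - p) * (A powr (- (a / (q - a))) + A powr (- (1 / (q - 1))))) + C * \<eta> powr (1 - p) * A * J \<epsilon>"
    using second_estimate by blast
  \<comment> \<open>For \<open>\<eta> = 1\<close> and \<open>A = 1 / (2 * C)\<close> the last term
    is half of \<open>J\<close>, hence at most half of \<open>I\<close>, and is absorbed;
    \<open>D\<close> is twice the remaining constant.\<close>
  define D where "D = 2 * (C * (1 + 1 * ((1 / (2 * C)) powr (- (a / (q - a))) + (1 / (2 * C)) powr (- (1 / (q - 1))))))"
  have ID: "I \<epsilon> \<le> D" if "0 < \<epsilon>" "\<epsilon> \<le> 1" for \<epsilon>
  proof -
    have "I \<epsilon> \<le> D / 2 + C * 1 * (1 / (2 * C)) * J \<epsilon>"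
      using est[of 1 "1 / (2 * C)" \<epsilon>] C that by (simp add: D_def)
    also have "\<dots> \<le> D / 2 + I \<epsilon> / 2" using C J_le_I[OF that(1)] by simp
    finally show ?thesis by simp
  qed
  define e where "e n = 1 / real (Suc n)" for n
  have e: "e n > 0" "e n \<le> 1" for n by (auto simp: e_def)
  have e0: "e \<longlonglongrightarrow> 0" unfolding e_def by (rule LIMSEQ_Suc[OF lim_inverse_n'[unfolded inverse_eq_divide]])

  have pinf: "filterlim (\<lambda>n. e n powr (- c)) at_top sequentially" if c: "c > 0" for c :: real
  proof -
    have "filterlim (\<lambda>n. real (Suc n) powr c) at_top sequentially"
      unfolding filterlim_at_top
    proof
      fix Z :: real
      obtain N :: nat where N: "\<bar>Z\<bar> powr (1 / c) \<le> real N" using real_arch_simple by blast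
      show "eventually (\<lambda>n. Z \<le> real (Suc n) powr c) sequentially"
      proof (rule eventually_sequentiallyI)
        fix n assume "n \<ge> N"
        then have "\<bar>Z\<bar> powr (1 / c) \<le> real (Suc n)" using N by linarith
        then have "(\<bar>Z\<bar> powr (1 / c)) powr c \<le> real (Suc n) powr c" using c by (intro powr_mono2) auto
        then have "\<bar>Z\<bar> \<le> real (Suc n) powr c" using c by (simp add: powr_powr)
        then show "Z \<le> real (Suc n) powr c" by linarith
      qed
    qed
    moreover have "e n powr (- c) = real (Suc n) powr c" for n
      by (simp add: e_def powr_divide powr_minus)
    ultimately show ?thesis by simp
  qed
  have Tinf: "filterlim (\<lambda>n. T (e n)) at_top sequentially" unfolding T_def by (rule pinf) (use q in auto)
  have Rinf: "filterlim (\<lambda>n. R (e n)) at_top sequentially" unfolding R_def by (rule pinf) (use q p in auto)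
  define h where "h z = indicator half_space z * \<bar>w z\<bar> powr q" for z
  have hm: "h \<in> borel_measurable lebesgue"
    unfolding h_def by (rule L_loc_measurable[OF source_loc S])
  have \<mu>0: "\<mu> (e n) z = 0" if "z \<notin> half_space" for n z
    using \<mu>_props(7)[OF e(1)] supp(2)[OF e(1)] that by blast
  have \<mu>lim: "(\<lambda>n. \<mu> (e n) z) \<longlonglongrightarrow> 1" "(\<lambda>n. \<sigma> (e n) z) \<longlonglongrightarrow> 0" if "z \<in> half_space" for z
  proof -
    note l = cutoff_tendsto_1[OF that Tinf Rinf e0]
    show "(\<lambda>n. \<mu> (e n) z) \<longlonglongrightarrow> 1" unfolding \<mu>_def by (rule l)
    show "(\<lambda>n. \<sigma> (e n) z) \<longlonglongrightarrow> 0" unfolding \<sigma>_def using tendsto_real_sqrt[OF l(2)] by simp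
  qed
  have \<mu>1: "\<mu> \<epsilon> z \<le> 1" for \<epsilon> z
    using mult_le_one[OF time_cutoff_bounds(2) zero_le_power[OF bowl_bounds(1)] power_le_one[OF bowl_bounds]]
    by (simp add: \<mu>_def cutoff_def)
  have s1: "\<sigma> (e n) z * \<mu> (e n) z \<le> 1" for n z
  proof (cases "\<zeta> (e n) z > 0")
    case True
    then have "\<sigma> (e n) z \<le> 1"
      using bowl_pos_imp(3)[OF True[unfolded \<zeta>_def] TR[OF e(1)]] by (simp add: \<sigma>_def)
    then show ?thesis using \<mu>1 \<mu>_props(6)[OF e(1)] by (intro mult_le_one) auto
  qed (simp add: outside_bowl)
  have heq: "\<bar>w z\<bar> powr q * \<mu> (e n) z = h z * \<mu> (e n) z" for n z
    by (cases "z \<in> half_space") (simp_all add: h_def \<mu>0)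
  have hlim: "(\<lambda>n. h z * \<mu> (e n) z) \<longlonglongrightarrow> h z" for z
    using tendsto_mult[OF tendsto_const \<mu>lim(1), of z "h z"] by (cases "z \<in> half_space") (auto simp: h_def)
  have ih: "integrable lebesgue h"
  proof (rule integrableI_bounded[OF hm])
    \<comment> \<open>Fatou's lemma turns the uniform bound on \<open>I\<close> into integrability
      of \<open>h\<close>, the majorant for the two dominated limits that follow.\<close>
    have "(\<integral>\<^sup>+z. ennreal (norm (h z)) \<partial>lebesgue) = (\<integral>\<^sup>+z. liminf (\<lambda>n. ennreal (h z * \<mu> (e n) z)) \<partial>lebesgue)"
    proof (rule nn_integral_cong)
      fix z
      have "(\<lambda>n. ennreal (h z * \<mu> (e n) z)) \<longlonglongrightarrow> ennreal (h z)" by (rule tendsto_ennrealI[OF hlim])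
      then have "liminf (\<lambda>n. ennreal (h z * \<mu> (e n) z)) = ennreal (h z)" by (intro lim_imp_Liminf) auto
      moreover have "norm (h z) = h z" by (simp add: h_def)
      ultimately show "ennreal (norm (h z)) = liminf (\<lambda>n. ennreal (h z * \<mu> (e n) z))" by simp
    qed
    also have "\<dots> \<le> liminf (\<lambda>n. \<integral>\<^sup>+z. ennreal (h z * \<mu> (e n) z) \<partial>lebesgue)"
    proof (rule nn_integral_liminf)
      show "(\<lambda>z. ennreal (h z * \<mu> (e n) z)) \<in> borel_measurable lebesgue" for n
        using borel_measurable_integrable[OF integrable_source(1)[OF e(1)[of n]]] by (simp add: heq)
    qed
    also have "\<dots> \<le> liminf (\<lambda>n. ennreal D)"
    proof (rule Liminf_mono, rule always_eventually, rule allI)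
      fix n
      have "(\<integral>\<^sup>+z. ennreal (h z * \<mu> (e n) z) \<partial>lebesgue) = ennreal (I (e n))"
        unfolding I_def heq
        by (rule nn_integral_eq_integral)
           (use integrable_source(1)[OF e(1)[of n]] \<mu>_props(6)[OF e(1)] in \<open>auto simp: heq h_def\<close>)
      then show "(\<integral>\<^sup>+z. ennreal (h z * \<mu> (e n) z) \<partial>lebesgue) \<le> ennreal D"
        using ID[OF e] by (simp add: ennreal_leI)
    qed
    also have "\<dots> < \<infinity>" by (simp add: Liminf_const)
    finally show "(\<integral>\<^sup>+z. ennreal (norm (h z)) \<partial>lebesgue) < \<infinity>" .
  qed
  have h0: "h z \<ge> 0" for z by (simp add: h_def)
  have Ilim: "(\<lambda>n. I (e n)) \<longlonglongrightarrow> (LINT z|lebesgue. h z)"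
    unfolding I_def heq
  proof (rule integral_dominated_convergence[OF hm _ ih])
    show "(\<lambda>z. h z * \<mu> (e n) z) \<in> borel_measurable lebesgue" for n
      using borel_measurable_integrable[OF integrable_source(1)[OF e(1)[of n]]] by (simp add: heq)
    show "AE z in lebesgue. norm (h z * \<mu> (e n) z) \<le> h z" for n
      using h0 \<mu>1 \<mu>_props(6)[OF e(1)] by (auto intro!: AE_I2 mult_left_le simp: abs_mult)
  qed (use hlim in auto)
  have heq': "\<bar>w z\<bar> powr q * (\<sigma> (e n) z * \<mu> (e n) z) = h z * (\<sigma> (e n) z * \<mu> (e n) z)" for n z
    by (cases "z \<in> half_space") (simp_all add: h_def \<mu>0)
  have Jlim: "(\<lambda>n. J (e n)) \<longlonglongrightarrow> (LINT z::real \<times> (real ^ 'n)|lebesgue. 0)"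
    unfolding J_def heq'
  proof (rule integral_dominated_convergence[OF _ _ ih])
    show "(\<lambda>z. h z * (\<sigma> (e n) z * \<mu> (e n) z)) \<in> borel_measurable lebesgue" for n
      using borel_measurable_integrable[OF integrable_source(2)[OF e(1)[of n]]] by (simp add: heq')
    show "AE z in lebesgue. norm (h z * (\<sigma> (e n) z * \<mu> (e n) z)) \<le> h z" for n
    proof (rule AE_I2)
      fix z
      have "0 \<le> \<sigma> (e n) z * \<mu> (e n) z"
        using \<mu>_props(6)[OF e(1)] by (auto simp: \<sigma>_def par_radius_nonneg)
      then show "norm (h z * (\<sigma> (e n) z * \<mu> (e n) z)) \<le> h z"
        using mult_left_le[OF s1[of n z] h0[of z]] mult_nonneg_nonneg[OF h0[of z]] by simp
    qed
    show "AE z in lebesgue. (\<lambda>n. h z * (\<sigma> (e n) z * \<mu> (e n) z)) \<longlonglongrightarrow> 0"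
    proof (rule AE_I2)
      fix z
      show "(\<lambda>n. h z * (\<sigma> (e n) z * \<mu> (e n) z)) \<longlonglongrightarrow> 0"
      proof (cases "z \<in> half_space")
        case True
        show ?thesis
          using tendsto_mult[OF tendsto_const[of "h z"] tendsto_mult[OF \<mu>lim(2)[OF True] \<mu>lim(1)[OF True]]] by simp
      qed (simp add: h_def)
    qed
  qed simp
  define N where "N = (LINT z|lebesgue. h z)"
  have N1: "N \<le> C * (\<eta> + \<eta> powr (1 - p) * (A powr (- (a / (q - a))) + A powr (- (1 / (q - 1)))))"
    if "0 < \<eta>" "\<eta> \<le> 1" "0 < A" for \<eta> A
  proof (rule LIMSEQ_le[OF Ilim[folded N_def]])
    show "(\<lambda>n. C * (\<eta> + \<eta> powr (1 - p) * (A powr (- (a / (q - a))) + A powr (- (1 / (q - 1))))) + C * \<eta> powr (1 - p) * A * J (e n))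
      \<longlonglongrightarrow> C * (\<eta> + \<eta> powr (1 - p) * (A powr (- (a / (q - a))) + A powr (- (1 / (q - 1)))))"
      using tendsto_add[OF tendsto_const tendsto_mult[OF tendsto_const Jlim]] by simp
  qed (use est[OF that e] in blast)
  \<comment> \<open>\<open>A\<close> tends to infinity with \<eta> fixed, so the factor
    \<eta>^(1-p), large for small \<eta>, is a constant here; only then may \<eta> tend to
    0.\<close>
  have N2: "N \<le> C * \<eta>" if \<eta>: "0 < \<eta>" "\<eta> \<le> 1" for \<eta>
  proof (rule tendsto_lowerbound)
    have z: "((\<lambda>A::real. A powr (- x)) \<longlongrightarrow> 0) at_top" if "x > 0" for x
      using that by (intro tendsto_neg_powr filterlim_ident) auto
    have "((\<lambda>A. C * (\<eta> + \<eta> powr (1 - p) * (A powr (- (a / (q - a))) + A powr (- (1 / (q - 1))))))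
       \<longlongrightarrow> C * (\<eta> + \<eta> powr (1 - p) * (0 + 0))) at_top"
      by (intro tendsto_intros z) (use a q in auto)
    then show "((\<lambda>A. C * (\<eta> + \<eta> powr (1 - p) * (A powr (- (a / (q - a))) + A powr (- (1 / (q - 1)))))) \<longlongrightarrow> C * \<eta>) at_top"
      by simp
    show "eventually (\<lambda>A. N \<le> C * (\<eta> + \<eta> powr (1 - p) * (A powr (- (a / (q - a))) + A powr (- (1 / (q - 1)))))) at_top"
      using eventually_gt_at_top[of "0::real"] by eventually_elim (rule N1[OF \<eta>])
  qed simp
  have "N \<le> 0"
  proof (rule tendsto_lowerbound)
    show "((\<lambda>\<eta>. C * \<eta>) \<longlongrightarrow> 0) (at_right 0)" by (auto intro!: tendsto_eq_intros)
    have "eventually (\<lambda>\<eta>::real. \<eta> \<in> {0<..<1}) (at_right 0)"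
      by (rule eventually_at_right_real) simp
    then show "eventually (\<lambda>\<eta>. N \<le> C * \<eta>) (at_right 0)"
      by eventually_elim (auto intro: N2)
  qed simp
  moreover have "N \<ge> 0" unfolding N_def by (intro Bochner_Integration.integral_nonneg h0)
  ultimately have "N = 0" by simp
  then have "AE z in lebesgue. h z = 0"
    unfolding N_def using ih h0 by (subst (asm) integral_nonneg_eq_0_iff_AE) auto
  then show ?thesis by eventually_elim (auto simp: h_def)
qed

end

section \<open>The comparison principle\<close>

lemma open_half_space: "open (half_space :: (real \<times> (real ^ 'n)) set)"
  by (simp add: half_space_def open_Times)

text \<open>The integral of a non-integrable function is 0 by convention, so the inequalities of two
  super-solutions can be added only once both integrands are known to be integrable.\<close>

lemma set_integrable_weak_form:
  fixes b :: "'i::finite \<Rightarrow> 'a::euclidean_space"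
  assumes \<phi>: "test_fun S \<phi>" and S: "open S" and b: "\<And>i. b i \<in> Basis"
    and L: "L_loc 1 S f0" "\<And>i. L_loc 1 S (f i)" "L_loc 1 S g"
  shows "set_integrable lebesgue S (\<lambda>z. f0 z * \<phi> z + (\<Sum>i\<in>UNIV. f i z * partial (b i) \<phi> z) - g z * \<phi> z)"
proof -
  note i = test_fun_set_integrable(1)[OF \<phi> L(1) S] test_fun_set_integrable(1)[OF \<phi> L(3) S]
    test_fun_set_integrable(2)[OF \<phi> L(2) S b]
  have "integrable lebesgue (\<lambda>z. indicator S z *\<^sub>R (f0 z * \<phi> z)
      + (\<Sum>i\<in>UNIV. indicator S z *\<^sub>R (f i z * partial (b i) \<phi> z)) - indicator S z *\<^sub>R (g z * \<phi> z))"
    using i unfolding set_integrable_def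
    by (intro Bochner_Integration.integrable_add Bochner_Integration.integrable_diff Bochner_Integration.integrable_sum)
  then show ?thesis
    unfolding set_integrable_def by (simp add: algebra_simps sum_distrib_left)
qed

text \<open>Symmetric form of the comparison, with \<open>v\<close> standing for the negative of the
  sub-solution. The work is to verify the abstract hypotheses for the sums of solutions, fluxes and
  sources.\<close>

lemma super_solutions_cancel:
  fixes u v :: "real \<times> (real ^ 'n) \<Rightarrow> real"
  assumes pq: "1 < p" "p \<le> 2" "1 < q" "q \<le> p - 1 + p / real CARD('n)"
    and u: "entire_weak_super_solution p q u" and v: "entire_weak_super_solution p q v"
    and nonneg: "AE z in lebesgue. z \<in> half_space \<longrightarrow> u z + v z \<ge> 0"
  shows "AE z in lebesgue. z \<in> half_space \<longrightarrow> u z + v z = 0"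
proof -
  let ?S = "half_space :: (real \<times> (real ^ 'n)) set"
  have S: "open ?S" by (rule open_half_space)
  have bt: "t_dir \<in> (Basis :: (real \<times> (real ^ 'n)) set)"
    by (simp add: t_dir_def Basis_prod_def)
  have bx: "x_dir i \<in> (Basis :: (real \<times> (real ^ 'n)) set)" for i
    by (auto simp: x_dir_def Basis_prod_def Basis_vec_def)
  obtain ut ux where U: "L_loc q ?S u" "has_weak_partial ?S t_dir u ut"
    "\<And>i. has_weak_partial ?S (x_dir i) u (\<lambda>z. ux z $ i)" "L_loc 1 ?S (\<lambda>z. norm (ux z) powr p)"
    "\<And>\<phi>. test_fun ?S \<phi> \<Longrightarrow> (\<forall>z\<in>?S. \<phi> z \<ge> 0) \<Longrightarrow> (LINT z:?S|lebesgue. ut z * \<phi> z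
       + (\<Sum>i\<in>UNIV. norm (ux z) powr (p - 2) * (ux z $ i) * partial (x_dir i) \<phi> z) - \<bar>u z\<bar> powr (q - 1) * u z * \<phi> z) \<ge> 0"
    using u unfolding entire_weak_super_solution_def by blast
  obtain vt vx where V: "L_loc q ?S v" "has_weak_partial ?S t_dir v vt"
    "\<And>i. has_weak_partial ?S (x_dir i) v (\<lambda>z. vx z $ i)" "L_loc 1 ?S (\<lambda>z. norm (vx z) powr p)"
    "\<And>\<phi>. test_fun ?S \<phi> \<Longrightarrow> (\<forall>z\<in>?S. \<phi> z \<ge> 0) \<Longrightarrow> (LINT z:?S|lebesgue. vt z * \<phi> z
       + (\<Sum>i\<in>UNIV. norm (vx z) powr (p - 2) * (vx z $ i) * partial (x_dir i) \<phi> z) - \<bar>v z\<bar> powr (q - 1) * v z * \<phi> z) \<ge> 0"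
    using v unfolding entire_weak_super_solution_def by blast
  define r where "r = p / (p - 1)"
  have r: "r > 1" "(p - 1) * r = p" using pq(1) by (auto simp: r_def)
  \<comment> \<open>Half of each gap gives \<open>s < p - 1\<close> and \<open>s + 1 < q\<close>; as
    \<open>p - 1 \<le> 1\<close>, the second implies \<open>(s + 1) * (p - 1) < q\<close>.\<close>
  define s where "s = min ((p - 1) / 2) ((q - 1) / 2)"
  have s: "0 < s" "s < p - 1" "(s + 1) * (p - 1) < q"
  proof -
    have "s \<le> (p - 1) / 2" "s \<le> (q - 1) / 2" unfolding s_def by (rule min.cobounded1 min.cobounded2)+
    then have le: "s < p - 1" "s + 1 < q" using pq(1,3) by (simp_all add: field_simps)
    show "0 < s" "s < p - 1" using pq le by (auto simp: s_def)
    then have "(s + 1) * (p - 1) \<le> (s + 1) * 1" using pq by (intro mult_left_mono) auto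
    also have "\<dots> < q" using le by simp
    finally show "(s + 1) * (p - 1) < q" .
  qed
  define k1 where "k1 = p * (q - s) / ((q - s) - (p - 1 - s))"
  define k2 where "k2 = 1 * (q - s) / ((q - s) - (1 - s))"
  define k3 where "k3 = p * q / (q - (s + 1) * (p - 1))"
  define k4 where "k4 = 1 * q / (q - 1)"
  \<comment> \<open>A natural number above all four thresholds; the absolute values avoid a
    discussion of their signs.\<close>
  obtain k :: nat where "real k \<ge> 2 + \<bar>k1\<bar> + \<bar>k2\<bar> + \<bar>k3\<bar> + \<bar>k4\<bar>" using real_arch_simple by blast
  then have k: "real k \<ge> 2" "real k \<ge> k1" "real k \<ge> k2" "real k \<ge> k3" "real k \<ge> k4" by linarith+
  define w where "w z = u z + v z" for z
  define wt where "wt z = ut z + vt z" for z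
  define g where "g z = \<bar>u z\<bar> powr (q - 1) * u z + \<bar>v z\<bar> powr (q - 1) * v z" for z
  define FF where "FF z = p_field p (ux z) + p_field p (vx z)" for z
  define F where "F i z = FF z $ i" for i z
  define X where "X i z = (ux z + vx z) $ i" for i z
  define N where "N z = norm (ux z) powr p + norm (vx z) powr p" for z
  have FF: "(\<chi> i. F i z) = FF z" for z by (simp add: F_def vec_eq_iff)
  have N: "L_loc 1 ?S N" unfolding N_def by (intro L_loc_add U V S)
  have N0: "N z \<ge> 0" for z by (simp add: N_def)
  have nFF: "norm (FF z) \<le> norm (ux z) powr (p - 1) + norm (vx z) powr (p - 1)" for z
    unfolding FF_def using norm_triangle_ineq[of "p_field p (ux z)" "p_field p (vx z)"] by (simp add: norm_p_field)
  have FFr: "norm (FF z) powr r \<le> 2 powr r * N z" for z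
  proof -
    have "norm (FF z) powr r \<le> (norm (ux z) powr (p - 1) + norm (vx z) powr (p - 1)) powr r"
      using r by (intro powr_mono2 nFF) auto
    also have "\<dots> \<le> 2 powr r * ((norm (ux z) powr (p - 1)) powr r + (norm (vx z) powr (p - 1)) powr r)"
      using r by (intro powr_add_le) auto
    finally show ?thesis by (simp add: powr_powr r N_def)
  qed
  have Xp: "norm (ux z + vx z) powr p \<le> 2 powr p * N z" for z
  proof -
    have "norm (ux z + vx z) powr p \<le> (norm (ux z) + norm (vx z)) powr p"
      using pq by (intro powr_mono2 norm_triangle_ineq) auto
    also have "\<dots> \<le> 2 powr p * N z" unfolding N_def using pq by (intro powr_add_le) auto
    finally show ?thesis .
  qed
  have meas: "ux \<in> borel_measurable (lebesgue_on ?S)" "vx \<in> borel_measurable (lebesgue_on ?S)"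
  proof -
    have "(\<lambda>z. ux z $ i) \<in> borel_measurable (lebesgue_on ?S)" "(\<lambda>z. vx z $ i) \<in> borel_measurable (lebesgue_on ?S)" for i
      using U(3)[of i] V(3)[of i] by (auto simp: has_weak_partial_def L_loc_def)
    then show "ux \<in> borel_measurable (lebesgue_on ?S)" "vx \<in> borel_measurable (lebesgue_on ?S)"
      by (auto simp: borel_measurable_euclidean_space[where f = ux] borel_measurable_euclidean_space[where f = vx] Basis_vec_def inner_axis)
  qed
  note [measurable] = meas
  have FFm[measurable]: "FF \<in> borel_measurable (lebesgue_on ?S)"
    unfolding FF_def p_field_def by measurable
  have comp_m: "(\<lambda>z. h z $ i) \<in> borel_measurable (lebesgue_on ?S)"
    if "h \<in> borel_measurable (lebesgue_on ?S)" for h :: "_ \<Rightarrow> real ^ 'n" and i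
    unfolding cart_eq_inner_axis using that by measurable
  \<comment> \<open>The growth \<open>p - 1\<close> of the flux lies below the controlled power
    \<open>p\<close>, and the constant 1 covers small gradients; hence each flux is locally
    integrable.\<close>
  have powr_le: "x powr (p - 1) \<le> 1 + x powr p" if "x \<ge> 0" for x :: real
  proof (cases "x \<le> 1")
    case True
    then show ?thesis using that pq powr_le1[of "p - 1" x] by (simp add: add_increasing2)
  next
    case False
    then have "x powr (p - 1) \<le> x powr p" by (intro powr_mono) auto
    then show ?thesis by simp
  qed
  have single: "L_loc 1 ?S (\<lambda>z. norm (h z) powr (p - 2) * (h z $ i))"
    if h: "h \<in> borel_measurable (lebesgue_on ?S)" "L_loc 1 ?S (\<lambda>z. norm (h z) powr p)" for h :: "_ \<Rightarrow> real ^ 'n" and i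
  proof (rule L_loc_bound[OF _ S])
    note [measurable] = h(1) comp_m[OF h(1), of i]
    show "(\<lambda>z. norm (h z) powr (p - 2) * (h z $ i)) \<in> borel_measurable (lebesgue_on ?S)" by measurable
    show "L_loc 1 ?S (\<lambda>z. 1 + norm (h z) powr p)" by (intro L_loc_add L_loc_const h S)
    fix z
    have "\<bar>norm (h z) powr (p - 2) * (h z $ i)\<bar> \<le> norm (p_field p (h z))"
      using component_le_norm_cart[of "p_field p (h z)" i] by (simp add: p_field_def)
    also have "\<dots> \<le> 1 + norm (h z) powr p" unfolding norm_p_field by (rule powr_le) simp
    finally show "\<bar>norm (h z) powr (p - 2) * (h z $ i)\<bar> \<le> 1 + norm (h z) powr p" .
  qed
  have Feq: "F i z = norm (ux z) powr (p - 2) * (ux z $ i) + norm (vx z) powr (p - 2) * (vx z $ i)" for i z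
    by (simp add: F_def FF_def p_field_def)
  have react: "L_loc 1 ?S (\<lambda>z. \<bar>h z\<bar> powr (q - 1) * h z)" if h: "L_loc q ?S h" for h
  proof (rule L_loc_bound[OF _ S L_loc_abs_powr[OF h]])
    have [measurable]: "h \<in> borel_measurable (lebesgue_on ?S)" using h by (simp add: L_loc_def)
    show "(\<lambda>z. \<bar>h z\<bar> powr (q - 1) * h z) \<in> borel_measurable (lebesgue_on ?S)" by measurable
    show "\<bar>\<bar>h z\<bar> powr (q - 1) * h z\<bar> \<le> \<bar>h z\<bar> powr q" for z
      using powr_mult_base[of "\<bar>h z\<bar>" "q - 1"] by (simp add: abs_mult mult.commute)
  qed
  have Lut: "L_loc 1 ?S ut" "L_loc 1 ?S vt" "L_loc 1 ?S w"
    using U(2) V(2) S unfolding w_def[abs_def] by (auto simp: has_weak_partial_def intro: L_loc_add)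
  \<comment> \<open>The two multiples of \<open>N\<close> dominate the power \<open>r\<close> of the
    flux and the power \<open>p\<close> of the gradient of \<open>w\<close>. Young's inequality
    between values at different points then gives the required product bound.\<close>
  interpret weak_inequality ?S t_dir x_dir w wt g F X "\<lambda>z. 2 powr r * N z" "\<lambda>z. 2 powr p * N z"
  proof
    show "has_weak_partial ?S t_dir w wt"
      unfolding w_def wt_def by (rule has_weak_partial_add[OF U(2) V(2) S bt])
    show "has_weak_partial ?S (x_dir i) w (X i)" for i
      unfolding w_def X_def vector_add_component by (rule has_weak_partial_add[OF U(3) V(3) S bx])
    show "L_loc 1 ?S (F i)" for i
      unfolding Feq by (intro L_loc_add single meas U V S)
    show "L_loc 1 ?S g" unfolding g_def by (intro L_loc_add react U V S)
    show "L_loc 1 ?S (\<lambda>z. 2 powr r * N z)" "L_loc 1 ?S (\<lambda>z. 2 powr p * N z)"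
      by (intro L_loc_cmult N)+
    show "\<bar>F i y\<bar> * \<bar>X i y'\<bar> \<le> 2 powr r * N y + 2 powr p * N y'" for i y y'
    proof -
      have "\<bar>F i y\<bar> * \<bar>X i y'\<bar> \<le> norm (FF y) * norm (ux y' + vx y')"
        unfolding F_def X_def by (intro mult_mono component_le_norm_cart) auto
      also have "\<dots> \<le> norm (FF y) powr r + norm (ux y' + vx y') powr p"
        by (rule Young_powr) (use pq r_def in auto)
      finally show ?thesis using FFr[of y] Xp[of y'] by linarith
    qed
    show "AE z in lebesgue. z \<in> ?S \<longrightarrow> w z \<ge> 0" using nonneg by (simp add: w_def)
    fix \<phi> assume t: "test_fun ?S \<phi>" and \<phi>0: "\<And>z. \<phi> z \<ge> 0"
    have "0 \<le> (LINT z:?S|lebesgue. ut z * \<phi> z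
       + (\<Sum>i\<in>UNIV. norm (ux z) powr (p - 2) * (ux z $ i) * partial (x_dir i) \<phi> z) - \<bar>u z\<bar> powr (q - 1) * u z * \<phi> z)
      + (LINT z:?S|lebesgue. vt z * \<phi> z
       + (\<Sum>i\<in>UNIV. norm (vx z) powr (p - 2) * (vx z $ i) * partial (x_dir i) \<phi> z) - \<bar>v z\<bar> powr (q - 1) * v z * \<phi> z)"
      using U(5)[OF t] V(5)[OF t] \<phi>0 by simp
    also have "\<dots> = (LINT z:?S|lebesgue. (ut z * \<phi> z
       + (\<Sum>i\<in>UNIV. norm (ux z) powr (p - 2) * (ux z $ i) * partial (x_dir i) \<phi> z) - \<bar>u z\<bar> powr (q - 1) * u z * \<phi> z)
      + (vt z * \<phi> z
       + (\<Sum>i\<in>UNIV. norm (vx z) powr (p - 2) * (vx z $ i) * partial (x_dir i) \<phi> z) - \<bar>v z\<bar> powr (q - 1) * v z * \<phi> z))"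
      by (rule set_integral_add(2)[symmetric]; rule set_integrable_weak_form[OF t S bx]; intro Lut single react meas U V)
    also have "\<dots> = (LINT z:?S|lebesgue. wt z * \<phi> z + (\<Sum>i\<in>UNIV. F i z * partial (x_dir i) \<phi> z) - g z * \<phi> z)"
      by (simp add: wt_def Feq g_def algebra_simps sum.distrib)
    finally show "0 \<le> (LINT z:?S|lebesgue. wt z * \<phi> z + (\<Sum>i\<in>UNIV. F i z * partial (x_dir i) \<phi> z) - g z * \<phi> z)" .
  qed (use S bt bx N0 in auto)
  \<comment> \<open>\<open>2 powr (1 - r)\<close> and \<open>2 powr (- q)\<close> are the constants
    of \<open>p_field_coercive\<close> and \<open>signed_powr_add_ge\<close>.\<close>
  interpret comparison w wt g F X "\<lambda>z. 2 powr r * N z" "\<lambda>z. 2 powr p * N z" p q r s k "2 powr (1 - r)" "2 powr (- q)"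
  proof
    show "2 powr (1 - r) * norm (\<chi> i. F i z) powr r \<le> (\<Sum>i\<in>UNIV. F i z * X i z)" for z
      using p_field_coercive[OF pq(1,2) r_def, of "ux z" "vx z"]
      unfolding FF by (simp add: F_def X_def FF_def[symmetric] inner_vec_def)
    show "2 powr (- q) * \<bar>w z\<bar> powr q \<le> g z" if "w z \<ge> 0" for z
      using signed_powr_add_ge[OF pq(3), of "u z" "v z"] that by (simp add: w_def g_def)
    show "L_loc 1 ?S (\<lambda>z. norm (\<chi> i. F i z) powr r)"
      unfolding FF
      by (rule L_loc_bound[OF _ S L_loc_cmult[OF N, of "2 powr r"]]) (measurable, simp add: FFr)
    show "L_loc 1 ?S (\<lambda>z. \<bar>w z\<bar> powr q)"
    proof (rule L_loc_bound[OF _ S])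
      have [measurable]: "w \<in> borel_measurable (lebesgue_on ?S)" using Lut(3) by (simp add: L_loc_def)
      show "(\<lambda>z. \<bar>w z\<bar> powr q) \<in> borel_measurable (lebesgue_on ?S)" by measurable
      show "L_loc 1 ?S (\<lambda>z. 2 powr q * (\<bar>u z\<bar> powr q + \<bar>v z\<bar> powr q))"
        by (intro L_loc_cmult L_loc_add L_loc_abs_powr U V S)
      fix z
      have "\<bar>w z\<bar> powr q \<le> (\<bar>u z\<bar> + \<bar>v z\<bar>) powr q" unfolding w_def using pq by (intro powr_mono2) auto
      also have "\<dots> \<le> 2 powr q * (\<bar>u z\<bar> powr q + \<bar>v z\<bar> powr q)" using pq by (intro powr_add_le) auto
      finally show "\<bar>\<bar>w z\<bar> powr q\<bar> \<le> 2 powr q * (\<bar>u z\<bar> powr q + \<bar>v z\<bar> powr q)" by simp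
    qed
  qed (use pq r_def s k in \<open>auto simp: k1_def k2_def k3_def k4_def\<close>)
  show ?thesis using vanishes by (simp add: w_def)
qed

theorem theorem1:
  fixes p q :: real and u v :: "real \<times> (real ^ 'n) \<Rightarrow> real"
  assumes "1 < p" and "p \<le> 2"
    and "1 < q" and "q \<le> p - 1 + p / real CARD('n)"
    and "entire_weak_super_solution p q u"
    and "entire_weak_sub_solution p q v"
    and "AE z in lebesgue_on half_space. u z \<ge> v z"
  shows "AE z in lebesgue_on half_space. u z = v z"
proof -
  have S: "half_space \<inter> space lebesgue \<in> sets (lebesgue :: (real \<times> (real ^ 'n)) measure)"
    using open_half_space[where 'n = 'n] by simp
  have "AE z in lebesgue. z \<in> half_space \<longrightarrow> u z + - v z \<ge> 0"
    using assms(7) by (simp add: AE_restrict_space_iff[OF S])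
  from super_solutions_cancel[OF assms(1-5) assms(6)[unfolded entire_weak_sub_solution_def] this]
  show ?thesis by (simp add: AE_restrict_space_iff[OF S])
qed

end
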